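(* Let $\varphi(x,y)$ be a $\Delta^b_1(\triangleleft)$ formula with parameters from $\mathbb I$, let $p,h\in\mathbb I$ and $o\in\mathbb O$, and let $\{T^+_{a,b}\}_{a<p,b<h}$ (together with $\{T^-_{a,b}\}_{a<p,b<h}$) be definable families such that for each $a<p,b<h$, $T^+_{a,b}$ and $T^-_{a,b}$ are disjoint with union an $o$-tree of depth at most $|n|^c$ ($c$ standard, depending only on $\varphi$), and $\mathsf{S}^1_2(\triangleleft)$ proves, for all $a<p,b<h$, $(\neg\mathsf{MIN}(\triangleleft)_n\land\text{“}\triangleleft\text{ extends }o\text{”})\to(\varphi(a,b)\leftrightarrow\text{“}\triangleleft\text{ extends some }o'\in T^+_{a,b}\text{”})$ and $(\neg\mathsf{MIN}(\triangleleft)_n\land\text{“}\triangleleft\text{ extends }o\text{”})\to(\neg\varphi(a,b)\leftrightarrow\text{“}\triangleleft\text{ extends some }o'\in T^-_{a,b}\text{”})$. Suppose at least one of the following holds: (i) there exist $a\ne b<p$ and $c<h$ and $o'\in T^+_{a,c}$, $o''\in T^+_{b,c}$ with $o'\parallel o''$; (ii) there exist $a<p$ and $b\ne c<h$ and $o'\in T^+_{a,b}$, $o''\in T^+_{a,c}$ with $o'\parallel o''$; (iii) there exist $o'\preceq o$ and $a<p$ such that for all $b<h$ and all $o''\in T^+_{a,b}$, $o'\perp o''$. Then there exists $o^*\in\mathbb O$ extending $o$ such that, assuming $P_{\mathsf{MIN}}$ uses the strategy $\mathcal S_{\mathsf{MIN}}$ described in the context and $P_{\mathsf{IND}}$ uses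 a strategy $\mathcal S_{\mathsf{IND}}$ winning for $P_{\mathsf{IND}}$, the formula $\varphi(x,y)$ does not define the graph of an injective function from $[0,\dots,p)$ into $[0,\dots,h)$ in any expansion $\mathbb I_\triangleleft$ constructed in a play of $G_{\mathbb O}$ in which $P_{\mathsf{PHP}}$ plays $o^*$.
   Context: $\mathbb M$ is a countable nonstandard model of true arithmetic in the language $\{0,1,+,\cdot,|\cdot|,\lfloor\cdot/2\rfloor,\#,\le\}$ ($|x|$ bit length, $x\#y=2^{|x||y|}$); $n\in\mathbb M$ nonstandard; $[0,\dots,n)=\{0,\dots,n-1\}$; $\mathbb I$ is the substructure of $\mathbb M$ with domain $\{m:m\le2^{|n|^c}$ for some standard $c\}$; "definable" means definable in $\mathbb M$. Conditions: $\mathbb O$ is the set of sequences (in $\mathbb M$) of distinct numbers from $[0,\dots,n)$ of length at most $|n|^c$ for some standard $c$; $o$ induces the strict order $\triangleleft_o$ on its entries $\mathrm{el}(o)$ by listing order; $o'\preceq o$ ($o'$ extends $o$) if $\triangleleft_{o'}\supseteq\triangleleft_o$; $o\parallel o'$ (compatible) if some element of $\mathbb O$ extends both, otherwise $o\perp o'$; “$\triangleleft$ extends $o$” means $\triangleleft\supseteq\triangleleft_o$. $o$-tree: a definable $T\subseteq\mathbb O$ with either $T=\{o\}$ or, for a single $a\notin\mathrm{el}(o)$ in $[0,\dots,n)$, $T=\bigcup_{o'\in A}T_{o'}$ where $A$ is the set of all extensions of $o$ with domain $\mathrm{el}(o)\cup\{a\}$ and each $T_{o'}$ an $o'$-tree;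 depth = largest difference between the length of a member and the length of $o$. Game $G_{\mathbb O}$: players $P_{\mathsf{MIN}},P_{\mathsf{IND}},P_{\mathsf{PHP}}$ move at stages $k\equiv0,1,2\pmod3$ respectively, countably many stages; $o_0$ empty; at stage $k$ the player receives $o_k$ and picks $o_{k+1}\in\mathbb O$ with $o_{k+1}\preceq o_k$. A strategy is a function $\mathcal S:\mathbb O\to\mathbb O$ with $\mathcal S(o)\preceq o$. The play yields $\triangleleft=\bigcup_i\triangleleft_{o_i}$ and $\mathbb I_\triangleleft$ is $\mathbb I$ expanded by it. A strategy of $P_{\mathsf{IND}}$ is winning if, whatever the others play, $\mathbb I_\triangleleft$ satisfies induction for all $\Sigma^b_1(\triangleleft)$ formulas. The strategy $\mathcal S_{\mathsf{MIN}}$: $P_{\mathsf{MIN}}$ fixes an external enumeration (queue) of all elements of $[0,\dots,n)$; given $o=(a_1,\dots,a_m)$ it takes the first element $a$ of the queue not among $a_1,\dots,a_m$ and plays $(a,a_1,\dots,a_m)$; this guarantees that $\triangleleft$ is a strict linear order of $[0,\dots,n)$ with no least element. Formula classes: $\Sigma^b_1(\triangleleft)$ is the smallest class containing sharply bounded formulas in the language with $\triangleleft$ and closed under $\land,\lor$, sharply bounded quantifiers and bounded existential quantifiers. $\mathsf{S}^1_2(\triangleleft)$ is Buss's $\mathsf{BASIC}$ plus polynomial induction for $\Sigma^b_1(\triangleleft)$ formulas. $\Delta^b_1(\triangleleft)$ formulas are $\Sigma^b_1(\triangleleft)$ formulas $\mathsf{S}^1_2(\triangleleft)$-provably equivalent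 to negations of $\Sigma^b_1(\triangleleft)$ formulas. $\mathsf{MIN}(\triangleleft)_n$ is the sentence: either $\triangleleft$ fails to be a strict linear order on $[0,\dots,n)$ (irreflexivity, antisymmetry, totality on distinct elements, or transitivity fails, each expressed by a bounded existential over elements $<n$) or $\exists x<n\,\forall y<n(x=y\lor x\triangleleft y)$. *)

theory Defs
  imports Main "HOL-Library.Countable_Set"
begin

section \<open>Syntax\<close>

text \<open>De Bruijn variables; \<open>Par c\<close> is a constant naming the parameter \<open>c\<close>.\<close>

datatype (params_tm: 'c) tm =
    Var nat
  | Par 'c
  | Zero
  | One
  | Add "'c tm" "'c tm"
  | Mul "'c tm" "'c tm"
  | Len "'c tm"
  | Half "'c tm"
  | Smash "'c tm" "'c tm"

text \<open>\<open>Tri\<close> is the symbol \<open>\<triangleleft>\<close>. The symbols \<open>Fam True\<close> and \<open>Fam False\<close> name the two families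
  \<open>T\<^sup>+\<close>, \<open>T\<^sup>-\<close> of sets (\<open>Fam True a b z\<close> says \<open>z \<in> T\<^sup>+\<^bsub>a,b\<^esub>\<close>); they belong neither to the language of
  arithmetic nor to its expansion by \<open>\<triangleleft>\<close>, see \<open>diagram\<close> below.\<close>

datatype (params: 'c) fm =
    Eq "'c tm" "'c tm"
  | Le "'c tm" "'c tm"
  | Tri "'c tm" "'c tm"
  | Fam bool "'c tm" "'c tm" "'c tm"
  | Neg "'c fm"
  | And "'c fm" "'c fm"
  | Or "'c fm" "'c fm"
  | Imp "'c fm" "'c fm"
  | All "'c fm"
  | Ex "'c fm"

primrec tri_free :: "'c fm \<Rightarrow> bool" where
  "tri_free (Eq s t) = True"
| "tri_free (Le s t) = True"
| "tri_free (Tri s t) = False"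
| "tri_free (Fam b r s t) = True"
| "tri_free (Neg p) = tri_free p"
| "tri_free (And p q) = (tri_free p \<and> tri_free q)"
| "tri_free (Or p q) = (tri_free p \<and> tri_free q)"
| "tri_free (Imp p q) = (tri_free p \<and> tri_free q)"
| "tri_free (All p) = tri_free p"
| "tri_free (Ex p) = tri_free p"

primrec fam_free :: "'c fm \<Rightarrow> bool" where
  "fam_free (Eq s t) = True"
| "fam_free (Le s t) = True"
| "fam_free (Tri s t) = True"
| "fam_free (Fam b r s t) = False"
| "fam_free (Neg p) = fam_free p"
| "fam_free (And p q) = (fam_free p \<and> fam_free q)"
| "fam_free (Or p q) = (fam_free p \<and> fam_free q)"
| "fam_free (Imp p q) = (fam_free p \<and> fam_free q)"
| "fam_free (All p) = fam_free p"
| "fam_free (Ex p) = fam_free p"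

abbreviation arith_fm :: "'c fm \<Rightarrow> bool" where
  "arith_fm p \<equiv> tri_free p \<and> fam_free p"

primrec fv_tm :: "'c tm \<Rightarrow> nat set" where
  "fv_tm (Var i) = {i}"
| "fv_tm (Par c) = {}"
| "fv_tm Zero = {}"
| "fv_tm One = {}"
| "fv_tm (Add s t) = fv_tm s \<union> fv_tm t"
| "fv_tm (Mul s t) = fv_tm s \<union> fv_tm t"
| "fv_tm (Len t) = fv_tm t"
| "fv_tm (Half t) = fv_tm t"
| "fv_tm (Smash s t) = fv_tm s \<union> fv_tm t"

primrec fv :: "'c fm \<Rightarrow> nat set" where
  "fv (Eq s t) = fv_tm s \<union> fv_tm t"
| "fv (Le s t) = fv_tm s \<union> fv_tm t"
| "fv (Tri s t) = fv_tm s \<union> fv_tm t"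
| "fv (Fam b r s t) = fv_tm r \<union> fv_tm s \<union> fv_tm t"
| "fv (Neg p) = fv p"
| "fv (And p q) = fv p \<union> fv q"
| "fv (Or p q) = fv p \<union> fv q"
| "fv (Imp p q) = fv p \<union> fv q"
| "fv (All p) = {i. Suc i \<in> fv p}"
| "fv (Ex p) = {i. Suc i \<in> fv p}"

primrec subst_tm :: "(nat \<Rightarrow> 'c tm) \<Rightarrow> 'c tm \<Rightarrow> 'c tm" where
  "subst_tm \<sigma> (Var i) = \<sigma> i"
| "subst_tm \<sigma> (Par c) = Par c"
| "subst_tm \<sigma> Zero = Zero"
| "subst_tm \<sigma> One = One"
| "subst_tm \<sigma> (Add s t) = Add (subst_tm \<sigma> s) (subst_tm \<sigma> t)"
| "subst_tm \<sigma> (Mul s t) = Mul (subst_tm \<sigma> s) (subst_tm \<sigma> t)"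
| "subst_tm \<sigma> (Len t) = Len (subst_tm \<sigma> t)"
| "subst_tm \<sigma> (Half t) = Half (subst_tm \<sigma> t)"
| "subst_tm \<sigma> (Smash s t) = Smash (subst_tm \<sigma> s) (subst_tm \<sigma> t)"

abbreviation shift :: "nat \<Rightarrow> 'c tm \<Rightarrow> 'c tm" where
  "shift k \<equiv> subst_tm (\<lambda>i. Var (i + k))"

definition up :: "(nat \<Rightarrow> 'c tm) \<Rightarrow> nat \<Rightarrow> 'c tm" where
  "up \<sigma> = case_nat (Var 0) (\<lambda>i. shift 1 (\<sigma> i))"

primrec subst :: "(nat \<Rightarrow> 'c tm) \<Rightarrow> 'c fm \<Rightarrow> 'c fm" where
  "subst \<sigma> (Eq s t) = Eq (subst_tm \<sigma> s) (subst_tm \<sigma> t)"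
| "subst \<sigma> (Le s t) = Le (subst_tm \<sigma> s) (subst_tm \<sigma> t)"
| "subst \<sigma> (Tri s t) = Tri (subst_tm \<sigma> s) (subst_tm \<sigma> t)"
| "subst \<sigma> (Fam b r s t) = Fam b (subst_tm \<sigma> r) (subst_tm \<sigma> s) (subst_tm \<sigma> t)"
| "subst \<sigma> (Neg p) = Neg (subst \<sigma> p)"
| "subst \<sigma> (And p q) = And (subst \<sigma> p) (subst \<sigma> q)"
| "subst \<sigma> (Or p q) = Or (subst \<sigma> p) (subst \<sigma> q)"
| "subst \<sigma> (Imp p q) = Imp (subst \<sigma> p) (subst \<sigma> q)"
| "subst \<sigma> (All p) = All (subst (up \<sigma>) p)"
| "subst \<sigma> (Ex p) = Ex (subst (up \<sigma>) p)"

definition lift :: "'c fm \<Rightarrow> 'c fm" where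
  "lift p = subst (\<lambda>i. Var (Suc i)) p"

definition inst :: "'c tm \<Rightarrow> 'c fm \<Rightarrow> 'c fm" where
  "inst t p = subst (case_nat t Var) p"

abbreviation Iff :: "'c fm \<Rightarrow> 'c fm \<Rightarrow> 'c fm" where
  "Iff p q \<equiv> And (Imp p q) (Imp q p)"

abbreviation Neq :: "'c tm \<Rightarrow> 'c tm \<Rightarrow> 'c fm" where
  "Neq s t \<equiv> Neg (Eq s t)"

abbreviation Lt :: "'c tm \<Rightarrow> 'c tm \<Rightarrow> 'c fm" where
  "Lt s t \<equiv> And (Le s t) (Neq s t)"

text \<open>Bounded quantifiers: the bound is shifted, so it does not contain the bound variable.\<close>

definition BAll :: "'c tm \<Rightarrow> 'c fm \<Rightarrow> 'c fm" where
  "BAll t p = All (Imp (Le (Var 0) (shift 1 t)) p)"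

definition BEx :: "'c tm \<Rightarrow> 'c fm \<Rightarrow> 'c fm" where
  "BEx t p = Ex (And (Le (Var 0) (shift 1 t)) p)"

definition BAll_lt :: "'c tm \<Rightarrow> 'c fm \<Rightarrow> 'c fm" where
  "BAll_lt t p = All (Imp (Lt (Var 0) (shift 1 t)) p)"

definition BEx_lt :: "'c tm \<Rightarrow> 'c fm \<Rightarrow> 'c fm" where
  "BEx_lt t p = Ex (And (Lt (Var 0) (shift 1 t)) p)"

section \<open>Structures\<close>

record 'a arith =
  univ :: "'a set"
  zero_of :: 'a ("\<zero>\<index>")
  one_of :: 'a ("\<one>\<index>")
  plus_of :: "'a \<Rightarrow> 'a \<Rightarrow> 'a" (infixl "\<oplus>\<index>" 65)
  times_of :: "'a \<Rightarrow> 'a \<Rightarrow> 'a" (infixl "\<otimes>\<index>" 70)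
  len_of :: "'a \<Rightarrow> 'a"
  half_of :: "'a \<Rightarrow> 'a"
  smash_of :: "'a \<Rightarrow> 'a \<Rightarrow> 'a" (infixl "\<sharp>\<index>" 75)
  le_of :: "'a \<Rightarrow> 'a \<Rightarrow> bool" (infix "\<sqsubseteq>\<index>" 50)
  tri_of :: "'a \<Rightarrow> 'a \<Rightarrow> bool"
  fam_of :: "bool \<Rightarrow> 'a \<Rightarrow> 'a \<Rightarrow> 'a \<Rightarrow> bool"

definition lt_of :: "'a arith \<Rightarrow> 'a \<Rightarrow> 'a \<Rightarrow> bool" (infix "\<sqsubset>\<index>" 50) where
  "x \<sqsubset>\<^bsub>A\<^esub> y \<longleftrightarrow> x \<sqsubseteq>\<^bsub>A\<^esub> y \<and> x \<noteq> y"

definition below :: "'a arith \<Rightarrow> 'a \<Rightarrow> 'a set" where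
  "below A m = {x \<in> univ A. x \<sqsubset>\<^bsub>A\<^esub> m}"

primrec tval :: "'a arith \<Rightarrow> ('c \<Rightarrow> 'a) \<Rightarrow> (nat \<Rightarrow> 'a) \<Rightarrow> 'c tm \<Rightarrow> 'a" where
  "tval A \<iota> e (Var i) = e i"
| "tval A \<iota> e (Par c) = \<iota> c"
| "tval A \<iota> e Zero = \<zero>\<^bsub>A\<^esub>"
| "tval A \<iota> e One = \<one>\<^bsub>A\<^esub>"
| "tval A \<iota> e (Add s t) = tval A \<iota> e s \<oplus>\<^bsub>A\<^esub> tval A \<iota> e t"
| "tval A \<iota> e (Mul s t) = tval A \<iota> e s \<otimes>\<^bsub>A\<^esub> tval A \<iota> e t"
| "tval A \<iota> e (Len t) = len_of A (tval A \<iota> e t)"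
| "tval A \<iota> e (Half t) = half_of A (tval A \<iota> e t)"
| "tval A \<iota> e (Smash s t) = tval A \<iota> e s \<sharp>\<^bsub>A\<^esub> tval A \<iota> e t"

primrec sat :: "'a arith \<Rightarrow> ('c \<Rightarrow> 'a) \<Rightarrow> (nat \<Rightarrow> 'a) \<Rightarrow> 'c fm \<Rightarrow> bool" where
  "sat A \<iota> e (Eq s t) \<longleftrightarrow> tval A \<iota> e s = tval A \<iota> e t"
| "sat A \<iota> e (Le s t) \<longleftrightarrow> tval A \<iota> e s \<sqsubseteq>\<^bsub>A\<^esub> tval A \<iota> e t"
| "sat A \<iota> e (Tri s t) \<longleftrightarrow> tri_of A (tval A \<iota> e s) (tval A \<iota> e t)"
| "sat A \<iota> e (Fam b r s t) \<longleftrightarrow> fam_of A b (tval A \<iota> e r) (tval A \<iota> e s) (tval A \<iota> e t)"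
| "sat A \<iota> e (Neg p) \<longleftrightarrow> \<not> sat A \<iota> e p"
| "sat A \<iota> e (And p q) \<longleftrightarrow> sat A \<iota> e p \<and> sat A \<iota> e q"
| "sat A \<iota> e (Or p q) \<longleftrightarrow> sat A \<iota> e p \<or> sat A \<iota> e q"
| "sat A \<iota> e (Imp p q) \<longleftrightarrow> (sat A \<iota> e p \<longrightarrow> sat A \<iota> e q)"
| "sat A \<iota> e (All p) \<longleftrightarrow> (\<forall>x\<in>univ A. sat A \<iota> (case_nat x e) p)"
| "sat A \<iota> e (Ex p) \<longleftrightarrow> (\<exists>x\<in>univ A. sat A \<iota> (case_nat x e) p)"

text \<open>Truth of the universal closure.\<close>

definition valid :: "'a arith \<Rightarrow> ('c \<Rightarrow> 'a) \<Rightarrow> 'c fm \<Rightarrow> bool" where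
  "valid A \<iota> p \<longleftrightarrow> (\<forall>e. range e \<subseteq> univ A \<longrightarrow> sat A \<iota> e p)"

definition closed_struct :: "'a arith \<Rightarrow> bool" where
  "closed_struct A \<longleftrightarrow> \<zero>\<^bsub>A\<^esub> \<in> univ A \<and> \<one>\<^bsub>A\<^esub> \<in> univ A \<and>
     (\<forall>x\<in>univ A. len_of A x \<in> univ A \<and> half_of A x \<in> univ A) \<and>
     (\<forall>x\<in>univ A. \<forall>y\<in>univ A. x \<oplus>\<^bsub>A\<^esub> y \<in> univ A \<and> x \<otimes>\<^bsub>A\<^esub> y \<in> univ A \<and> x \<sharp>\<^bsub>A\<^esub> y \<in> univ A)"

definition bit_length :: "nat \<Rightarrow> nat" where
  "bit_length x = (LEAST k. x < 2 ^ k)"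

definition std :: "nat arith" where
  "std = \<lparr>univ = UNIV, zero_of = 0, one_of = 1, plus_of = (+), times_of = (*),
     len_of = bit_length, half_of = (\<lambda>x. x div 2),
     smash_of = (\<lambda>x y. 2 ^ (bit_length x * bit_length y)), le_of = (\<le>),
     tri_of = (\<lambda>_ _. False), fam_of = (\<lambda>_ _ _ _. False)\<rparr>"

definition true_arith_model :: "'a arith \<Rightarrow> bool" where
  "true_arith_model M \<longleftrightarrow> closed_struct M \<and>
     (\<forall>p :: unit fm. arith_fm p \<and> params p = {} \<and> valid std (\<lambda>_. 0) p \<longrightarrow> valid M (\<lambda>_. \<zero>\<^bsub>M\<^esub>) p)"

definition standard :: "'a arith \<Rightarrow> 'a \<Rightarrow> bool" where
  "standard M x \<longleftrightarrow> (\<exists>k :: nat. x = ((\<lambda>y. y \<oplus>\<^bsub>M\<^esub> \<one>\<^bsub>M\<^esub>) ^^ k) \<zero>\<^bsub>M\<^esub>)"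

text \<open>Definability with parameters; a \<open>k\<close>-ary relation is a set of lists of length \<open>k\<close>.\<close>

definition definable :: "'a arith \<Rightarrow> 'a list set \<Rightarrow> bool" where
  "definable M X \<longleftrightarrow> (\<exists>k (p :: 'a fm). arith_fm p \<and> params p \<subseteq> univ M \<and> fv p \<subseteq> {..<k} \<and>
     X = {xs. length xs = k \<and> set xs \<subseteq> univ M \<and> sat M id ((!) xs) p})"

text \<open>\<open>|n|\<^sup>c\<close> for standard \<open>c\<close>\<close>

definition len_pow :: "'a arith \<Rightarrow> 'a \<Rightarrow> nat \<Rightarrow> 'a" where
  "len_pow M n c = ((\<lambda>y. len_of M n \<otimes>\<^bsub>M\<^esub> y) ^^ c) \<one>\<^bsub>M\<^esub>"

text \<open>The structure \<open>\<I>\<close>. As \<open>x \<sharp> y\<close> is \<open>2\<close> to the power \<open>|x||y|\<close> and \<open>|1| = 1\<close>, the bound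
  \<open>1 \<sharp> z\<close> with \<open>|z| = |n|\<^sup>c\<close> is \<open>2\<close> to the power \<open>|n|\<^sup>c\<close>.\<close>

definition cut :: "'a arith \<Rightarrow> 'a \<Rightarrow> 'a arith" where
  "cut M n = M\<lparr>univ := {m \<in> univ M. \<exists>c. \<exists>z\<in>univ M.
     len_of M z = len_pow M n c \<and> m \<sqsubseteq>\<^bsub>M\<^esub> \<one>\<^bsub>M\<^esub> \<sharp>\<^bsub>M\<^esub> z}\<rparr>"

definition cut_tri :: "'a arith \<Rightarrow> 'a \<Rightarrow> ('a \<Rightarrow> 'a \<Rightarrow> bool) \<Rightarrow> 'a arith" where
  "cut_tri M n R = (cut M n)\<lparr>tri_of := R\<rparr>"

section \<open>Provability and the theory \<open>S\<^sup>1\<^sub>2(\<triangleleft>)\<close>\<close>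

text \<open>Classical natural deduction with equality. The formulas of the theory \<open>T\<close> are implicitly
  universally closed: only the local hypotheses \<open>H\<close> are lifted in \<open>AllI\<close> and \<open>ExE\<close>.\<close>

inductive proves :: "'c fm set \<Rightarrow> 'c fm set \<Rightarrow> 'c fm \<Rightarrow> bool" for T where
  Axiom: "p \<in> T \<Longrightarrow> proves T H p"
| Hyp: "p \<in> H \<Longrightarrow> proves T H p"
| ImpI: "proves T (insert p H) q \<Longrightarrow> proves T H (Imp p q)"
| ImpE: "proves T H (Imp p q) \<Longrightarrow> proves T H p \<Longrightarrow> proves T H q"
| NegI: "proves T (insert p H) q \<Longrightarrow> proves T (insert p H) (Neg q) \<Longrightarrow> proves T H (Neg p)"
| NegNegE: "proves T H (Neg (Neg p)) \<Longrightarrow> proves T H p"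
| AndI: "proves T H p \<Longrightarrow> proves T H q \<Longrightarrow> proves T H (And p q)"
| AndE1: "proves T H (And p q) \<Longrightarrow> proves T H p"
| AndE2: "proves T H (And p q) \<Longrightarrow> proves T H q"
| OrI1: "proves T H p \<Longrightarrow> proves T H (Or p q)"
| OrI2: "proves T H q \<Longrightarrow> proves T H (Or p q)"
| OrE: "proves T H (Or p q) \<Longrightarrow> proves T (insert p H) r \<Longrightarrow> proves T (insert q H) r \<Longrightarrow> proves T H r"
| AllI: "proves T (lift ` H) p \<Longrightarrow> proves T H (All p)"
| AllE: "proves T H (All p) \<Longrightarrow> proves T H (inst t p)"
| ExI: "proves T H (inst t p) \<Longrightarrow> proves T H (Ex p)"
| ExE: "proves T H (Ex p) \<Longrightarrow> proves T (insert p (lift ` H)) (lift q) \<Longrightarrow> proves T H q"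
| EqRefl: "proves T H (Eq t t)"
| EqSubst: "proves T H (Eq s t) \<Longrightarrow> proves T H (inst s p) \<Longrightarrow> proves T H (inst t p)"

inductive sharply_bounded :: "'c fm \<Rightarrow> bool" where
  "sharply_bounded (Eq s t)"
| "sharply_bounded (Le s t)"
| "sharply_bounded (Tri s t)"
| "sharply_bounded p \<Longrightarrow> sharply_bounded (Neg p)"
| "sharply_bounded p \<Longrightarrow> sharply_bounded q \<Longrightarrow> sharply_bounded (And p q)"
| "sharply_bounded p \<Longrightarrow> sharply_bounded q \<Longrightarrow> sharply_bounded (Or p q)"
| "sharply_bounded p \<Longrightarrow> sharply_bounded q \<Longrightarrow> sharply_bounded (Imp p q)"
| "sharply_bounded p \<Longrightarrow> sharply_bounded (BAll (Len t) p)"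
| "sharply_bounded p \<Longrightarrow> sharply_bounded (BEx (Len t) p)"

inductive sigma_b1 :: "'c fm \<Rightarrow> bool" where
  "sharply_bounded p \<Longrightarrow> sigma_b1 p"
| "sigma_b1 p \<Longrightarrow> sigma_b1 q \<Longrightarrow> sigma_b1 (And p q)"
| "sigma_b1 p \<Longrightarrow> sigma_b1 q \<Longrightarrow> sigma_b1 (Or p q)"
| "sigma_b1 p \<Longrightarrow> sigma_b1 (BAll (Len t) p)"
| "sigma_b1 p \<Longrightarrow> sigma_b1 (BEx (Len t) p)"
| "sigma_b1 p \<Longrightarrow> sigma_b1 (BEx t p)"

text \<open>Buss's 32 axioms, in his order; the successor of \<open>t\<close> is \<open>t + 1\<close> in the present language.\<close>

definition BASIC :: "'c fm set" where
  "BASIC = (let x = Var 0; y = Var 1; z = Var 2; u = Var 3; v = Var 4;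
      S = (\<lambda>t. Add t One); dbl = (\<lambda>t. Mul (Add One One) t) in
   { Imp (Le y x) (Le y (S x)),
     Neq x (S x),
     Le Zero x,
     Iff (And (Le x y) (Neq x y)) (Le (S x) y),
     Imp (Neq x Zero) (Neq (dbl x) Zero),
     Or (Le y x) (Le x y),
     Imp (And (Le x y) (Le y x)) (Eq x y),
     Imp (And (Le x y) (Le y z)) (Le x z),
     Eq (Len Zero) Zero,
     Imp (Neq x Zero) (And (Eq (Len (dbl x)) (S (Len x))) (Eq (Len (S (dbl x))) (S (Len x)))),
     Eq (Len One) One,
     Imp (Le x y) (Le (Len x) (Len y)),
     Eq (Len (Smash x y)) (S (Mul (Len x) (Len y))),
     Eq (Smash Zero y) One,
     Imp (Neq x Zero) (And (Eq (Smash One (dbl x)) (dbl (Smash One x)))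
                           (Eq (Smash One (S (dbl x))) (dbl (Smash One x)))),
     Eq (Smash x y) (Smash y x),
     Imp (Eq (Len x) (Len y)) (Eq (Smash x z) (Smash y z)),
     Imp (Eq (Len x) (Add (Len u) (Len v))) (Eq (Smash x y) (Mul (Smash u y) (Smash v y))),
     Le x (Add x y),
     Imp (And (Le x y) (Neq x y)) (And (Le (S (dbl x)) (dbl y)) (Neq (S (dbl x)) (dbl y))),
     Eq (Add x y) (Add y x),
     Eq (Add x Zero) x,
     Eq (Add x (S y)) (S (Add x y)),
     Eq (Add (Add x y) z) (Add x (Add y z)),
     Iff (Le (Add x y) (Add x z)) (Le y z),
     Eq (Mul x Zero) Zero,
     Eq (Mul x (S y)) (Add (Mul x y) x),
     Eq (Mul x y) (Mul y x),
     Eq (Mul x (Add y z)) (Add (Mul x y) (Mul x z)),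
     Imp (Le One x) (Iff (Le (Mul x y) (Mul x z)) (Le y z)),
     Imp (Neq x Zero) (Eq (Len x) (S (Len (Half x)))),
     Iff (Eq x (Half y)) (Or (Eq (dbl x) y) (Eq (S (dbl x)) y)) })"

text \<open>In both schemes the induction variable is \<open>Var 0\<close>.\<close>

definition IND :: "'c fm \<Rightarrow> 'c fm" where
  "IND p = Imp (And (inst Zero p)
                    (All (Imp p (subst (case_nat (Add (Var 0) One) (\<lambda>i. Var (Suc i))) p))))
               (All p)"

definition PIND :: "'c fm \<Rightarrow> 'c fm" where
  "PIND p = Imp (And (inst Zero p)
                     (All (Imp (subst (case_nat (Half (Var 0)) (\<lambda>i. Var (Suc i))) p) p)))
                (All p)"

definition S12 :: "'c fm set" where
  "S12 = BASIC \<union> {PIND p | p. sigma_b1 p \<and> params p = {}}"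

definition delta_b1 :: "'c fm \<Rightarrow> bool" where
  "delta_b1 p \<longleftrightarrow> sigma_b1 p \<and> (\<exists>q. sigma_b1 q \<and> proves S12 {} (Iff p (Neg q)))"

definition sigma_b1_induction :: "'a arith \<Rightarrow> bool" where
  "sigma_b1_induction A \<longleftrightarrow> (\<forall>p :: 'a fm. sigma_b1 p \<and> params p \<subseteq> univ A \<longrightarrow> valid A id (IND p))"

definition MIN_fm :: "'c tm \<Rightarrow> 'c fm" where
  "MIN_fm n = (let bex = BEx_lt; n1 = shift 1 n; n2 = shift 2 n in
     Or (bex n (Tri (Var 0) (Var 0)))
    (Or (bex n (bex n1 (And (Tri (Var 1) (Var 0)) (Tri (Var 0) (Var 1)))))
    (Or (bex n (bex n1 (And (Neq (Var 1) (Var 0))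
                            (And (Neg (Tri (Var 1) (Var 0))) (Neg (Tri (Var 0) (Var 1)))))))
    (Or (bex n (bex n1 (bex n2 (And (Tri (Var 2) (Var 1))
                               (And (Tri (Var 1) (Var 0)) (Neg (Tri (Var 2) (Var 0))))))))
        (bex n (BAll_lt n1 (Or (Eq (Var 1) (Var 0)) (Tri (Var 1) (Var 0)))))))))"

section \<open>Sequences in the model\<close>

text \<open>A sequence \<open>a\<^sub>0, \<dots>, a\<^sub>l\<^sub>-\<^sub>1\<close> of numbers below \<open>n\<close> is coded by the number with binary expansion
  \<open>1 a\<^sub>l\<^sub>-\<^sub>1 \<dots> a\<^sub>0\<close>, each \<open>a\<^sub>i\<close> being written with \<open>|n|\<close> bits. This gives every sequence exactly one
  code, of bit length \<open>l|n| + 1\<close>; the empty sequence is \<open>1\<close>. Note that \<open>n \<sharp> x\<close> with \<open>|x| = i\<close> is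
  \<open>2\<close> to the power \<open>i|n|\<close>, and that \<open>n \<sharp> 1\<close> is \<open>2\<close> to the power \<open>|n|\<close>.\<close>

definition seq_len :: "'a arith \<Rightarrow> 'a \<Rightarrow> 'a \<Rightarrow> 'a \<Rightarrow> bool" where
  "seq_len A n w l \<longleftrightarrow> len_of A w = l \<otimes>\<^bsub>A\<^esub> len_of A n \<oplus>\<^bsub>A\<^esub> \<one>\<^bsub>A\<^esub>"

definition seq_entry :: "'a arith \<Rightarrow> 'a \<Rightarrow> 'a \<Rightarrow> 'a \<Rightarrow> 'a \<Rightarrow> bool" where
  "seq_entry A n w i a \<longleftrightarrow> (\<exists>x\<in>univ A. \<exists>u\<in>univ A. \<exists>v\<in>univ A.
     len_of A x = i \<and> u \<sqsubset>\<^bsub>A\<^esub> n \<sharp>\<^bsub>A\<^esub> x \<and> a \<sqsubset>\<^bsub>A\<^esub> n \<sharp>\<^bsub>A\<^esub> \<one>\<^bsub>A\<^esub> \<and>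
     w = u \<oplus>\<^bsub>A\<^esub> n \<sharp>\<^bsub>A\<^esub> x \<otimes>\<^bsub>A\<^esub> (a \<oplus>\<^bsub>A\<^esub> n \<sharp>\<^bsub>A\<^esub> \<one>\<^bsub>A\<^esub> \<otimes>\<^bsub>A\<^esub> v))"

definition seq_prec :: "'a arith \<Rightarrow> 'a \<Rightarrow> 'a \<Rightarrow> 'a \<Rightarrow> 'a \<Rightarrow> bool" where
  "seq_prec A n w x y \<longleftrightarrow> (\<exists>l\<in>univ A. \<exists>i\<in>univ A. \<exists>j\<in>univ A. seq_len A n w l \<and>
     i \<sqsubset>\<^bsub>A\<^esub> j \<and> j \<sqsubset>\<^bsub>A\<^esub> l \<and> seq_entry A n w i x \<and> seq_entry A n w j y)"

definition el :: "'a arith \<Rightarrow> 'a \<Rightarrow> 'a \<Rightarrow> 'a set" where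
  "el A n w = {a \<in> univ A. \<exists>l\<in>univ A. \<exists>i\<in>univ A. seq_len A n w l \<and> i \<sqsubset>\<^bsub>A\<^esub> l \<and> seq_entry A n w i a}"

definition conds_upto :: "'a arith \<Rightarrow> 'a \<Rightarrow> nat \<Rightarrow> 'a set" where
  "conds_upto M n c = {w \<in> univ M. \<exists>l\<in>univ M. seq_len M n w l \<and> l \<sqsubseteq>\<^bsub>M\<^esub> len_pow M n c \<and>
     (\<forall>i\<in>below M l. \<exists>a\<in>below M n. seq_entry M n w i a) \<and>
     (\<forall>i\<in>below M l. \<forall>j\<in>below M l. \<forall>a\<in>univ M.
        seq_entry M n w i a \<and> seq_entry M n w j a \<longrightarrow> i = j)}"

definition Conds :: "'a arith \<Rightarrow> 'a \<Rightarrow> 'a set" where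
  "Conds M n = (\<Union>c. conds_upto M n c)"

text \<open>Extension compares the induced orders only; a sequence of length at most \<open>1\<close> induces the empty
  order, so it is extended by every element of \<open>\<O>\<close>.\<close>

definition extends :: "'a arith \<Rightarrow> 'a \<Rightarrow> 'a \<Rightarrow> 'a \<Rightarrow> bool" where
  "extends M n s' s \<longleftrightarrow> (\<forall>x\<in>univ M. \<forall>y\<in>univ M. seq_prec M n s x y \<longrightarrow> seq_prec M n s' x y)"

definition compatible :: "'a arith \<Rightarrow> 'a \<Rightarrow> 'a \<Rightarrow> 'a \<Rightarrow> bool" where
  "compatible M n s s' \<longleftrightarrow> (\<exists>t\<in>Conds M n. extends M n t s \<and> extends M n t s')"

text \<open>The formula ``\<open>\<triangleleft>\<close> extends \<open>w\<close>''\<close>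

definition seq_entry_fm :: "'c tm \<Rightarrow> 'c tm \<Rightarrow> 'c tm \<Rightarrow> 'c tm \<Rightarrow> 'c fm" where
  "seq_entry_fm n w i a = (let x = Var 2; u = Var 1; v = Var 0; n' = shift 3 n; a' = shift 3 a in
     Ex (Ex (Ex (And (Eq (Len x) (shift 3 i)) (And (Lt u (Smash n' x)) (And (Lt a' (Smash n' One))
       (Eq (shift 3 w) (Add u (Mul (Smash n' x) (Add a' (Mul (Smash n' One) v)))))))))))"

definition seq_prec_fm :: "'c tm \<Rightarrow> 'c tm \<Rightarrow> 'c tm \<Rightarrow> 'c tm \<Rightarrow> 'c fm" where
  "seq_prec_fm n w x y = (let l = Var 2; i = Var 1; j = Var 0; n' = shift 3 n; w' = shift 3 w in
     Ex (Ex (Ex (And (Eq (Len w') (Add (Mul l (Len n')) One)) (And (Lt i j) (And (Lt j l)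
       (And (seq_entry_fm n' w' i (shift 3 x)) (seq_entry_fm n' w' j (shift 3 y)))))))))"

definition extends_fm :: "'c tm \<Rightarrow> 'c tm \<Rightarrow> 'c fm" where
  "extends_fm n w = All (All (Imp (seq_prec_fm (shift 2 n) (shift 2 w) (Var 1) (Var 0))
                                  (Tri (Var 1) (Var 0))))"

lemma tval_subst_tm: "tval A \<iota> e (subst_tm \<sigma> t) = tval A \<iota> (\<lambda>i. tval A \<iota> e (\<sigma> i)) t"
  by (induction t) simp_all

lemma sat_seq_entry_fm:
  "sat A \<iota> e (seq_entry_fm n w i a) \<longleftrightarrow>
     seq_entry A (tval A \<iota> e n) (tval A \<iota> e w) (tval A \<iota> e i) (tval A \<iota> e a)"
  by (simp add: seq_entry_fm_def seq_entry_def tval_subst_tm lt_of_def Let_def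
      numeral_2_eq_2 numeral_3_eq_3)

lemma sat_seq_prec_fm:
  "sat A \<iota> e (seq_prec_fm n w x y) \<longleftrightarrow>
     seq_prec A (tval A \<iota> e n) (tval A \<iota> e w) (tval A \<iota> e x) (tval A \<iota> e y)"
  by (simp add: seq_prec_fm_def seq_prec_def seq_len_def sat_seq_entry_fm tval_subst_tm lt_of_def Let_def
      numeral_2_eq_2 numeral_3_eq_3)

lemma sat_extends_fm:
  "sat A \<iota> e (extends_fm n w) \<longleftrightarrow> (\<forall>x\<in>univ A. \<forall>y\<in>univ A.
     seq_prec A (tval A \<iota> e n) (tval A \<iota> e w) x y \<longrightarrow> tri_of A x y)"
  by (simp add: extends_fm_def sat_seq_prec_fm tval_subst_tm numeral_2_eq_2)

section \<open>Trees\<close>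

definition one_point_exts :: "'a arith \<Rightarrow> 'a \<Rightarrow> 'a \<Rightarrow> 'a \<Rightarrow> 'a set" where
  "one_point_exts M n s a = {s' \<in> Conds M n. extends M n s' s \<and> el M n s' = el M n s \<union> {a}}"

text \<open>The recursive definition of \<open>o\<close>-trees is carried out inside the model, where the recursion
  may have nonstandard depth; an external inductive predicate would only produce trees all of
  whose branches have standard length. So the subtrees \<open>F s\<close> appearing in the recursion, for \<open>s\<close>
  in a set \<open>N\<close> of nodes, are required to form a definable family, and every \<open>F s\<close> has to obey
  the defining clause. The common bound on the lengths of the nodes, together with induction in
  the model, makes this recursion well-founded (a definable subset of \<open>\<O>\<close> always has such a
  bound).\<close>

definition is_tree :: "'a arith \<Rightarrow> 'a \<Rightarrow> 'a \<Rightarrow> 'a set \<Rightarrow> bool" where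
  "is_tree M n r T \<longleftrightarrow> T \<subseteq> Conds M n \<and> definable M {[t] | t. t \<in> T} \<and>
     (\<exists>c N F. N \<subseteq> conds_upto M n c \<and> definable M {[s] | s. s \<in> N} \<and>
        definable M {[s, t] | s t. s \<in> N \<and> t \<in> F s} \<and> r \<in> N \<and> F r = T \<and>
        (\<forall>s\<in>N. F s = {s} \<or>
           (\<exists>a\<in>below M n. a \<notin> el M n s \<and> one_point_exts M n s a \<subseteq> N \<and>
              F s = (\<Union>s'\<in>one_point_exts M n s a. F s'))))"

definition depth_le :: "'a arith \<Rightarrow> 'a \<Rightarrow> 'a \<Rightarrow> 'a set \<Rightarrow> 'a \<Rightarrow> bool" where
  "depth_le M n r T d \<longleftrightarrow> (\<forall>t\<in>T. \<forall>k\<in>univ M. \<forall>l\<in>univ M.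
     seq_len M n r k \<and> seq_len M n t l \<longrightarrow> l \<sqsubseteq>\<^bsub>M\<^esub> k \<oplus>\<^bsub>M\<^esub> d)"

text \<open>A family \<open>T b x y\<close>, with \<open>b = True\<close> for \<open>T\<^sup>+\<close> and \<open>b = False\<close> for \<open>T\<^sup>-\<close>, indexed by
  \<open>x < p\<close> and \<open>y < h\<close>.\<close>

definition family_rel ::
  "'a arith \<Rightarrow> 'a \<Rightarrow> 'a \<Rightarrow> (bool \<Rightarrow> 'a \<Rightarrow> 'a \<Rightarrow> 'a set) \<Rightarrow> bool \<Rightarrow> 'a \<Rightarrow> 'a \<Rightarrow> 'a \<Rightarrow> bool" where
  "family_rel M p h T b x y t \<longleftrightarrow> x \<in> below M p \<and> y \<in> below M h \<and> t \<in> T b x y"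

definition definable_family ::
  "'a arith \<Rightarrow> 'a \<Rightarrow> 'a \<Rightarrow> (bool \<Rightarrow> 'a \<Rightarrow> 'a \<Rightarrow> 'a set) \<Rightarrow> bool \<Rightarrow> bool" where
  "definable_family M p h T b \<longleftrightarrow> definable M {[x, y, t] | x y t. family_rel M p h T b x y t}"

text \<open>``\<open>\<triangleleft>\<close> extends some \<open>o' \<in> T\<^sup>+\<^bsub>a,b\<^esub>\<close>'' refers to a set definable in \<open>\<M>\<close>, through parameters
  in \<open>\<I>\<close>. It is formalized with the symbol \<open>Fam\<close>, and provability in \<open>S\<^sup>1\<^sub>2(\<triangleleft>)\<close> of statements with
  parameters and with these sets is provability from \<open>S\<^sup>1\<^sub>2(\<triangleleft>)\<close> and all \<open>\<triangleleft>\<close>-free truths about the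
  parameters and sets in \<open>\<I>\<close>. The induction scheme of \<open>S\<^sup>1\<^sub>2(\<triangleleft>)\<close> is not extended to \<open>Fam\<close>.\<close>

definition diagram ::
  "'a arith \<Rightarrow> 'a \<Rightarrow> (bool \<Rightarrow> 'a \<Rightarrow> 'a \<Rightarrow> 'a \<Rightarrow> bool) \<Rightarrow> 'a fm set" where
  "diagram M n \<F> = {q. tri_free q \<and> params q \<subseteq> univ (cut M n) \<and> valid ((cut M n)\<lparr>fam_of := \<F>\<rparr>) id q}"

definition extends_some_fm :: "bool \<Rightarrow> 'c \<Rightarrow> 'c \<Rightarrow> 'c \<Rightarrow> 'c fm" where
  "extends_some_fm b n x y = Ex (And (Fam b (Par x) (Par y) (Var 0)) (extends_fm (Par n) (Var 0)))"

text \<open>\<open>\<phi>(a,b)\<close> for \<open>\<phi>\<close> with free variables \<open>Var 0\<close> and \<open>Var 1\<close>\<close>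

definition inst2 :: "'c fm \<Rightarrow> 'c \<Rightarrow> 'c \<Rightarrow> 'c fm" where
  "inst2 \<phi> a b = subst (case_nat (Par a) (\<lambda>_. Par b)) \<phi>"

section \<open>The game\<close>

definition strategy :: "'a arith \<Rightarrow> 'a \<Rightarrow> ('a \<Rightarrow> 'a) \<Rightarrow> bool" where
  "strategy M n S \<longleftrightarrow> (\<forall>s\<in>Conds M n. S s \<in> Conds M n \<and> extends M n (S s) s)"

definition is_play :: "'a arith \<Rightarrow> 'a \<Rightarrow> (nat \<Rightarrow> 'a) \<Rightarrow> bool" where
  "is_play M n ps \<longleftrightarrow> ps 0 = \<one>\<^bsub>M\<^esub> \<and>
     (\<forall>k. ps (Suc k) \<in> Conds M n \<and> extends M n (ps (Suc k)) (ps k))"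

text \<open>The players MIN, IND, PHP are numbered \<open>0, 1, 2\<close>.\<close>

definition follows :: "nat \<Rightarrow> ('a \<Rightarrow> 'a) \<Rightarrow> (nat \<Rightarrow> 'a) \<Rightarrow> bool" where
  "follows j S ps \<longleftrightarrow> (\<forall>k. k mod 3 = j \<longrightarrow> ps (Suc k) = S (ps k))"

definition play_order :: "'a arith \<Rightarrow> 'a \<Rightarrow> (nat \<Rightarrow> 'a) \<Rightarrow> 'a \<Rightarrow> 'a \<Rightarrow> bool" where
  "play_order M n ps x y \<longleftrightarrow> (\<exists>i. seq_prec M n (ps i) x y)"

definition winning_IND :: "'a arith \<Rightarrow> 'a \<Rightarrow> ('a \<Rightarrow> 'a) \<Rightarrow> bool" where
  "winning_IND M n S \<longleftrightarrow> strategy M n S \<and>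
     (\<forall>ps. is_play M n ps \<and> follows 1 S ps \<longrightarrow> sigma_b1_induction (cut_tri M n (play_order M n ps)))"

text \<open>\<open>q\<close> enumerates the numbers below \<open>n\<close>. The low-order block of a code is the first entry, so
  prepending \<open>a\<close> to the sequence coded by \<open>w\<close> gives \<open>a + (n \<sharp> 1) w\<close>.\<close>

definition strategy_MIN :: "'a arith \<Rightarrow> 'a \<Rightarrow> (nat \<Rightarrow> 'a) \<Rightarrow> 'a \<Rightarrow> 'a" where
  "strategy_MIN M n q w = q (LEAST k. q k \<notin> el M n w) \<oplus>\<^bsub>M\<^esub> n \<sharp>\<^bsub>M\<^esub> \<one>\<^bsub>M\<^esub> \<otimes>\<^bsub>M\<^esub> w"

definition defines_injection :: "'a arith \<Rightarrow> 'a fm \<Rightarrow> 'a \<Rightarrow> 'a \<Rightarrow> bool" where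
  "defines_injection A \<phi> p h \<longleftrightarrow> (\<exists>f. f ` below A p \<subseteq> below A h \<and> inj_on f (below A p) \<and>
     (\<forall>x\<in>below A p. \<forall>y\<in>below A h. sat A id (case_nat x (\<lambda>_. y)) \<phi> \<longleftrightarrow> y = f x))"

end

theory Submission
  imports Defs
begin

text \<open>The move \<open>t\<close> of PHP extends a common extension of the two given members of the trees in
  cases (i) and (ii), and \<open>o'\<close> in case (iii). Since MIN makes \<open>\<triangleleft>\<close> a linear order without least
  element and IND makes \<open>\<I>\<^sub>\<triangleleft>\<close> a model of \<open>S\<^sup>1\<^sub>2(\<triangleleft>)\<close>, soundness shows that \<open>\<phi>(a,b)\<close> holds in
  \<open>\<I>\<^sub>\<triangleleft>\<close> iff \<open>\<triangleleft>\<close> extends a member of \<open>T\<^sup>+\<^bsub>a,b\<^esub>\<close>. In cases (i) and (ii) two incompatible instances of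
  \<open>\<phi>\<close> become true. In case (iii) a value \<open>b\<close> of \<open>\<phi>\<close> at \<open>a\<close> would give a member \<open>o''\<close> of \<open>T\<^sup>+\<^bsub>a,b\<^esub>\<close> with
  \<open>\<triangleleft>\<close> extending both \<open>o'\<close> and \<open>o''\<close>; these then order no two elements differently, which already
  makes them compatible in \<open>\<M>\<close>. Combinatorial facts about sequences are proved for lists of natural
  numbers and transferred to \<open>\<M>\<close>.\<close>

section \<open>Semantics of formulas, soundness and transfer\<close>

text \<open>Facts about \<open>M\<close> are obtained by writing a formula with the elements in
  question as parameters and checking it in \<open>std\<close> under every interpretation. This is
  done for one external exponent c at a time, since \<open>Conds\<close> is a union over all
  standard c. The nonstandardness of n enters only as |n| >= 2 and as n exceeding every numeral. Two
  mismatches shape the rest. The winning condition supplies ordinary induction, whereas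
  \<open>S12\<close> has polynomial induction, which must be derived inside the cut. And
  \<open>extends\<close> compares orders only: a position with at most one entry may be followed by
  one that lacks this entry, so the queue of MIN makes lasting progress only once some pair has been
  ordered. In cases (i) and (ii) the move must also extend s. This rests on the members of an s-tree
  extending s, and as trees may have nonstandard depth, it takes induction in \<open>M\<close>
  rather than outside.\<close>

lemma tval_cong:
  assumes "\<And>i. i \<in> fv_tm t \<Longrightarrow> e i = e' i" "\<And>c. c \<in> params_tm t \<Longrightarrow> \<iota> c = \<iota>' c"
  shows "tval A \<iota> e t = tval A \<iota>' e' t"
  using assms by (induction t) auto

lemma sat_cong:
  assumes "\<And>i. i \<in> fv p \<Longrightarrow> e i = e' i" "\<And>c. c \<in> params p \<Longrightarrow> \<iota> c = \<iota>' c"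
  shows "sat A \<iota> e p \<longleftrightarrow> sat A \<iota>' e' p"
  using assms
proof (induction p arbitrary: e e')
  case (All p)
  have "sat A \<iota> (case_nat x e) p \<longleftrightarrow> sat A \<iota>' (case_nat x e') p" for x
    by (rule All.IH) (use All.prems in \<open>auto split: nat.split\<close>)
  then show ?case by simp
next
  case (Ex p)
  have "sat A \<iota> (case_nat x e) p \<longleftrightarrow> sat A \<iota>' (case_nat x e') p" for x
    by (rule Ex.IH) (use Ex.prems in \<open>auto split: nat.split\<close>)
  then show ?case by simp
next
  case (Eq s t)
  then show ?case using tval_cong[of s e e' \<iota> \<iota>' A] tval_cong[of t e e' \<iota> \<iota>' A] by auto
next
  case (Le s t)
  then show ?case using tval_cong[of s e e' \<iota> \<iota>' A] tval_cong[of t e e' \<iota> \<iota>' A] by auto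
next
  case (Tri s t)
  then show ?case using tval_cong[of s e e' \<iota> \<iota>' A] tval_cong[of t e e' \<iota> \<iota>' A] by auto
next
  case (Fam b r s t)
  then show ?case using tval_cong[of r e e' \<iota> \<iota>' A] tval_cong[of s e e' \<iota> \<iota>' A]
      tval_cong[of t e e' \<iota> \<iota>' A] by auto
next
  case (Neg p)
  then show ?case by simp
next
  case (And p q)
  have "sat A \<iota> e p \<longleftrightarrow> sat A \<iota>' e' p" "sat A \<iota> e q \<longleftrightarrow> sat A \<iota>' e' q"
    by (rule And.IH; use And.prems in auto)+
  then show ?case by simp
next
  case (Or p q)
  have "sat A \<iota> e p \<longleftrightarrow> sat A \<iota>' e' p" "sat A \<iota> e q \<longleftrightarrow> sat A \<iota>' e' q"
    by (rule Or.IH; use Or.prems in auto)+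
  then show ?case by simp
next
  case (Imp p q)
  have "sat A \<iota> e p \<longleftrightarrow> sat A \<iota>' e' p" "sat A \<iota> e q \<longleftrightarrow> sat A \<iota>' e' q"
    by (rule Imp.IH; use Imp.prems in auto)+
  then show ?case by simp
qed

lemma tval_struct_cong:
  assumes "zero_of A = zero_of B" "one_of A = one_of B" "plus_of A = plus_of B"
    "times_of A = times_of B" "len_of A = len_of B" "half_of A = half_of B" "smash_of A = smash_of B"
  shows "tval A \<iota> e t = tval B \<iota> e t"
  by (induction t) (simp_all add: assms)

text \<open>The disjunctions let one lemma serve twice: either symbol may be reinterpreted if absent
  from \<open>p\<close>, while the other keeps its meaning.\<close>

lemma sat_tri_fam_cong:
  assumes "tri_free p \<or> R = tri_of A" "fam_free p \<or> F = fam_of A"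
  shows "sat (A\<lparr>tri_of := R, fam_of := F\<rparr>) \<iota> e p \<longleftrightarrow> sat A \<iota> e p"
proof -
  have "tval (A\<lparr>tri_of := R, fam_of := F\<rparr>) \<iota> e t = tval A \<iota> e t" for e t
    by (rule tval_struct_cong) simp_all
  then show ?thesis using assms by (induction p arbitrary: e) auto
qed

lemma sat_subst: "sat A \<iota> e (subst \<sigma> p) \<longleftrightarrow> sat A \<iota> (\<lambda>i. tval A \<iota> e (\<sigma> i)) p"
proof (induction p arbitrary: e \<sigma>)
  have up: "(\<lambda>i. tval A \<iota> (case_nat x e) (up \<sigma> i)) = case_nat x (\<lambda>i. tval A \<iota> e (\<sigma> i))" for x e \<sigma>
    by (auto simp: up_def tval_subst_tm split: nat.split)
  { case (All p) then show ?case by (simp add: up) }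
  { case (Ex p) then show ?case by (simp add: up) }
qed (simp_all add: tval_subst_tm)

lemma sat_lift: "sat A \<iota> (case_nat x e) (lift p) \<longleftrightarrow> sat A \<iota> e p"
  by (simp add: lift_def sat_subst)

lemma sat_inst: "sat A \<iota> e (inst t p) \<longleftrightarrow> sat A \<iota> (case_nat (tval A \<iota> e t) e) p"
proof -
  have "(\<lambda>i. tval A \<iota> e (case i of 0 \<Rightarrow> t | Suc x \<Rightarrow> Var x)) = case_nat (tval A \<iota> e t) e"
    by (auto split: nat.split)
  then show ?thesis by (simp add: inst_def sat_subst)
qed

lemma sat_BAll [simp]: "sat A \<iota> e (BAll t p) \<longleftrightarrow>
    (\<forall>x\<in>univ A. x \<sqsubseteq>\<^bsub>A\<^esub> tval A \<iota> e t \<longrightarrow> sat A \<iota> (case_nat x e) p)"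
  by (simp add: BAll_def tval_subst_tm)

lemma sat_BEx [simp]: "sat A \<iota> e (BEx t p) \<longleftrightarrow>
    (\<exists>x\<in>univ A. x \<sqsubseteq>\<^bsub>A\<^esub> tval A \<iota> e t \<and> sat A \<iota> (case_nat x e) p)"
  by (simp add: BEx_def tval_subst_tm)

lemma sat_BAll_lt [simp]: "sat A \<iota> e (BAll_lt t p) \<longleftrightarrow>
    (\<forall>x\<in>below A (tval A \<iota> e t). sat A \<iota> (case_nat x e) p)"
  by (auto simp: BAll_lt_def tval_subst_tm below_def lt_of_def)

lemma sat_BEx_lt [simp]: "sat A \<iota> e (BEx_lt t p) \<longleftrightarrow>
    (\<exists>x\<in>below A (tval A \<iota> e t). sat A \<iota> (case_nat x e) p)"
  by (auto simp: BEx_lt_def tval_subst_tm below_def lt_of_def)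

lemma tval_in_univ:
  assumes "closed_struct A" "range \<iota> \<subseteq> univ A" "range e \<subseteq> univ A"
  shows "tval A \<iota> e t \<in> univ A"
  using assms by (induction t) (auto simp: closed_struct_def)

lemma range_case_nat: "x \<in> U \<Longrightarrow> range e \<subseteq> U \<Longrightarrow> range (case_nat x e) \<subseteq> U"
  by (force split: nat.splits)

text \<open>Axioms must hold under all assignments because the quantifier rules change
  \<open>e\<close> without lifting \<open>Th\<close>; hypotheses need only hold at \<open>e\<close>.
  Derivations may instantiate with arbitrary constants, so the whole range of \<open>\<iota>\<close>
  has to lie in the universe.\<close>

theorem soundness:
  assumes "proves Th H p" "closed_struct A" "range \<iota> \<subseteq> univ A"
    "\<And>q. q \<in> Th \<Longrightarrow> valid A \<iota> q" "range e \<subseteq> univ A" "\<And>q. q \<in> H \<Longrightarrow> sat A \<iota> e q"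
  shows "sat A \<iota> e p"
  using assms
proof (induction arbitrary: e rule: proves.induct)
  case (Axiom p H)
  then show ?case by (auto simp: valid_def)
next
  case (ImpI p H q)
  have "sat A \<iota> e p \<Longrightarrow> sat A \<iota> e q"
    by (rule ImpI.IH) (use ImpI.prems in auto)
  then show ?case by simp
next
  case (NegI p H q)
  have "sat A \<iota> e p \<Longrightarrow> sat A \<iota> e q" "sat A \<iota> e p \<Longrightarrow> sat A \<iota> e (Neg q)"
    by (rule NegI.IH; use NegI.prems in auto)+
  then show ?case by auto
next
  case (OrE H p q r)
  have "sat A \<iota> e p \<or> sat A \<iota> e q" using OrE.IH(1)[of e] OrE.prems by auto
  moreover have "sat A \<iota> e p \<Longrightarrow> sat A \<iota> e r" by (rule OrE.IH(2)) (use OrE.prems in auto)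
  moreover have "sat A \<iota> e q \<Longrightarrow> sat A \<iota> e r" by (rule OrE.IH(3)) (use OrE.prems in auto)
  ultimately show ?case by auto
next
  case (AllI H p)
  have "sat A \<iota> (case_nat x e) p" if "x \<in> univ A" for x
    by (rule AllI.IH) (use AllI.prems range_case_nat[OF that] in \<open>auto simp: sat_lift\<close>)
  then show ?case by simp
next
  case (AllE H p t)
  have "sat A \<iota> e (All p)" using AllE by blast
  then show ?case using tval_in_univ[OF AllE.prems(1,2,4)] by (auto simp: sat_inst)
next
  case (ExI H t p)
  have "sat A \<iota> e (inst t p)" using ExI by blast
  then show ?case using tval_in_univ[OF ExI.prems(1,2,4)] by (auto simp: sat_inst)
next
  case (ExE H p q)
  have "sat A \<iota> e (Ex p)" using ExE.IH(1)[of e] ExE.prems by blast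
  then obtain x where x: "x \<in> univ A" "sat A \<iota> (case_nat x e) p" by auto
  have "sat A \<iota> (case_nat x e) (lift q)"
    by (rule ExE.IH(2)) (use ExE.prems x range_case_nat[OF x(1)] in \<open>auto simp: sat_lift\<close>)
  then show ?case by (simp add: sat_lift)
next
  case (EqSubst H s t p)
  have "sat A \<iota> e (Eq s t)" "sat A \<iota> e (inst s p)" using EqSubst by blast+
  then show ?case by (simp add: sat_inst)
qed auto

section \<open>Trading parameters for free variables\<close>

primrec unpar_tm :: "('c \<Rightarrow> nat) \<Rightarrow> nat \<Rightarrow> 'c tm \<Rightarrow> unit tm" where
  "unpar_tm g d (Var i) = Var (if i < d then i else d + 2 * (i - d))"
| "unpar_tm g d (Par c) = Var (d + 2 * g c + 1)"
| "unpar_tm g d Zero = Zero"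
| "unpar_tm g d One = One"
| "unpar_tm g d (Add s t) = Add (unpar_tm g d s) (unpar_tm g d t)"
| "unpar_tm g d (Mul s t) = Mul (unpar_tm g d s) (unpar_tm g d t)"
| "unpar_tm g d (Len t) = Len (unpar_tm g d t)"
| "unpar_tm g d (Half t) = Half (unpar_tm g d t)"
| "unpar_tm g d (Smash s t) = Smash (unpar_tm g d s) (unpar_tm g d t)"

text \<open>Parameters become odd-numbered free variables; \<open>d\<close> counts the enclosing quantifiers.\<close>

primrec unpar :: "('c \<Rightarrow> nat) \<Rightarrow> 'c fm \<Rightarrow> nat \<Rightarrow> unit fm" where
  "unpar g (Eq s t) d = Eq (unpar_tm g d s) (unpar_tm g d t)"
| "unpar g (Le s t) d = Le (unpar_tm g d s) (unpar_tm g d t)"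
| "unpar g (Tri s t) d = Tri (unpar_tm g d s) (unpar_tm g d t)"
| "unpar g (Fam b r s t) d = Fam b (unpar_tm g d r) (unpar_tm g d s) (unpar_tm g d t)"
| "unpar g (Neg p) d = Neg (unpar g p d)"
| "unpar g (And p q) d = And (unpar g p d) (unpar g q d)"
| "unpar g (Or p q) d = Or (unpar g p d) (unpar g q d)"
| "unpar g (Imp p q) d = Imp (unpar g p d) (unpar g q d)"
| "unpar g (All p) d = All (unpar g p (Suc d))"
| "unpar g (Ex p) d = Ex (unpar g p (Suc d))"

definition interleave :: "nat \<Rightarrow> (nat \<Rightarrow> 'a) \<Rightarrow> (nat \<Rightarrow> 'a) \<Rightarrow> nat \<Rightarrow> 'a" where
  "interleave d e v i = (if i < d then e i else if even (i - d) then e (d + (i - d) div 2)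
     else v ((i - d) div 2))"

lemma case_nat_interleave: "case_nat x (interleave d e v) = interleave (Suc d) (case_nat x e) v"
  by (rule ext) (simp add: interleave_def split: nat.split)

lemma tval_unpar_tm:
  "tval A \<kappa> (interleave d e v) (unpar_tm g d t) = tval A (\<lambda>c. v (g c)) e t"
  by (induction t) (auto simp: interleave_def)

lemma sat_unpar:
  assumes "\<And>c. c \<in> params p \<Longrightarrow> \<iota> c = v (g c)"
  shows "sat A \<kappa> (interleave d e v) (unpar g p d) \<longleftrightarrow> sat A \<iota> e p"
proof -
  have "sat A \<kappa> (interleave d e v) (unpar g p d) \<longleftrightarrow> sat A (\<lambda>c. v (g c)) e p"
    by (induction p arbitrary: d e) (simp_all add: tval_unpar_tm case_nat_interleave)
  also have "\<dots> \<longleftrightarrow> sat A \<iota> e p" using assms by (intro sat_cong) auto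
  finally show ?thesis .
qed

lemma params_unpar: "params (unpar g p d) = {}"
proof (induction p arbitrary: d)
  have "params_tm (unpar_tm g d t) = {}" for d t by (induction t) auto
  then show "params (unpar g (Eq s t) d) = {}" "params (unpar g (Le s t) d) = {}"
    "params (unpar g (Tri s t) d) = {}" "params (unpar g (Fam b r s t) d) = {}" for b r s t d
    by auto
qed auto

lemma finite_params: "finite (params p)"
proof (induction p)
  have "finite (params_tm t)" for t :: "'a tm" by (induction t) auto
  then show "finite (params (Eq s t))" "finite (params (Le s t))"
    "finite (params (Tri s t))" "finite (params (Fam b r s t))" for b and r s t :: "'a tm"
    by auto
qed auto

text \<open>\<open>true_arith_model\<close> speaks of parameter-free formulas over
  \<open>unit\<close> only. Truth in \<open>std\<close> for all values of parameters and variables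
  becomes validity of \<open>unpar g p 0\<close>; in \<open>M\<close> the parameters return as
  values of the odd-numbered variables.\<close>

theorem transfer:
  assumes M: "true_arith_model M" and p: "arith_fm p" "params p \<subseteq> univ M"
    and e: "range e \<subseteq> univ M" and std: "\<And>\<iota> e. sat std \<iota> e p"
  shows "sat M id e p"
proof -
  \<comment> \<open>A single formula has finitely many parameters, so an injective numbering of them
    exists whatever the size of the type.\<close>
  obtain g :: "'a \<Rightarrow> nat" where g: "inj_on g (params p)"
    using finite_params by (metis countable_def countable_finite)
  define q where "q = unpar g p 0"
  have "tri_free (unpar g p d) = tri_free p" "fam_free (unpar g p d) = fam_free p" for d
    by (induction p arbitrary: d) auto
  then have q: "arith_fm q" "params q = {}" using p by (auto simp: q_def params_unpar)
  have "sat std (\<lambda>_. 0) E q" for E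
  proof -
    have "interleave 0 (\<lambda>i. E (2 * i)) (\<lambda>i. E (2 * i + 1)) = E"
      by (rule ext) (auto simp: interleave_def)
    then show ?thesis
      using sat_unpar[of p "\<lambda>c. E (2 * g c + 1)" "\<lambda>i. E (2 * i + 1)" g std "\<lambda>_. 0" 0
          "\<lambda>i. E (2 * i)"] std by (simp add: q_def)
  qed
  then have vM: "valid M (\<lambda>_. \<zero>\<^bsub>M\<^esub>) q"
    using M q by (simp add: true_arith_model_def valid_def)
  \<comment> \<open>Off the range of \<open>g\<close> the value is zero, so that the assignment
    stays inside \<open>univ M\<close>.\<close>
  define v where "v j = (if j \<in> g ` params p then inv_into (params p) g j else \<zero>\<^bsub>M\<^esub>)" for j
  have v: "id c = v (g c)" if "c \<in> params p" for c
    using that g by (simp add: v_def inv_into_f_f)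
  have "v j \<in> univ M" for j
    using p(2) M inv_into_into[of j g "params p"]
    by (auto simp: v_def true_arith_model_def closed_struct_def)
  then have "range (interleave 0 e v) \<subseteq> univ M" using e by (auto simp: interleave_def)
  then have "sat M (\<lambda>_. \<zero>\<^bsub>M\<^esub>) (interleave 0 e v) q" using vM by (simp add: valid_def)
  then show ?thesis using sat_unpar[of p id v g M "\<lambda>_. \<zero>\<^bsub>M\<^esub>" 0 e] v by (simp add: q_def)
qed

section \<open>Bit lengths and the model\<close>

text \<open>The adjunction with powers of two; it replaces the \<open>LEAST\<close> of the
  definition from here on.\<close>

lemma bit_length_le_iff: "bit_length x \<le> k \<longleftrightarrow> x < 2 ^ k"
proof
  have "x < 2 ^ bit_length x"
    unfolding bit_length_def by (rule LeastI[of _ x]) simp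
  moreover assume "bit_length x \<le> k"
  ultimately show "x < 2 ^ k"
    by (meson less_le_trans one_le_numeral power_increasing)
next
  assume "x < 2 ^ k"
  then show "bit_length x \<le> k" unfolding bit_length_def by (rule Least_le)
qed

lemma less_bit_length_iff: "k < bit_length x \<longleftrightarrow> 2 ^ k \<le> x"
  using bit_length_le_iff[of x k] by linarith

lemma less_two_power_bit_length: "x < 2 ^ bit_length x"
  using bit_length_le_iff by blast

lemma bit_length_mono: "x \<le> y \<Longrightarrow> bit_length x \<le> bit_length y"
  using less_two_power_bit_length[of y] by (simp add: bit_length_le_iff)

lemma bit_length_eqI: "2 ^ k \<le> x \<Longrightarrow> x < 2 ^ Suc k \<Longrightarrow> bit_length x = Suc k"
  using bit_length_le_iff[of x "Suc k"] less_bit_length_iff[of k x] by simp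

lemma bit_length_0 [simp]: "bit_length 0 = 0"
  using bit_length_le_iff[of 0 0] by simp

lemma bit_length_two_power [simp]: "bit_length (2 ^ k) = Suc k"
  by (rule bit_length_eqI) simp_all

lemma bit_length_Suc_0 [simp]: "bit_length (Suc 0) = Suc 0"
  using bit_length_two_power[of 0] by simp

lemma bit_length_two_power_minus [simp]: "bit_length (2 ^ k - Suc 0) = k"
proof (cases k)
  case (Suc j)
  have "2 ^ j \<ge> (1::nat)" by simp
  then show ?thesis using Suc by (intro bit_length_eqI[THEN trans]) auto
qed simp

lemma bit_length_eq_0_iff [simp]: "bit_length x = 0 \<longleftrightarrow> x = 0"
  using bit_length_le_iff[of x 0] by auto

lemma bit_length_le_self: "bit_length x \<le> x"
  by (simp add: bit_length_le_iff)

lemma bit_length_half: "x \<noteq> 0 \<Longrightarrow> bit_length x = Suc (bit_length (x div 2))"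
proof -
  assume "x \<noteq> 0"
  then obtain k where k: "bit_length x = Suc k" by (metis bit_length_eq_0_iff not0_implies_Suc)
  have "2 ^ k \<le> x" "x < 2 ^ Suc k"
    using less_bit_length_iff[of k x] k less_two_power_bit_length[of x] by auto
  then have "x div 2 < 2 ^ k" by auto
  moreover have "2 ^ j \<le> x div 2" if "k = Suc j" for j
    using that \<open>2 ^ k \<le> x\<close> by auto
  ultimately have "bit_length (x div 2) = k"
    by (metis bit_length_le_iff less_bit_length_iff le_0_eq lessI less_Suc_eq_le not0_implies_Suc
        order_antisym_conv linorder_not_le)
  then show ?thesis using k by simp
qed

lemma bit_length_double: "x \<noteq> 0 \<Longrightarrow> bit_length (2 * x) = Suc (bit_length x)"
  using bit_length_half[of "2 * x"] by simp

lemma bit_length_Suc_double: "bit_length (Suc (2 * x)) = Suc (bit_length x)"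
  using bit_length_half[of "Suc (2 * x)"] by simp

section \<open>The standard model and terms for powers of the length\<close>

lemma std_simps [simp]:
  "univ std = UNIV" "zero_of std = 0" "one_of std = 1" "plus_of std = (+)" "times_of std = (*)"
  "len_of std = bit_length" "half_of std x = x div 2"
  "smash_of std x y = 2 ^ (bit_length x * bit_length y)" "le_of std = (\<le>)"
  by (simp_all add: std_def)

lemma lt_of_std [simp]: "lt_of std x y \<longleftrightarrow> x < y"
  by (auto simp: lt_of_def)

lemma below_std [simp]: "below std x = {..<x}"
  by (auto simp: below_def)

text \<open>Since c is an external number, |n|^c is an iterated product and thus a term of the
  language; bounds by it can be transferred for each c separately.\<close>

definition len_pow_tm :: "'c tm \<Rightarrow> nat \<Rightarrow> 'c tm" where
  "len_pow_tm t c = ((\<lambda>u. Mul (Len t) u) ^^ c) One"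

lemma tval_len_pow_tm [simp]: "tval A \<iota> e (len_pow_tm t c) = len_pow A (tval A \<iota> e t) c"
  by (induction c) (simp_all add: len_pow_tm_def len_pow_def)

lemma params_len_pow_tm [simp]: "params_tm (len_pow_tm t c) \<subseteq> U \<longleftrightarrow> c = 0 \<or> params_tm t \<subseteq> U"
  by (induction c) (auto simp: len_pow_tm_def)

lemma len_pow_std [simp]: "len_pow std x c = bit_length x ^ c"
  by (induction c) (simp_all add: len_pow_def)

lemma tri_free_subst [simp]: "tri_free (subst \<sigma> p) = tri_free p"
  by (induction p arbitrary: \<sigma>) auto

lemma fam_free_subst [simp]: "fam_free (subst \<sigma> p) = fam_free p"
  by (induction p arbitrary: \<sigma>) auto

lemma params_tm_subst_tm: "params_tm (subst_tm \<sigma> t) \<subseteq> params_tm t \<union> (\<Union>i. params_tm (\<sigma> i))"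
  by (induction t) auto

lemma params_subst: "params (subst \<sigma> p) \<subseteq> params p \<union> (\<Union>i. params_tm (\<sigma> i))"
proof (induction p arbitrary: \<sigma>)
  have "params_tm (up \<sigma> i) \<subseteq> (\<Union>i. params_tm (\<sigma> i))" for \<sigma> :: "nat \<Rightarrow> 'a tm" and i
    using params_tm_subst_tm[of "\<lambda>i. Var (Suc i)"] by (fastforce simp: up_def split: nat.splits)
  note up = this
  { case (All p) show ?case using All[of "up \<sigma>"] up[of \<sigma>] by fastforce }
  { case (Ex p) show ?case using Ex[of "up \<sigma>"] up[of \<sigma>] by fastforce }
  { case (Eq s t) show ?case using params_tm_subst_tm[of \<sigma>] by fastforce }
  { case (Le s t) show ?case using params_tm_subst_tm[of \<sigma>] by fastforce }
  { case (Tri s t) show ?case using params_tm_subst_tm[of \<sigma>] by fastforce }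
  { case (Fam b r s t) show ?case using params_tm_subst_tm[of \<sigma>] by fastforce }
qed fastforce+

text \<open>Here z is a leading part of a and |y| the number of bits cut off. Halving y returns one
  bit to the leading part. For y = 0 nothing is cut off, and the first disjunct holds. The
  object-level implications match the formula that is transferred later.\<close>

lemma std_shift_step:
  "a = z * 2 ^ bit_length y + u \<longrightarrow> u < 2 ^ bit_length y \<longrightarrow> y \<le> a \<longrightarrow>
    bit_length a < bit_length z + 1 \<or>
    (\<exists>z'\<le>a. \<exists>y'\<le>a. \<exists>u'\<le>a. a = z' * 2 ^ bit_length y' + u' \<and> u' < 2 ^ bit_length y' \<and>
      bit_length z' = bit_length z + 1 \<and> z' div 2 = z)"
  (is "_ \<longrightarrow> _ \<longrightarrow> _ \<longrightarrow> _ \<or> ?ex")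
proof (intro impI)
  assume assms: "a = z * 2 ^ bit_length y + u" "u < 2 ^ bit_length y" "y \<le> a"
  have ?ex if "\<not> bit_length a < bit_length z + 1"
  proof -
  have "y \<noteq> 0" using assms that by (cases "y = 0") auto
  define k where "k = bit_length (y div 2)"
  have k: "bit_length y = Suc k" using bit_length_half[OF \<open>y \<noteq> 0\<close>] by (simp add: k_def)
  define z' where "z' = a div 2 ^ k"
  have "z = a div 2 ^ Suc k" using assms(1,2) by (simp add: k)
  then have z: "z' div 2 = z" by (simp add: z'_def flip: div_mult2_eq)
      (simp add: mult.commute)
  \<comment> \<open>From y <= a it follows that |a| >= |y| = k + 1. So the longer leading part is
    nonzero and its length is exactly one more than that of its half z.\<close>
  have "\<not> a < 2 ^ k" using bit_length_mono[OF assms(3)] by (simp add: k flip: bit_length_le_iff)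
  then have "z' \<noteq> 0" by (simp add: z'_def div_eq_0_iff)
  then have "bit_length z' = bit_length z + 1" using bit_length_half z by simp
  moreover have "z' \<le> a" "y div 2 \<le> a" "a mod 2 ^ k \<le> a" using assms(3) by (auto simp: z'_def)
  moreover have "a = z' * 2 ^ k + a mod 2 ^ k" "a mod 2 ^ k < 2 ^ k"
    unfolding z'_def div_mult_mod_eq by simp_all
  ultimately show ?thesis using z unfolding k_def by blast
  qed
  then show "bit_length a < bit_length z + 1 \<or> ?ex" by blast
qed

text \<open>If bits were cut off a nonzero z, then a >= 2z would have more bits than z.\<close>

lemma std_shift_end:
  assumes "a = z * 2 ^ k + u" "u < 2 ^ k" "bit_length z = bit_length a"
  shows "z = a"
proof (cases "k = 0 \<or> z = 0")
  case True
  then show ?thesis using assms by auto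
next
  case False
  then have "2 * z \<le> z * 2 ^ k" by (cases k) auto
  then have "bit_length (2 * z) \<le> bit_length a" using assms(1) by (intro bit_length_mono) linarith
  then show ?thesis using bit_length_double[of z] False assms(3) by simp
qed

text \<open>One exponent serves all three operations: N^c and N^d are at most N^(c+d), and the
  additional factor N >= 2 absorbs a sum of two such terms or a successor.\<close>

lemma std_len_ops:
  assumes "Suc (Suc 0) \<le> N" "bit_length x \<le> N ^ c" "bit_length y \<le> N ^ d"
  shows "bit_length (x + y) \<le> N ^ (c + d + 1)" "bit_length (x * y) \<le> N ^ (c + d + 1)"
    "Suc (bit_length x * bit_length y) \<le> N ^ (c + d + 1)"
proof -
  have 1: "N ^ c \<ge> 1" "N ^ d \<ge> 1" using assms(1) by simp_all
  have 2: "N ^ c \<le> N ^ (c + d)" "N ^ d \<le> N ^ (c + d)" using assms(1) by (simp_all add: power_increasing)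
  have 3: "2 * N ^ (c + d) \<le> N ^ (c + d + 1)" using assms(1) by simp
  have 4: "N ^ (c + d) \<ge> 1" using assms(1) by simp
  have x: "x < 2 ^ (N ^ c)" and y: "y < 2 ^ (N ^ d)" using assms(2,3) by (simp_all add: bit_length_le_iff)
  have p: "x * y < 2 ^ (N ^ c + N ^ d)"
    using x y by (simp add: power_add mult_strict_mono)
  moreover have "N ^ c + N ^ d \<le> N ^ (c + d + 1)" using 2 3 by linarith
  ultimately show "bit_length (x * y) \<le> N ^ (c + d + 1)"
    by (meson bit_length_le_iff le_trans)
  have "x < 2 ^ (N ^ (c + d))" "y < 2 ^ (N ^ (c + d))"
    using assms 2 by (meson bit_length_le_iff le_trans)+
  then have "x + y < 2 ^ Suc (N ^ (c + d))" by simp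
  moreover have "Suc (N ^ (c + d)) \<le> N ^ (c + d + 1)" using 3 4 by linarith
  ultimately show "bit_length (x + y) \<le> N ^ (c + d + 1)" by (meson bit_length_le_iff le_trans)
  have "bit_length x * bit_length y \<le> N ^ (c + d)"
    using assms(2,3) by (simp add: power_add mult_le_mono)
  then show "Suc (bit_length x * bit_length y) \<le> N ^ (c + d + 1)" using 3 4 by linarith
qed

lemma std_BASIC: "p \<in> BASIC \<Longrightarrow> sat std \<iota> e p"
proof -
  have [simp]: "bit_length (x + x) = Suc (bit_length x)" if "x > 0" for x
    using bit_length_double[of x] that by (simp add: mult_2)
  have [simp]: "bit_length (Suc (x + x)) = Suc (bit_length x)" for x
    using bit_length_Suc_double[of x] by (simp add: mult_2)
  have [simp]: "Suc (bit_length (x div 2)) = bit_length x" if "x > 0" for x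
    using bit_length_half[of x] that by simp
  show "p \<in> BASIC \<Longrightarrow> sat std \<iota> e p"
    unfolding BASIC_def Let_def
    by (elim insertE) (auto simp: bit_length_mono algebra_simps power_add)
qed

section \<open>Elementary arithmetic inside a model\<close>

locale arith_model =
  fixes M :: "'m arith"
  assumes true_arith: "true_arith_model M"
begin

lemma closed_M: "closed_struct M"
  using true_arith by (simp add: true_arith_model_def)

lemma closed [simp, intro]:
  "\<zero>\<^bsub>M\<^esub> \<in> univ M" "\<one>\<^bsub>M\<^esub> \<in> univ M"
  "x \<in> univ M \<Longrightarrow> len_of M x \<in> univ M" "x \<in> univ M \<Longrightarrow> half_of M x \<in> univ M"
  "x \<in> univ M \<Longrightarrow> y \<in> univ M \<Longrightarrow> x \<oplus>\<^bsub>M\<^esub> y \<in> univ M"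
  "x \<in> univ M \<Longrightarrow> y \<in> univ M \<Longrightarrow> x \<otimes>\<^bsub>M\<^esub> y \<in> univ M"
  "x \<in> univ M \<Longrightarrow> y \<in> univ M \<Longrightarrow> x \<sharp>\<^bsub>M\<^esub> y \<in> univ M"
  using closed_M by (simp_all add: closed_struct_def)

lemma len_pow_closed [simp, intro]: "x \<in> univ M \<Longrightarrow> len_pow M x c \<in> univ M"
  by (induction c) (simp_all add: len_pow_def)

text \<open>Elements of \<open>M\<close> enter the transferred formulas as parameters naming
  themselves; the assignment is a dummy.\<close>

lemma transfer_id:
  assumes "\<And>\<iota> e. sat std \<iota> e p" "arith_fm p" "params p \<subseteq> univ M"
  shows "sat M id (\<lambda>_. \<zero>\<^bsub>M\<^esub>) p"
  using transfer[OF true_arith assms(2,3) _ assms(1)] by simp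

lemma le_refl [simp]: "x \<in> univ M \<Longrightarrow> x \<sqsubseteq>\<^bsub>M\<^esub> x"
  using transfer_id[of "Le (Par x) (Par x)"] by simp

lemma zero_le [simp]: "x \<in> univ M \<Longrightarrow> \<zero>\<^bsub>M\<^esub> \<sqsubseteq>\<^bsub>M\<^esub> x"
  using transfer_id[of "Le Zero (Par x)"] by simp

lemma le_trans:
  assumes "x \<sqsubseteq>\<^bsub>M\<^esub> y" "y \<sqsubseteq>\<^bsub>M\<^esub> z" "x \<in> univ M" "y \<in> univ M" "z \<in> univ M"
  shows "x \<sqsubseteq>\<^bsub>M\<^esub> z"
  using transfer_id[of "Imp (Le (Par x) (Par y)) (Imp (Le (Par y) (Par z)) (Le (Par x) (Par z)))"] assms
  by simp

lemma le_antisym: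
  assumes "x \<sqsubseteq>\<^bsub>M\<^esub> y" "y \<sqsubseteq>\<^bsub>M\<^esub> x" "x \<in> univ M" "y \<in> univ M"
  shows "x = y"
  using transfer_id[of "Imp (Le (Par x) (Par y)) (Imp (Le (Par y) (Par x)) (Eq (Par x) (Par y)))"] assms
  by simp

lemma le_total:
  assumes "x \<in> univ M" "y \<in> univ M"
  shows "x \<sqsubseteq>\<^bsub>M\<^esub> y \<or> y \<sqsubseteq>\<^bsub>M\<^esub> x"
  using transfer_id[of "Or (Le (Par x) (Par y)) (Le (Par y) (Par x))"] assms
  by (simp add: linorder_linear)

lemma lt_le_trans:
  assumes "x \<sqsubset>\<^bsub>M\<^esub> y" "y \<sqsubseteq>\<^bsub>M\<^esub> z" "x \<in> univ M" "y \<in> univ M" "z \<in> univ M"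
  shows "x \<sqsubset>\<^bsub>M\<^esub> z"
  using assms le_trans le_antisym by (metis lt_of_def)

lemma below_univ: "x \<in> below M m \<Longrightarrow> x \<in> univ M"
  by (simp add: below_def)

lemma len_mono: "x \<sqsubseteq>\<^bsub>M\<^esub> y \<Longrightarrow> x \<in> univ M \<Longrightarrow> y \<in> univ M \<Longrightarrow> len_of M x \<sqsubseteq>\<^bsub>M\<^esub> len_of M y"
  using transfer_id[of "Imp (Le (Par x) (Par y)) (Le (Len (Par x)) (Len (Par y)))"]
  by (simp add: bit_length_mono)

text \<open>The order of \<open>M\<close> need not be well-founded, but for one formula the least
  number principle is itself a formula, true in \<open>std\<close>. This is the induction used
  inside \<open>M\<close>.\<close>

lemma least_number:
  assumes p: "arith_fm p" "params p \<subseteq> univ M" and e: "range e \<subseteq> univ M"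
    and x: "x \<in> univ M" "sat M id (case_nat x e) p"
  shows "\<exists>x\<in>univ M. sat M id (case_nat x e) p \<and>
    (\<forall>y\<in>univ M. y \<sqsubset>\<^bsub>M\<^esub> x \<longrightarrow> \<not> sat M id (case_nat y e) p)"
proof -
  \<comment> \<open>In the scope of the inner quantifier the outer bound variable has index 1, so
    index 0 is kept and the remaining ones jump over it.\<close>
  define \<sigma> :: "nat \<Rightarrow> 'm tm" where "\<sigma> = case_nat (Var 0) (\<lambda>i. Var (i + 2))"
  have \<sigma>: "(\<lambda>i. tval A \<iota> (case_nat y (case_nat x e)) (\<sigma> i)) = case_nat y e"
    for A :: "'z arith" and \<iota> x y e
    by (rule ext) (simp add: \<sigma>_def split: nat.split)
  have par: "params (subst \<sigma> p) \<subseteq> univ M"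
    using params_subst[of \<sigma> p] p(2) by (fastforce simp: \<sigma>_def split: nat.splits)
  let ?q = "Imp (Ex p) (Ex (And p (BAll_lt (Var 0) (Neg (subst \<sigma> p)))))"
  have "sat std \<iota> e ?q" for \<iota> e
    using exists_least_iff[of "\<lambda>x. sat std \<iota> (case_nat x e) p"]
    by (simp add: sat_subst \<sigma>) blast
  moreover have "arith_fm ?q" "params ?q \<subseteq> univ M"
    using p par by (simp_all add: BAll_lt_def)
  ultimately have "sat M id e ?q" using transfer[OF true_arith, of ?q e] e by blast
  then show ?thesis using x by (auto simp: sat_subst \<sigma> below_def)
qed

end

section \<open>The cut \<open>\<I>\<close>\<close>

lemma sharply_bounded_fam_free: "sharply_bounded p \<Longrightarrow> fam_free p"
  by (induction rule: sharply_bounded.induct) (simp_all add: BAll_def BEx_def)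

lemma sigma_b1_fam_free: "sigma_b1 p \<Longrightarrow> fam_free p"
  by (induction rule: sigma_b1.induct) (simp_all add: BAll_def BEx_def sharply_bounded_fam_free)

text \<open>Bounded quantifiers are abbreviations, so closure of the classes under substitution
  depends on the shifted bound commuting with \<open>up\<close>.\<close>

lemma subst_BAll_BEx:
  "subst \<sigma> (BAll t p) = BAll (subst_tm \<sigma> t) (subst (up \<sigma>) p)"
  "subst \<sigma> (BEx t p) = BEx (subst_tm \<sigma> t) (subst (up \<sigma>) p)"
proof -
  have "subst_tm (up \<sigma>) (shift 1 t) = shift 1 (subst_tm \<sigma> t)"
    by (induction t) (simp_all add: up_def)
  then show "subst \<sigma> (BAll t p) = BAll (subst_tm \<sigma> t) (subst (up \<sigma>) p)"
    "subst \<sigma> (BEx t p) = BEx (subst_tm \<sigma> t) (subst (up \<sigma>) p)"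
    by (simp_all add: BAll_def BEx_def up_def)
qed

lemma sharply_bounded_subst: "sharply_bounded p \<Longrightarrow> sharply_bounded (subst \<sigma> p)"
  by (induction arbitrary: \<sigma> rule: sharply_bounded.induct)
    (simp_all add: subst_BAll_BEx sharply_bounded.intros)

lemma sigma_b1_subst: "sigma_b1 p \<Longrightarrow> sigma_b1 (subst \<sigma> p)"
  by (induction arbitrary: \<sigma> rule: sigma_b1.induct)
    (simp_all add: subst_BAll_BEx sigma_b1.intros sharply_bounded_subst)

lemma sat_PIND: "sat A \<iota> e (PIND p) \<longleftrightarrow>
   (sat A \<iota> (case_nat \<zero>\<^bsub>A\<^esub> e) p \<and>
    (\<forall>x\<in>univ A. sat A \<iota> (case_nat (half_of A x) e) p \<longrightarrow> sat A \<iota> (case_nat x e) p) \<longrightarrow>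
    (\<forall>x\<in>univ A. sat A \<iota> (case_nat x e) p))"
proof -
  have "(\<lambda>i. tval A \<iota> (case_nat x e) (case_nat (Half (Var 0)) (\<lambda>i. Var (Suc i)) i)) =
      case_nat (half_of A x) e" for x
    by (rule ext) (simp split: nat.split)
  then show ?thesis by (simp add: PIND_def sat_inst sat_subst)
qed

lemma sat_IND: "sat A \<iota> e (IND p) \<longleftrightarrow>
   (sat A \<iota> (case_nat \<zero>\<^bsub>A\<^esub> e) p \<and>
    (\<forall>x\<in>univ A. sat A \<iota> (case_nat x e) p \<longrightarrow> sat A \<iota> (case_nat (x \<oplus>\<^bsub>A\<^esub> \<one>\<^bsub>A\<^esub>) e) p) \<longrightarrow>
    (\<forall>x\<in>univ A. sat A \<iota> (case_nat x e) p))"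
proof -
  have "(\<lambda>i. tval A \<iota> (case_nat x e) (case_nat (Add (Var 0) One) (\<lambda>i. Var (Suc i)) i)) =
      case_nat (x \<oplus>\<^bsub>A\<^esub> \<one>\<^bsub>A\<^esub>) e" for x
    by (rule ext) (simp split: nat.split)
  then show ?thesis by (simp add: IND_def sat_inst sat_subst)
qed

locale nonstandard_model = arith_model M for M :: "'m arith" +
  fixes n :: 'm
  assumes n_univ [simp]: "n \<in> univ M" and n_nonstandard: "\<not> standard M n"
begin

text \<open>Being neither 0 nor 1, n has two bits at least. This makes a further factor |n| absorb
  doublings and added constants.\<close>

lemma two_le_len: "\<one>\<^bsub>M\<^esub> \<oplus>\<^bsub>M\<^esub> \<one>\<^bsub>M\<^esub> \<sqsubseteq>\<^bsub>M\<^esub> len_of M n"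
proof -
  have "sat std \<iota> e (Or (Eq (Par n) Zero) (Or (Eq (Par n) (Add Zero One))
      (Le (Add One One) (Len (Par n)))))" for \<iota> :: "'m \<Rightarrow> nat" and e
    using less_bit_length_iff[of 1 "\<iota> n"] by auto
  from transfer_id[OF this]
  have "n = \<zero>\<^bsub>M\<^esub> \<or> n = \<zero>\<^bsub>M\<^esub> \<oplus>\<^bsub>M\<^esub> \<one>\<^bsub>M\<^esub> \<or> ?thesis" by simp
  moreover have "n \<noteq> \<zero>\<^bsub>M\<^esub>"
    using n_nonstandard unfolding standard_def by (metis funpow_0)
  moreover have "n \<noteq> \<zero>\<^bsub>M\<^esub> \<oplus>\<^bsub>M\<^esub> \<one>\<^bsub>M\<^esub>"
    using n_nonstandard unfolding standard_def by (metis funpow_0 funpow_Suc_right comp_apply)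
  ultimately show ?thesis by blast
qed

text \<open>In \<open>std\<close> the parameter n ranges over all numbers, 0 and 1 included, so
  transferred formulas carry this hypothesis explicitly.\<close>

definition two_le_len_fm :: "'m fm" where
  "two_le_len_fm = Le (Add One One) (Len (Par n))"

lemma two_le_len_fm_simps [simp]:
  "arith_fm two_le_len_fm" "params two_le_len_fm = {n}"
  "tri_free two_le_len_fm" "fam_free two_le_len_fm"
  "sat A \<iota> e two_le_len_fm \<longleftrightarrow> \<one>\<^bsub>A\<^esub> \<oplus>\<^bsub>A\<^esub> \<one>\<^bsub>A\<^esub> \<sqsubseteq>\<^bsub>A\<^esub> len_of A (\<iota> n)"
  by (simp_all add: two_le_len_fm_def)

text \<open>As 2^(N^c) has N^c + 1 bits, the exponent c + 1 bounds the length. Conversely 2^(N^c) -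
  1 is a number with exactly N^c bits, as the definition of the cut requires of its witness
  z.\<close>

lemma cut_iff: "m \<in> univ (cut M n) \<longleftrightarrow> m \<in> univ M \<and> (\<exists>c. len_of M m \<sqsubseteq>\<^bsub>M\<^esub> len_pow M n c)"
proof (intro iffI conjI)
  assume "m \<in> univ (cut M n)"
  then obtain c z where m: "m \<in> univ M" "z \<in> univ M" "len_of M z = len_pow M n c"
    "m \<sqsubseteq>\<^bsub>M\<^esub> \<one>\<^bsub>M\<^esub> \<sharp>\<^bsub>M\<^esub> z" by (auto simp: cut_def)
  then show "m \<in> univ M" by simp
  have "sat std \<iota> e (Imp two_le_len_fm (Imp (Eq (Len (Par z)) (len_pow_tm (Par n) c))
     (Imp (Le (Par m) (Smash One (Par z))) (Le (Len (Par m)) (len_pow_tm (Par n) (Suc c))))))"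
    for \<iota> :: "'m \<Rightarrow> nat" and e
  proof -
    define N where "N = bit_length (\<iota> n)"
    { assume N: "Suc (Suc 0) \<le> N" and "\<iota> m \<le> 2 ^ (N ^ c)"
      then have "bit_length (\<iota> m) \<le> Suc (N ^ c)"
        by (metis bit_length_mono bit_length_two_power)
      also have "\<dots> \<le> N ^ c + N ^ c" using N by simp
      also have "\<dots> \<le> N * N ^ c" using mult_le_mono1[OF N, of "N ^ c"] by simp
      finally have "bit_length (\<iota> m) \<le> N * N ^ c" . }
    then show ?thesis by (auto simp: N_def)
  qed
  from transfer_id[OF this] show "\<exists>c. len_of M m \<sqsubseteq>\<^bsub>M\<^esub> len_pow M n c"
    using m two_le_len by auto
next
  assume "m \<in> univ M \<and> (\<exists>c. len_of M m \<sqsubseteq>\<^bsub>M\<^esub> len_pow M n c)"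
  then obtain c where m: "m \<in> univ M" "len_of M m \<sqsubseteq>\<^bsub>M\<^esub> len_pow M n c" by auto
  have "sat std \<iota> e (Imp (Le (Len (Par m)) (len_pow_tm (Par n) c))
     (Ex (And (Eq (Len (Var 0)) (len_pow_tm (Par n) c)) (Le (Par m) (Smash One (Var 0))))))"
    for \<iota> :: "'m \<Rightarrow> nat" and e
    by (auto simp: bit_length_le_iff intro!: exI[of _ "2 ^ (bit_length (\<iota> n) ^ c) - Suc 0"])
  from transfer_id[OF this] m show "m \<in> univ (cut M n)"
    by (auto simp: cut_def)
qed

lemma cut_univ: "m \<in> univ (cut M n) \<Longrightarrow> m \<in> univ M"
  by (simp add: cut_iff)

lemma cut_downward:
  assumes "m' \<sqsubseteq>\<^bsub>M\<^esub> m" "m \<in> univ (cut M n)" "m' \<in> univ M"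
  shows "m' \<in> univ (cut M n)"
  using assms len_mono[OF assms(1)] le_trans unfolding cut_iff by (metis closed(3) len_pow_closed n_univ)

lemma below_in_cut: "x \<in> below M m \<Longrightarrow> m \<in> univ (cut M n) \<Longrightarrow> x \<in> univ (cut M n)"
  using cut_downward by (auto simp: below_def lt_of_def)

lemma cut_sel [simp]:
  "zero_of (cut M n) = zero_of M" "one_of (cut M n) = one_of M" "plus_of (cut M n) = plus_of M"
  "times_of (cut M n) = times_of M" "len_of (cut M n) = len_of M" "half_of (cut M n) = half_of M"
  "smash_of (cut M n) = smash_of M" "le_of (cut M n) = le_of M"
  by (simp_all add: cut_def)

lemma cut_tri_sel [simp]:
  "univ (cut_tri M n R) = univ (cut M n)"
  "zero_of (cut_tri M n R) = zero_of M" "one_of (cut_tri M n R) = one_of M"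
  "plus_of (cut_tri M n R) = plus_of M"
  "times_of (cut_tri M n R) = times_of M" "len_of (cut_tri M n R) = len_of M"
  "half_of (cut_tri M n R) = half_of M"
  "smash_of (cut_tri M n R) = smash_of M" "le_of (cut_tri M n R) = le_of M"
  "tri_of (cut_tri M n R) = R"
  by (simp_all add: cut_tri_def)

lemma n_in_cut [simp]: "n \<in> univ (cut M n)"
proof -
  have "sat std \<iota> e (Le (Len (Par n)) (len_pow_tm (Par n) 1))" for \<iota> :: "'m \<Rightarrow> nat" and e by simp
  from transfer_id[OF this] show ?thesis unfolding cut_iff by auto
qed

lemma closed_cut: "closed_struct (cut M n)"
proof -
  have 0: "\<zero>\<^bsub>M\<^esub> \<in> univ (cut M n)"
    by (rule cut_downward[OF zero_le n_in_cut]) simp_all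
  have "\<one>\<^bsub>M\<^esub> \<sqsubseteq>\<^bsub>M\<^esub> n"
  proof -
    have "sat std \<iota> e (Imp two_le_len_fm (Le One (Par n)))" for \<iota> :: "'m \<Rightarrow> nat" and e
      using bit_length_le_self[of "\<iota> n"] by auto
    from transfer_id[OF this] show ?thesis using two_le_len by simp
  qed
  then have 1: "\<one>\<^bsub>M\<^esub> \<in> univ (cut M n)" by (rule cut_downward) simp_all
  have 2: "len_of M x \<in> univ (cut M n) \<and> half_of M x \<in> univ (cut M n)" if x: "x \<in> univ (cut M n)" for x
  proof -
    have "sat std \<iota> e (And (Le (Len (Par x)) (Par x)) (Le (Half (Par x)) (Par x)))"
      for \<iota> :: "'m \<Rightarrow> nat" and e
      by (simp add: bit_length_le_self)
    from transfer_id[OF this] cut_univ[OF x] have "len_of M x \<sqsubseteq>\<^bsub>M\<^esub> x" "half_of M x \<sqsubseteq>\<^bsub>M\<^esub> x" by auto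
    then show ?thesis using x cut_univ[OF x] by (auto intro: cut_downward)
  qed
  have 3: "x \<oplus>\<^bsub>M\<^esub> y \<in> univ (cut M n) \<and> x \<otimes>\<^bsub>M\<^esub> y \<in> univ (cut M n) \<and> x \<sharp>\<^bsub>M\<^esub> y \<in> univ (cut M n)"
    if xy: "x \<in> univ (cut M n)" "y \<in> univ (cut M n)" for x y
  proof -
    obtain c d where cd: "len_of M x \<sqsubseteq>\<^bsub>M\<^esub> len_pow M n c" "len_of M y \<sqsubseteq>\<^bsub>M\<^esub> len_pow M n d"
      using xy by (auto simp: cut_iff)
    let ?b = "len_pow_tm (Par n) (c + d + 1)"
    have "sat std \<iota> e (Imp two_le_len_fm (Imp (Le (Len (Par x)) (len_pow_tm (Par n) c))
      (Imp (Le (Len (Par y)) (len_pow_tm (Par n) d)) (And (Le (Len (Add (Par x) (Par y))) ?b)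
       (And (Le (Len (Mul (Par x) (Par y))) ?b) (Le (Len (Smash (Par x) (Par y))) ?b))))))"
      for \<iota> :: "'m \<Rightarrow> nat" and e
      using std_len_ops[of "bit_length (\<iota> n)" "\<iota> x" c "\<iota> y" d] by simp
    from transfer_id[OF this] show ?thesis using two_le_len cd xy[THEN cut_univ]
      unfolding cut_iff by auto
  qed
  show ?thesis unfolding closed_struct_def using 0 1 2 3 by simp
qed

text \<open>The axioms are quantifier-free and do not mention the order, so they pass from
  \<open>M\<close> to its substructure.\<close>

lemma BASIC_valid_cut:
  fixes q :: "'m fm"
  assumes "q \<in> BASIC"
  shows "valid (cut_tri M n R) \<iota> q"
  unfolding valid_def
proof (intro allI impI)
  fix e :: "nat \<Rightarrow> 'm"
  assume e: "range e \<subseteq> univ (cut_tri M n R)"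
  have tv: "tval (cut_tri M n R) \<iota> e t = tval M \<iota> e t" for e t
    by (rule tval_struct_cong) simp_all
  have q: "arith_fm q" "params q = {}"
    "sat (cut_tri M n R) \<iota> e q \<longleftrightarrow> sat M \<iota> e q"
    using assms unfolding BASIC_def Let_def by (elim insertE emptyE; simp add: tv)+
  have "range e \<subseteq> univ M" using e cut_univ unfolding cut_tri_sel by blast
  then have "sat M id e q" using transfer[OF true_arith q(1), of e] q(2) std_BASIC[OF assms] by simp
  also have "sat M id e q \<longleftrightarrow> sat M \<iota> e q" by (rule sat_cong) (simp_all add: q(2))
  finally show "sat (cut_tri M n R) \<iota> e q" unfolding q(3) .
qed

text \<open>Polynomial induction on \<open>x\<close> is ordinary induction on the number \<open>i\<close> of leading bits: the
  induction formula says that \<open>p\<close> holds of the number \<open>z\<close> formed by the first \<open>i\<close> bits of \<open>x\<close>.\<close>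

lemma PIND_valid_cut:
  fixes p :: "'m fm"
  assumes IND: "sigma_b1_induction (cut_tri M n R)" and p: "sigma_b1 p" "params p = {}"
  shows "valid (cut_tri M n R) \<iota> (PIND p)"
  unfolding valid_def sat_PIND
proof (intro allI impI ballI, elim conjE)
  let ?A = "cut_tri M n R" and ?C = "univ (cut M n)"
  fix e x
  assume e: "range e \<subseteq> univ ?A" and "x \<in> univ ?A"
    and p0: "sat ?A \<iota> (case_nat \<zero>\<^bsub>?A\<^esub> e) p"
    and pS: "\<forall>x\<in>univ ?A. sat ?A \<iota> (case_nat (half_of ?A x) e) p \<longrightarrow> sat ?A \<iota> (case_nat x e) p"
  then have x: "x \<in> ?C" and xM: "x \<in> univ M" by (simp_all add: cut_iff)
  \<comment> \<open>The induction formula below has x as a parameter and needs the interpretation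
    \<open>id\<close>; as \<open>p\<close> has no parameters, the change from \<open>\<iota>\<close>
    is harmless.\<close>
  define P where "P z \<longleftrightarrow> sat ?A id (case_nat z e) p" for z
  have P: "P z \<longleftrightarrow> sat ?A \<iota> (case_nat z e) p" for z
    unfolding P_def by (rule sat_cong) (simp_all add: p)
  \<comment> \<open>In the formula q the indices 0, 1, 2, 3 stand for u, y, z and the induction
    variable i.\<close>
  define \<sigma> :: "nat \<Rightarrow> 'm tm" where "\<sigma> = case_nat (Var 2) (\<lambda>k. Var (k + 4))"
  have \<sigma>: "(\<lambda>k. tval ?A id (case_nat u (case_nat y (case_nat z (case_nat i e)))) (\<sigma> k)) = case_nat z e"
    for u y z i
    by (rule ext) (simp add: \<sigma>_def split: nat.split)
  \<comment> \<open>z consists of the first i bits of x and u of the remaining |y| bits. The number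
    y acts only through its length, since 1 # y is 2^|y|.\<close>
  define Q where "Q i z y u \<longleftrightarrow> x = z \<otimes>\<^bsub>M\<^esub> \<one>\<^bsub>M\<^esub> \<sharp>\<^bsub>M\<^esub> y \<oplus>\<^bsub>M\<^esub> u \<and> u \<sqsubset>\<^bsub>M\<^esub> \<one>\<^bsub>M\<^esub> \<sharp>\<^bsub>M\<^esub> y \<and> len_of M z = i"
    for i z y u
  \<comment> \<open>The first disjunct makes the formula true past the last bit of x; bounding all
    witnesses by x keeps it \<open>sigma_b1\<close>.\<close>
  define q where "q = Or (Lt (Len (Par x)) (Var 0)) (BEx (Par x) (BEx (Par x) (BEx (Par x)
    (And (And (Eq (Par x) (Add (Mul (Var 2) (Smash One (Var 1))) (Var 0)))
      (And (Lt (Var 0) (Smash One (Var 1))) (Eq (Len (Var 2)) (Var 3)))) (subst \<sigma> p)))))"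
  have q1: "sigma_b1 q" unfolding q_def
    by (intro sigma_b1.intros(2-) sigma_b1_subst p sigma_b1.intros(1) sharply_bounded.intros)
  have q2: "params q \<subseteq> univ ?A"
    using params_subst[of \<sigma> p] p x
    by (fastforce simp: q_def BEx_def \<sigma>_def split: nat.splits)
  have sat_q: "sat ?A id (case_nat i e) q \<longleftrightarrow> len_of M x \<sqsubset>\<^bsub>M\<^esub> i \<or>
      (\<exists>z\<in>?C. z \<sqsubseteq>\<^bsub>M\<^esub> x \<and> (\<exists>y\<in>?C. y \<sqsubseteq>\<^bsub>M\<^esub> x \<and> (\<exists>u\<in>?C. u \<sqsubseteq>\<^bsub>M\<^esub> x \<and> Q i z y u \<and> P z)))" for i
    by (simp add: q_def sat_subst \<sigma> Q_def P_def lt_of_def)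
  have down: "z \<in> ?C" if "z \<in> univ M" "z \<sqsubseteq>\<^bsub>M\<^esub> x" for z
    using that x cut_downward by blast
  \<comment> \<open>No bits are taken at i = 0: z = 0 and y = u = x work because x < 2^|x|.\<close>
  have "sat ?A id (case_nat \<zero>\<^bsub>?A\<^esub> e) q"
  proof -
    have "sat std \<kappa> e (And (And (Eq (Par x) (Add (Mul Zero (Smash One (Par x))) (Par x)))
      (Lt (Par x) (Smash One (Par x)))) (Eq (Len Zero) Zero))" for \<kappa> :: "'m \<Rightarrow> nat" and e
      using less_two_power_bit_length[of "\<kappa> x"] by simp
    from transfer_id[OF this] have "Q \<zero>\<^bsub>M\<^esub> \<zero>\<^bsub>M\<^esub> x x" using xM by (simp add: Q_def lt_of_def)
    then show ?thesis
      using p0 x xM down[of "\<zero>\<^bsub>M\<^esub>"] unfolding sat_q P[symmetric] cut_tri_sel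
      by (meson closed(1) le_refl zero_le)
  qed
  moreover have "sat ?A id (case_nat (i \<oplus>\<^bsub>?A\<^esub> \<one>\<^bsub>?A\<^esub>) e) q" if i: "i \<in> univ ?A" and qi: "sat ?A id (case_nat i e) q" for i
  proof (cases "len_of M x \<sqsubset>\<^bsub>M\<^esub> i \<or> len_of M x \<sqsubset>\<^bsub>M\<^esub> i \<oplus>\<^bsub>M\<^esub> \<one>\<^bsub>M\<^esub>")
    case True
    have "sat std \<kappa> e (Imp (Lt (Len (Par x)) (Par i)) (Lt (Len (Par x)) (Add (Par i) One)))"
      for \<kappa> :: "'m \<Rightarrow> nat" and e by auto
    from transfer_id[OF this] i have "len_of M x \<sqsubset>\<^bsub>M\<^esub> i \<oplus>\<^bsub>M\<^esub> \<one>\<^bsub>M\<^esub>"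
      using True xM by (auto simp: lt_of_def cut_iff)
    then show ?thesis by (simp add: sat_q)
  next
    case False
    then obtain z y u where zyu: "z \<in> ?C" "z \<sqsubseteq>\<^bsub>M\<^esub> x" "y \<in> ?C" "y \<sqsubseteq>\<^bsub>M\<^esub> x" "u \<in> ?C" "u \<sqsubseteq>\<^bsub>M\<^esub> x"
      "Q i z y u" "P z" using qi unfolding sat_q by blast
    then have zyuM: "z \<in> univ M" "y \<in> univ M" "u \<in> univ M" by (simp_all add: cut_iff)
    let ?q = "Imp (Eq (Par x) (Add (Mul (Par z) (Smash One (Par y))) (Par u)))
      (Imp (Lt (Par u) (Smash One (Par y))) (Imp (Le (Par y) (Par x))
        (Or (Lt (Len (Par x)) (Add (Len (Par z)) One)) (BEx (Par x) (BEx (Par x) (BEx (Par x)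
          (And (Eq (Par x) (Add (Mul (Var 2) (Smash One (Var 1))) (Var 0)))
            (And (Lt (Var 0) (Smash One (Var 1))) (And (Eq (Len (Var 2)) (Add (Len (Par z)) One))
              (Eq (Half (Var 2)) (Par z)))))))))))"
    have "sat std \<kappa> e ?q" for \<kappa> :: "'m \<Rightarrow> nat" and e
      by (rule iffD2[OF _ std_shift_step[of "\<kappa> x" "\<kappa> z" "\<kappa> y" "\<kappa> u"]])
        (simp add: nat_less_le)
    from transfer_id[OF this] obtain z' y' u' where z': "z' \<in> univ M" "y' \<in> univ M" "u' \<in> univ M"
      "z' \<sqsubseteq>\<^bsub>M\<^esub> x" "y' \<sqsubseteq>\<^bsub>M\<^esub> x" "u' \<sqsubseteq>\<^bsub>M\<^esub> x" "Q (i \<oplus>\<^bsub>M\<^esub> \<one>\<^bsub>M\<^esub>) z' y' u'" "half_of M z' = z"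
      using zyu zyuM xM False by (auto simp: Q_def lt_of_def BEx_def)
    \<comment> \<open>The half of z' is z, so this is one application of the polynomial induction
      step.\<close>
    have "P z'" unfolding P by (rule pS[rule_format])
        (use z' down[of z'] \<open>P z\<close> in \<open>simp_all add: P\<close>)
    then have "len_of M x \<sqsubset>\<^bsub>M\<^esub> i \<oplus>\<^bsub>M\<^esub> \<one>\<^bsub>M\<^esub> \<or> (\<exists>z\<in>?C. z \<sqsubseteq>\<^bsub>M\<^esub> x \<and> (\<exists>y\<in>?C. y \<sqsubseteq>\<^bsub>M\<^esub> x \<and>
        (\<exists>u\<in>?C. u \<sqsubseteq>\<^bsub>M\<^esub> x \<and> Q (i \<oplus>\<^bsub>M\<^esub> \<one>\<^bsub>M\<^esub>) z y u \<and> P z)))"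
      using z' down by blast
    then show ?thesis by (simp add: sat_q)
  qed
  moreover have "sat ?A id e (IND q)"
    using IND q1 q2 e by (simp add: sigma_b1_induction_def valid_def)
  ultimately have "\<forall>i\<in>univ ?A. sat ?A id (case_nat i e) q"
    unfolding sat_IND by blast
  \<comment> \<open>At i = |x| the leading part z has full length, hence is x itself.\<close>
  then have "sat ?A id (case_nat (len_of M x) e) q"
    using closed_cut x unfolding closed_struct_def cut_tri_sel cut_sel by blast
  then obtain z y u where "z \<in> ?C" "y \<in> ?C" "u \<in> ?C" and Q: "Q (len_of M x) z y u" and "P z"
    unfolding sat_q by (auto simp: lt_of_def)
  then have zyuM: "z \<in> univ M" "y \<in> univ M" "u \<in> univ M" by (simp_all add: cut_iff)
  have "sat std \<kappa> e (Imp (Eq (Par x) (Add (Mul (Par z) (Smash One (Par y))) (Par u)))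
      (Imp (Lt (Par u) (Smash One (Par y))) (Imp (Eq (Len (Par z)) (Len (Par x))) (Eq (Par z) (Par x)))))"
      for \<kappa> :: "'m \<Rightarrow> nat" and e
    using std_shift_end[of "\<kappa> x" "\<kappa> z" "bit_length (\<kappa> y)" "\<kappa> u"] by auto
  from transfer_id[OF this] have "z = x" using Q zyuM xM by (auto simp: Q_def lt_of_def)
  then show "sat ?A \<iota> (case_nat x e) p" using \<open>P z\<close> by (simp add: P)
qed

lemma S12_valid_cut:
  fixes q :: "'m fm"
  assumes "sigma_b1_induction (cut_tri M n R)" "q \<in> S12"
  shows "valid (cut_tri M n R) \<iota> q"
  using assms(2) unfolding S12_def
proof (elim UnE)
  show ?thesis if "q \<in> {PIND p | p. sigma_b1 p \<and> params p = {}}"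
    using that PIND_valid_cut[OF assms(1)] by auto
qed (rule BASIC_valid_cut)

end

section \<open>Coded sequences in the standard model\<close>

text \<open>The first-order part of membership in \<open>Conds\<close>; the length bound, with its
  external exponent, is kept apart so that this can be written as a formula.\<close>

definition dseq :: "'a arith \<Rightarrow> 'a \<Rightarrow> 'a \<Rightarrow> 'a \<Rightarrow> bool" where
  "dseq A n w l \<longleftrightarrow> seq_len A n w l \<and> (\<forall>i\<in>below A l. \<exists>a\<in>below A n. seq_entry A n w i a) \<and>
     (\<forall>i\<in>below A l. \<forall>j\<in>below A l. \<forall>a\<in>univ A.
        seq_entry A n w i a \<and> seq_entry A n w j a \<longrightarrow> i = j)"

lemma conds_upto_dseq:
  "conds_upto A n c = {w \<in> univ A. \<exists>l\<in>univ A. dseq A n w l \<and> l \<sqsubseteq>\<^bsub>A\<^esub> len_pow A n c}"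
  unfolding conds_upto_def dseq_def by (simp add: conj_ac)

lemma Conds_dseq: "w \<in> Conds A n \<longleftrightarrow>
    w \<in> univ A \<and> (\<exists>c. \<exists>l\<in>univ A. dseq A n w l \<and> l \<sqsubseteq>\<^bsub>A\<^esub> len_pow A n c)"
  unfolding Conds_def conds_upto_def dseq_def by blast

definition in_el :: "'a arith \<Rightarrow> 'a \<Rightarrow> 'a \<Rightarrow> 'a \<Rightarrow> bool" where
  "in_el A n w a \<longleftrightarrow> (\<exists>l\<in>univ A. \<exists>i\<in>univ A. seq_len A n w l \<and> i \<sqsubset>\<^bsub>A\<^esub> l \<and> seq_entry A n w i a)"

lemma mem_el_iff: "a \<in> el A n w \<longleftrightarrow> a \<in> univ A \<and> in_el A n w a"
  by (auto simp: el_def in_el_def)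

definition dseq_fm :: "'c tm \<Rightarrow> 'c tm \<Rightarrow> 'c tm \<Rightarrow> 'c fm" where
  "dseq_fm n w l = And (Eq (Len w) (Add (Mul l (Len n)) One))
    (And (BAll_lt l (BEx_lt (shift 1 n) (seq_entry_fm (shift 2 n) (shift 2 w) (Var 1) (Var 0))))
      (BAll_lt l (BAll_lt (shift 1 l) (All (Imp
        (And (seq_entry_fm (shift 3 n) (shift 3 w) (Var 2) (Var 0))
          (seq_entry_fm (shift 3 n) (shift 3 w) (Var 1) (Var 0))) (Eq (Var 2) (Var 1)))))))"

lemma sat_dseq_fm [simp]:
  "sat A \<iota> e (dseq_fm n w l) \<longleftrightarrow> dseq A (tval A \<iota> e n) (tval A \<iota> e w) (tval A \<iota> e l)"
  by (simp add: dseq_fm_def dseq_def seq_len_def sat_seq_entry_fm tval_subst_tm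
      numeral_2_eq_2 numeral_3_eq_3)

definition in_el_fm :: "'c tm \<Rightarrow> 'c tm \<Rightarrow> 'c tm \<Rightarrow> 'c fm" where
  "in_el_fm n w a = Ex (Ex (And (Eq (Len (shift 2 w)) (Add (Mul (Var 1) (Len (shift 2 n))) One))
     (And (Lt (Var 0) (Var 1)) (seq_entry_fm (shift 2 n) (shift 2 w) (Var 0) (shift 2 a)))))"

lemma sat_in_el_fm [simp]:
  "sat A \<iota> e (in_el_fm n w a) \<longleftrightarrow> in_el A (tval A \<iota> e n) (tval A \<iota> e w) (tval A \<iota> e a)"
  by (simp add: in_el_fm_def in_el_def seq_len_def sat_seq_entry_fm tval_subst_tm lt_of_def
      numeral_2_eq_2)

lemma params_tm_rename [simp]: "params_tm (subst_tm (\<lambda>i. Var (f i)) t) = params_tm t"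
  by (induction t) auto

lemma seq_fm_params [simp]:
  "params (seq_entry_fm n w i a) = params_tm n \<union> params_tm w \<union> params_tm i \<union> params_tm a"
  "params (seq_prec_fm n w x y) = params_tm n \<union> params_tm w \<union> params_tm x \<union> params_tm y"
  "params (dseq_fm n w l) = params_tm n \<union> params_tm w \<union> params_tm l"
  "params (in_el_fm n w a) = params_tm n \<union> params_tm w \<union> params_tm a"
  by (auto simp: seq_entry_fm_def seq_prec_fm_def dseq_fm_def in_el_fm_def BAll_lt_def BEx_lt_def Let_def)

lemma seq_fm_arith [simp]:
  "tri_free (seq_entry_fm n w i a)" "fam_free (seq_entry_fm n w i a)"
  "tri_free (seq_prec_fm n w x y)" "fam_free (seq_prec_fm n w x y)"
  "tri_free (dseq_fm n w l)" "fam_free (dseq_fm n w l)"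
  "tri_free (in_el_fm n w a)" "fam_free (in_el_fm n w a)"
  by (auto simp: seq_entry_fm_def seq_prec_fm_def dseq_fm_def in_el_fm_def BAll_lt_def BEx_lt_def Let_def)

declare sat_seq_prec_fm [simp] sat_seq_entry_fm [simp]

section \<open>Orders given by lists, and their merging\<close>

definition lprec :: "'a list \<Rightarrow> 'a \<Rightarrow> 'a \<Rightarrow> bool" where
  "lprec xs x y \<longleftrightarrow> (\<exists>i j. i < j \<and> j < length xs \<and> xs ! i = x \<and> xs ! j = y)"

lemma lprec_Nil [simp]: "\<not> lprec [] x y"
  by (simp add: lprec_def)

lemma lprec_Cons [simp]: "lprec (z # zs) x y \<longleftrightarrow> x = z \<and> y \<in> set zs \<or> lprec zs x y"
proof
  assume "lprec (z # zs) x y"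
  then obtain i j where ij: "i < j" "j < Suc (length zs)" "(z # zs) ! i = x" "(z # zs) ! j = y"
    unfolding lprec_def by auto
  then obtain j' where [simp]: "j = Suc j'" by (cases j) auto
  from ij show "x = z \<and> y \<in> set zs \<or> lprec zs x y"
    by (cases i) (auto simp: lprec_def)
next
  assume "x = z \<and> y \<in> set zs \<or> lprec zs x y"
  then show "lprec (z # zs) x y"
  proof
    assume "x = z \<and> y \<in> set zs"
    then obtain j where "j < length zs" "zs ! j = y" "x = z" by (auto simp: in_set_conv_nth)
    then show ?thesis unfolding lprec_def by (intro exI[of _ 0] exI[of _ "Suc j"]) auto
  next
    assume "lprec zs x y"
    then obtain i j where "i < j" "j < length zs" "zs ! i = x" "zs ! j = y"
      unfolding lprec_def by auto
    then show ?thesis unfolding lprec_def by (intro exI[of _ "Suc i"] exI[of _ "Suc j"]) auto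
  qed
qed

lemma lprec_set: "lprec xs x y \<Longrightarrow> x \<in> set xs \<and> y \<in> set xs"
  by (induction xs) auto

lemma lprec_trans: "distinct xs \<Longrightarrow> lprec xs x y \<Longrightarrow> lprec xs y z \<Longrightarrow> lprec xs x z"
  by (induction xs) (auto dest: lprec_set)

lemma lprec_irrefl: "distinct xs \<Longrightarrow> \<not> lprec xs x x"
  by (induction xs) (auto dest: lprec_set)

lemma lprec_total: "x \<in> set xs \<Longrightarrow> y \<in> set xs \<Longrightarrow> x \<noteq> y \<Longrightarrow> lprec xs x y \<or> lprec xs y x"
  by (induction xs) auto

text \<open>A cycle in the union of two finite chains alternates between them, with all its turning
  points in both chains. So two chains have a common linear extension unless they order two
  common elements differently.\<close>

lemma merge_chains:
  assumes "distinct xs" "distinct ys" "\<And>x y. \<not> (lprec xs x y \<and> lprec ys y x)"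
  shows "\<exists>zs. distinct zs \<and> set zs = set xs \<union> set ys \<and> length zs \<le> length xs + length ys \<and>
    (\<forall>x y. lprec xs x y \<or> lprec ys x y \<longrightarrow> lprec zs x y)"
  using assms
proof (induction "length xs + length ys" arbitrary: xs ys rule: less_induct)
  case less
  show ?case
  proof (cases "xs = [] \<or> ys = []")
    case True
    then show ?thesis using less.prems
      by (intro exI[of _ "xs @ ys"]) auto
  next
    case False
    then obtain x xs' y ys' where xy: "xs = x # xs'" "ys = y # ys'" by (metis neq_Nil_conv)
    \<comment> \<open>A head that is also the head of the other list, or does not occur there, may
      come first in the merged list. Otherwise each head occurs later in the other list, and the two
      lists order the heads oppositely.\<close>
    consider "x = y" | "x \<notin> set ys" | "y \<notin> set xs" | "x \<noteq> y" "x \<in> set ys'" "y \<in> set xs'"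
      using xy by auto
    then show ?thesis
    proof cases
      case 1
      have "\<exists>zs. distinct zs \<and> set zs = set xs' \<union> set ys' \<and> length zs \<le> length xs' + length ys' \<and>
          (\<forall>x y. lprec xs' x y \<or> lprec ys' x y \<longrightarrow> lprec zs x y)"
        by (rule less.hyps) (use less.prems xy in auto)
      then obtain zs where "distinct zs" "set zs = set xs' \<union> set ys'" "length zs \<le> length xs' + length ys'"
        "\<And>x y. lprec xs' x y \<or> lprec ys' x y \<longrightarrow> lprec zs x y" by blast
      then show ?thesis using less.prems 1 unfolding xy by (intro exI[of _ "x # zs"]) auto
    next
      case 2
      have "\<exists>zs. distinct zs \<and> set zs = set xs' \<union> set ys \<and> length zs \<le> length xs' + length ys \<and>
          (\<forall>x y. lprec xs' x y \<or> lprec ys x y \<longrightarrow> lprec zs x y)"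
        by (rule less.hyps) (use less.prems xy in auto)
      then obtain zs where "distinct zs" "set zs = set xs' \<union> set ys" "length zs \<le> length xs' + length ys"
        "\<And>x y. lprec xs' x y \<or> lprec ys x y \<longrightarrow> lprec zs x y" by blast
      then show ?thesis using less.prems 2 unfolding xy by (intro exI[of _ "x # zs"]) auto
    next
      case 3
      have "\<exists>zs. distinct zs \<and> set zs = set xs \<union> set ys' \<and> length zs \<le> length xs + length ys' \<and>
          (\<forall>x y. lprec xs x y \<or> lprec ys' x y \<longrightarrow> lprec zs x y)"
        by (rule less.hyps) (use less.prems xy in auto)
      then obtain zs where "distinct zs" "set zs = set xs \<union> set ys'" "length zs \<le> length xs + length ys'"
        "\<And>x y. lprec xs x y \<or> lprec ys' x y \<longrightarrow> lprec zs x y" by blast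
      then show ?thesis using less.prems 3 unfolding xy by (intro exI[of _ "y # zs"]) auto
    next
      case 4
      then show ?thesis using less.prems(3)[of x y] xy by auto
    qed
  qed
qed

section \<open>Decoding and building codes of lists\<close>

abbreviation block :: "nat \<Rightarrow> nat \<Rightarrow> nat \<Rightarrow> nat" where
  "block n w i \<equiv> w div 2 ^ (bit_length n * i) mod 2 ^ bit_length n"

lemma seq_entry_std: "seq_entry std n w i a \<longleftrightarrow> a = block n w i"
proof
  assume "seq_entry std n w i a"
  then obtain u v where "u < 2 ^ (bit_length n * i)" "a < 2 ^ bit_length n"
    "w = u + 2 ^ (bit_length n * i) * (a + 2 ^ bit_length n * v)"
    unfolding seq_entry_def by auto
  then show "a = block n w i" by simp
next
  assume a: "a = block n w i"
  let ?P = "2 ^ (bit_length n * i) :: nat" and ?B = "2 ^ bit_length n :: nat"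
  have "w = w mod ?P + ?P * (w div ?P)" by simp
  also have "w div ?P = block n w i + ?B * (w div ?P div ?B)" by simp
  \<comment> \<open>The first witness only has to have bit length i, and 2^i - 1 does; the other two
    are the bits below and above block i.\<close>
  finally show "seq_entry std n w i a" unfolding seq_entry_def a
    by (intro bexI[of _ "2 ^ i - Suc 0"] bexI[of _ "w mod ?P"] bexI[of _ "w div ?P div ?B"]) simp_all
qed

definition dec :: "nat \<Rightarrow> nat \<Rightarrow> nat \<Rightarrow> nat list" where
  "dec n w l = map (block n w) [0..<l]"

lemma length_dec [simp]: "length (dec n w l) = l"
  by (simp add: dec_def)

lemma dseq_std_iff: "dseq std n w l \<longleftrightarrow>
    bit_length w = l * bit_length n + 1 \<and> distinct (dec n w l) \<and> set (dec n w l) \<subseteq> {..<n}"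
  unfolding dseq_def seq_len_def seq_entry_std dec_def
  by (auto simp: distinct_map inj_on_def image_subset_iff)

text \<open>For n > 0 the blocks have positive width, so the bit length of w determines l and the
  quantifiers over the sequence length collapse.\<close>

lemma seq_prec_std:
  assumes "n > 0" "bit_length w = l * bit_length n + 1"
  shows "seq_prec std n w x y \<longleftrightarrow> lprec (dec n w l) x y"
    and "in_el std n w x \<longleftrightarrow> x \<in> set (dec n w l)"
proof -
  have "bit_length n > 0" using assms(1) by (metis bit_length_eq_0_iff neq0_conv)
  then have l: "seq_len std n w l' \<longleftrightarrow> l' = l" for l'
    using assms(2) by (auto simp: seq_len_def)
  show "seq_prec std n w x y \<longleftrightarrow> lprec (dec n w l) x y"
    unfolding seq_prec_def lprec_def l seq_entry_std by (auto simp: dec_def cong: conj_cong)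
  show "in_el std n w x \<longleftrightarrow> x \<in> set (dec n w l)"
    unfolding in_el_def l seq_entry_std dec_def by auto
qed

lemma dseq_std_list:
  assumes "dseq std n w l" "n > 0"
  obtains xs where "length xs = l" "distinct xs" "set xs \<subseteq> {..<n}"
    "\<And>x y. seq_prec std n w x y \<longleftrightarrow> lprec xs x y" "\<And>x. in_el std n w x \<longleftrightarrow> x \<in> set xs"
  using that[of "dec n w l"] assms seq_prec_std[OF assms(2)] unfolding dseq_std_iff by simp

lemma block_0: "a < 2 ^ bit_length n \<Longrightarrow> block n (a + 2 ^ bit_length n * w) 0 = a"
  by simp

lemma block_Suc:
  "a < 2 ^ bit_length n \<Longrightarrow> block n (a + 2 ^ bit_length n * w) (Suc i) = block n w i"
  by (simp add: power_add div_mult2_eq)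

text \<open>A new low-order block moves the leading 1 of w up by b places; w > 0 ensures that there
  is a leading 1.\<close>

lemma bit_length_block:
  assumes "a < 2 ^ b" "w > 0"
  shows "bit_length (a + 2 ^ b * w) = bit_length w + b"
proof -
  obtain k where k: "bit_length w = Suc k" using assms(2) by (cases "bit_length w") auto
  then have w: "2 ^ k \<le> w" "w + 1 \<le> 2 ^ Suc k"
    using less_bit_length_iff[of k w] less_two_power_bit_length[of w] by auto
  have "2 ^ (k + b) \<le> a + 2 ^ b * w" using w(1) by (simp add: power_add trans_le_add2)
  moreover have "a + 2 ^ b * w < 2 ^ b * (w + 1)" using assms(1) by simp
  moreover have "2 ^ b * (w + 1) \<le> 2 ^ b * 2 ^ Suc k" using w(2) by (rule mult_le_mono2)
  ultimately have "bit_length (a + 2 ^ b * w) = Suc (k + b)"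
    by (intro bit_length_eqI) (simp_all add: power_add mult.commute)
  then show ?thesis using k by simp
qed

lemma dec_Cons:
  "a < 2 ^ bit_length n \<Longrightarrow> dec n (a + 2 ^ bit_length n * w) (Suc l) = a # dec n w l"
  unfolding dec_def upt_conv_Cons[OF zero_less_Suc] map_Suc_upt[symmetric] list.map map_map
  by (simp only: block_0 block_Suc comp_def cong: map_cong)

text \<open>The code is built from the end of the list: start with 1 for the empty list and prepend
  each entry as a low-order block.\<close>

lemma dseq_std_of_list:
  assumes "distinct xs" "set xs \<subseteq> {..<n}" "n > 0"
  obtains w where "dseq std n w (length xs)" "\<And>x y. seq_prec std n w x y \<longleftrightarrow> lprec xs x y"
proof -
  have "\<exists>w. bit_length w = length xs * bit_length n + 1 \<and> dec n w (length xs) = xs"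
    using assms(2)
  proof (induction xs)
    case Nil
    then show ?case by (intro exI[of _ "Suc 0"]) (simp add: dec_def)
  next
    case (Cons a xs)
    then obtain w where w: "bit_length w = length xs * bit_length n + 1" "dec n w (length xs) = xs"
      by auto
    then have "w > 0" using bit_length_eq_0_iff[of w] by (cases w) auto
    have a: "a < 2 ^ bit_length n"
      using Cons.prems less_two_power_bit_length[of n] by auto
    then show ?case using w bit_length_block[OF a \<open>w > 0\<close>] dec_Cons[OF a]
      by (intro exI[of _ "a + 2 ^ bit_length n * w"]) simp
  qed
  then obtain w where w: "bit_length w = length xs * bit_length n + 1" "dec n w (length xs) = xs"
    by blast
  show ?thesis
    by (rule that[of w]) (use w seq_prec_std[OF assms(3) w(1)] assms in \<open>simp_all add: dseq_std_iff\<close>)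
qed

text \<open>For d = 2c and j = k div d >= d: k < d(j+1) <= (j+1)^2, so k^c < (j+1)^d <= 2^(jd) <=
  2^k. The condition j >= d explains the threshold d * d.\<close>

lemma power_less_two_power: "\<exists>N. \<forall>k\<ge>N. k ^ c < (2::nat) ^ k"
proof (cases "c = 0")
  case False
  define d where "d = 2 * c"
  have "k ^ c < 2 ^ k" if k: "k \<ge> d * d" for k
  proof -
    define j where "j = k div d"
    have d: "d > 0" using False by (simp add: d_def)
    have j: "d \<le> j" using k d by (simp add: j_def less_eq_div_iff_mult_less_eq)
    have "k < d * (j + 1)" using d unfolding j_def
      by (metis Suc_eq_plus1 dividend_less_div_times mult.commute mult_Suc)
    then have "k ^ c < (d * (j + 1)) ^ c" using False by (intro power_strict_mono) auto
    also have "\<dots> \<le> ((j + 1) * (j + 1)) ^ c" using j by (intro power_mono mult_le_mono1) auto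
    also have "\<dots> = (j + 1) ^ d" by (simp add: d_def power_mult_distrib power_mult power2_eq_square)
    also have "\<dots> \<le> (2 ^ j) ^ d" by (intro power_mono) (simp_all add: Suc_le_eq)
    also have "\<dots> \<le> 2 ^ k"
      unfolding power_mult[symmetric] by (intro power_increasing) (simp_all add: j_def)
    finally show ?thesis .
  qed
  then show ?thesis by blast
next
  case True
  have "(1::nat) < 2 ^ k" if "k \<ge> 1" for k using that by (intro one_less_power) auto
  then show ?thesis using True by auto
qed

text \<open>With k = |m| large, 2 k^c <= k^(c+1) < 2^k <= 2m. This is the reason why no sequence in
  \<open>Conds\<close> can list all numbers below n.\<close>

lemma bit_length_power_less: "\<exists>N. \<forall>m\<ge>N. bit_length m ^ c < m"
proof -
  obtain N where N: "\<And>k. k \<ge> N \<Longrightarrow> k ^ (c + 1) < (2::nat) ^ k"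
    using power_less_two_power by blast
  have "bit_length m ^ c < m" if m: "m \<ge> 2 ^ (N + 2)" for m
  proof -
    let ?k = "bit_length m"
    have k: "N + 2 < ?k" using m less_bit_length_iff by blast
    have "2 * ?k ^ c \<le> ?k ^ (c + 1)" using k by simp
    also have "\<dots> < 2 ^ ?k" using N[of ?k] k by simp
    also have "\<dots> = 2 * 2 ^ (?k - 1)" using k by (cases ?k) auto
    also have "\<dots> \<le> 2 * m" using less_bit_length_iff[of "?k - 1" m] k by simp
    finally show ?thesis by simp
  qed
  then show ?thesis by blast
qed

section \<open>Coded sequences in the model\<close>

lemma extends_refl: "extends A n s s"
  by (simp add: extends_def)

lemma extends_trans: "extends A n u t \<Longrightarrow> extends A n t s \<Longrightarrow> extends A n u s"
  by (simp add: extends_def)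

text \<open>A pair ordered oppositely, which turns out to be the only obstacle to
  compatibility.\<close>

definition conflict :: "'a arith \<Rightarrow> 'a \<Rightarrow> 'a \<Rightarrow> 'a \<Rightarrow> bool" where
  "conflict A n w w' \<longleftrightarrow> (\<exists>x\<in>univ A. \<exists>y\<in>univ A. seq_prec A n w x y \<and> seq_prec A n w' y x)"

definition conflict_fm :: "'c tm \<Rightarrow> 'c tm \<Rightarrow> 'c tm \<Rightarrow> 'c fm" where
  "conflict_fm n w w' = Ex (Ex (And (seq_prec_fm (shift 2 n) (shift 2 w) (Var 1) (Var 0))
     (seq_prec_fm (shift 2 n) (shift 2 w') (Var 0) (Var 1))))"

definition ext_fm :: "'c tm \<Rightarrow> 'c tm \<Rightarrow> 'c tm \<Rightarrow> 'c fm" where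
  "ext_fm n t s = All (All (Imp (seq_prec_fm (shift 2 n) (shift 2 s) (Var 1) (Var 0))
     (seq_prec_fm (shift 2 n) (shift 2 t) (Var 1) (Var 0))))"

lemma conflict_ext_fm [simp]:
  "sat A \<iota> e (conflict_fm n w w') \<longleftrightarrow> conflict A (tval A \<iota> e n) (tval A \<iota> e w) (tval A \<iota> e w')"
  "sat A \<iota> e (ext_fm n w w') \<longleftrightarrow> extends A (tval A \<iota> e n) (tval A \<iota> e w) (tval A \<iota> e w')"
  "params (conflict_fm n w w') = params_tm n \<union> params_tm w \<union> params_tm w'"
  "params (ext_fm n w w') = params_tm n \<union> params_tm w \<union> params_tm w'"
  "tri_free (conflict_fm n w w')" "fam_free (conflict_fm n w w')"
  "tri_free (ext_fm n w w')" "fam_free (ext_fm n w w')"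
  by (auto simp: conflict_fm_def ext_fm_def conflict_def extends_def tval_subst_tm numeral_2_eq_2)

text \<open>Numerals in the shape used by \<open>standard\<close>, so that external thresholds can
  occur in transferred formulas.\<close>

definition num_tm :: "nat \<Rightarrow> 'c tm" where
  "num_tm k = ((\<lambda>t. Add t One) ^^ k) Zero"

lemma tval_num_tm: "tval A \<iota> e (num_tm k) = ((\<lambda>y. y \<oplus>\<^bsub>A\<^esub> \<one>\<^bsub>A\<^esub>) ^^ k) \<zero>\<^bsub>A\<^esub>"
  by (induction k) (simp_all add: num_tm_def)

lemma tval_num_tm_std [simp]: "tval std \<iota> e (num_tm k) = k"
  by (induction k) (simp_all add: num_tm_def)

lemma params_num_tm [simp]: "params_tm (num_tm k) = {}"
  by (induction k) (simp_all add: num_tm_def)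

section \<open>Facts about lists transferred to the elements of \<open>Conds\<close>\<close>

context nonstandard_model
begin

lemma dseq_facts:
  assumes "dseq M n w l" "w \<in> univ M" "l \<in> univ M" "x \<in> univ M" "y \<in> univ M" "z \<in> univ M"
  shows "seq_prec M n w x y \<Longrightarrow> x \<noteq> y \<and> in_el M n w x \<and> in_el M n w y"
    and "seq_prec M n w x y \<Longrightarrow> seq_prec M n w y z \<Longrightarrow> seq_prec M n w x z"
    and "in_el M n w x \<Longrightarrow> in_el M n w y \<Longrightarrow> x \<noteq> y \<Longrightarrow> seq_prec M n w x y \<or> seq_prec M n w y x"
    and "in_el M n w x \<Longrightarrow> x \<sqsubset>\<^bsub>M\<^esub> n"
proof -
  let ?p = "\<lambda>x y. seq_prec_fm (Par n) (Par w) (Par x) (Par y)" and ?i = "\<lambda>x. in_el_fm (Par n) (Par w) (Par x)"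
  let ?q = "Imp two_le_len_fm (Imp (dseq_fm (Par n) (Par w) (Par l)) (And
    (Imp (?p x y) (And (Neq (Par x) (Par y)) (And (?i x) (?i y)))) (And
    (Imp (?p x y) (Imp (?p y z) (?p x z))) (And
    (Imp (?i x) (Imp (?i y) (Imp (Neq (Par x) (Par y)) (Or (?p x y) (?p y x)))))
    (Imp (?i x) (Lt (Par x) (Par n)))))))"
  \<comment> \<open>The case distinction collects hypotheses of \<open>?q\<close>: when they hold, w
    decodes to a list; when they fail, \<open>?q\<close> is vacuous. The transfers below follow the
    same pattern.\<close>
  have "sat std \<iota> e ?q" for \<iota> e
  proof (cases "Suc (Suc 0) \<le> bit_length (\<iota> n) \<and> dseq std (\<iota> n) (\<iota> w) (\<iota> l)")
    case True
    then have "\<iota> n > 0" by (cases "\<iota> n") auto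
    with True obtain xs where "distinct xs" "set xs \<subseteq> {..<\<iota> n}"
      "\<And>x y. seq_prec std (\<iota> n) (\<iota> w) x y \<longleftrightarrow> lprec xs x y" "\<And>x. in_el std (\<iota> n) (\<iota> w) x \<longleftrightarrow> x \<in> set xs"
      using dseq_std_list by metis
    then show ?thesis
      using lprec_set[of xs] lprec_trans[of xs] lprec_irrefl[of xs] lprec_total[of _ xs] by auto
  qed auto
  from transfer_id[OF this]
  show "seq_prec M n w x y \<Longrightarrow> x \<noteq> y \<and> in_el M n w x \<and> in_el M n w y"
    and "seq_prec M n w x y \<Longrightarrow> seq_prec M n w y z \<Longrightarrow> seq_prec M n w x z"
    and "in_el M n w x \<Longrightarrow> in_el M n w y \<Longrightarrow> x \<noteq> y \<Longrightarrow> seq_prec M n w x y \<or> seq_prec M n w y x"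
    and "in_el M n w x \<Longrightarrow> x \<sqsubset>\<^bsub>M\<^esub> n"
    using assms two_le_len by (simp_all add: lt_of_def)
qed

lemma seq_prec_irrefl: "w \<in> Conds M n \<Longrightarrow> x \<in> univ M \<Longrightarrow> \<not> seq_prec M n w x x"
  using dseq_facts(1)[of w _ x x x] unfolding Conds_dseq by blast

lemma seq_prec_el:
  "w \<in> Conds M n \<Longrightarrow> x \<in> univ M \<Longrightarrow> y \<in> univ M \<Longrightarrow> seq_prec M n w x y \<Longrightarrow> x \<in> el M n w \<and> y \<in> el M n w"
  using dseq_facts(1)[of w _ x y x] unfolding Conds_dseq mem_el_iff by blast

lemma seq_prec_trans:
  "w \<in> Conds M n \<Longrightarrow> x \<in> univ M \<Longrightarrow> y \<in> univ M \<Longrightarrow> z \<in> univ M \<Longrightarrow>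
    seq_prec M n w x y \<Longrightarrow> seq_prec M n w y z \<Longrightarrow> seq_prec M n w x z"
  using dseq_facts(2)[of w _ x y z] unfolding Conds_dseq by blast

lemma seq_prec_total:
  "w \<in> Conds M n \<Longrightarrow> x \<in> el M n w \<Longrightarrow> y \<in> el M n w \<Longrightarrow> x \<noteq> y \<Longrightarrow>
    seq_prec M n w x y \<or> seq_prec M n w y x"
  using dseq_facts(3)[of w _ x y x] unfolding Conds_dseq mem_el_iff by blast

lemma el_below: "w \<in> Conds M n \<Longrightarrow> el M n w \<subseteq> below M n"
proof
  fix x
  assume w: "w \<in> Conds M n" and x: "x \<in> el M n w"
  then obtain l where "w \<in> univ M" "l \<in> univ M" "dseq M n w l" unfolding Conds_dseq by blast
  then show "x \<in> below M n" using dseq_facts(4)[of w l x x x] x by (simp add: mem_el_iff below_def)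
qed

text \<open>The merged list has length at most |n|^c1 + |n|^c2 <= |n|^(c1+c2+1), so its code stays
  in \<open>Conds\<close>.\<close>

lemma compatible_if_no_conflict:
  assumes w: "w1 \<in> Conds M n" "w2 \<in> Conds M n"
    and nc: "\<And>x y. x \<in> univ M \<Longrightarrow> y \<in> univ M \<Longrightarrow> \<not> (seq_prec M n w1 x y \<and> seq_prec M n w2 y x)"
  shows "compatible M n w1 w2"
proof -
  obtain c1 l1 c2 l2 where l: "l1 \<in> univ M" "dseq M n w1 l1" "l1 \<sqsubseteq>\<^bsub>M\<^esub> len_pow M n c1"
    "l2 \<in> univ M" "dseq M n w2 l2" "l2 \<sqsubseteq>\<^bsub>M\<^esub> len_pow M n c2"
    using w unfolding Conds_dseq by blast
  have wM: "w1 \<in> univ M" "w2 \<in> univ M" using w by (simp_all add: Conds_dseq)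
  let ?q = "Imp two_le_len_fm (Imp (dseq_fm (Par n) (Par w1) (Par l1)) (Imp (dseq_fm (Par n) (Par w2) (Par l2))
    (Imp (Le (Par l1) (len_pow_tm (Par n) c1)) (Imp (Le (Par l2) (len_pow_tm (Par n) c2))
    (Imp (Neg (conflict_fm (Par n) (Par w1) (Par w2)))
     (Ex (Ex (And (dseq_fm (Par n) (Var 1) (Var 0)) (And (Le (Var 0) (len_pow_tm (Par n) (c1 + c2 + 1)))
       (And (ext_fm (Par n) (Var 1) (Par w1)) (ext_fm (Par n) (Var 1) (Par w2))))))))))))"
  have "sat std \<iota> e ?q" for \<iota> e
  proof (cases "Suc (Suc 0) \<le> bit_length (\<iota> n) \<and> dseq std (\<iota> n) (\<iota> w1) (\<iota> l1) \<and>
      dseq std (\<iota> n) (\<iota> w2) (\<iota> l2) \<and> \<iota> l1 \<le> bit_length (\<iota> n) ^ c1 \<and> \<iota> l2 \<le> bit_length (\<iota> n) ^ c2 \<and>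
      \<not> conflict std (\<iota> n) (\<iota> w1) (\<iota> w2)")
    case True
    then have n: "\<iota> n > 0" by (cases "\<iota> n") auto
    obtain xs where xs: "length xs = \<iota> l1" "distinct xs" "set xs \<subseteq> {..<\<iota> n}"
      "\<And>x y. seq_prec std (\<iota> n) (\<iota> w1) x y \<longleftrightarrow> lprec xs x y"
      using dseq_std_list True n by metis
    obtain ys where ys: "length ys = \<iota> l2" "distinct ys" "set ys \<subseteq> {..<\<iota> n}"
      "\<And>x y. seq_prec std (\<iota> n) (\<iota> w2) x y \<longleftrightarrow> lprec ys x y"
      using dseq_std_list True n by metis
    have "\<not> (lprec xs x y \<and> lprec ys y x)" for x y
      using True by (simp add: conflict_def flip: xs(4) ys(4))
    then obtain zs where zs: "distinct zs" "set zs = set xs \<union> set ys" "length zs \<le> length xs + length ys"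
      "\<And>x y. lprec xs x y \<or> lprec ys x y \<longrightarrow> lprec zs x y"
      using merge_chains[OF xs(2) ys(2)] by blast
    then have "set zs \<subseteq> {..<\<iota> n}" using xs(3) ys(3) by simp
    then obtain w where w: "dseq std (\<iota> n) w (length zs)" "\<And>x y. seq_prec std (\<iota> n) w x y \<longleftrightarrow> lprec zs x y"
      using dseq_std_of_list zs(1) n by metis
    have "length zs \<le> bit_length (\<iota> n) * bit_length (\<iota> n) ^ (c1 + c2)"
    proof -
      let ?N = "bit_length (\<iota> n)"
      have N: "Suc (Suc 0) \<le> ?N" using True by simp
      have "length zs \<le> ?N ^ c1 + ?N ^ c2" using zs(3) xs(1) ys(1) True by linarith
      also have "\<dots> \<le> ?N ^ (c1 + c2) + ?N ^ (c1 + c2)"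
        using N by (intro add_mono power_increasing) auto
      also have "\<dots> \<le> ?N * ?N ^ (c1 + c2)" using mult_le_mono1[OF N, of "?N ^ (c1 + c2)"] by simp
      finally show ?thesis .
    qed
    then have "\<exists>w l. dseq std (\<iota> n) w l \<and> l \<le> bit_length (\<iota> n) * bit_length (\<iota> n) ^ (c1 + c2) \<and>
        extends std (\<iota> n) w (\<iota> w1) \<and> extends std (\<iota> n) w (\<iota> w2)"
      using w zs(4) xs(4) ys(4) unfolding extends_def by blast
    then show ?thesis by simp
  qed auto
  note q = this
  have "sat M id (\<lambda>_. \<zero>\<^bsub>M\<^esub>) ?q"
    by (rule transfer_id[OF q]) (use l wM in simp_all)
  moreover have "\<not> conflict M n w1 w2" using nc by (auto simp: conflict_def)
  ultimately have "\<exists>t\<in>univ M. \<exists>l\<in>univ M. dseq M n t l \<and> l \<sqsubseteq>\<^bsub>M\<^esub> len_pow M n (c1 + c2 + 1) \<and>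
    extends M n t w1 \<and> extends M n t w2"
    using l two_le_len by simp
  then obtain t l where "t \<in> univ M" "l \<in> univ M" "dseq M n t l" "l \<sqsubseteq>\<^bsub>M\<^esub> len_pow M n (c1 + c2 + 1)"
    and ext: "extends M n t w1" "extends M n t w2" by blast
  then have "t \<in> Conds M n" unfolding Conds_dseq by blast
  then show ?thesis using ext unfolding compatible_def by blast
qed

text \<open>Counting the entries of distinct lists shows that length increases along every step of a
  tree; it serves as the measure for the induction on nodes.\<close>

lemma length_grows:
  assumes "dseq M n w l" "dseq M n w' l'" "el M n w' = el M n w \<union> {a}" "a \<notin> el M n w"
    and univ: "w \<in> univ M" "w' \<in> univ M" "l \<in> univ M" "l' \<in> univ M"
  shows "l \<sqsubset>\<^bsub>M\<^esub> l'"
proof -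
  have a: "a \<in> univ M" using assms(3) by (auto simp: el_def)
  let ?q = "Imp two_le_len_fm (Imp (dseq_fm (Par n) (Par w) (Par l)) (Imp (dseq_fm (Par n) (Par w') (Par l'))
    (Imp (All (Imp (in_el_fm (Par n) (Par w) (Var 0)) (in_el_fm (Par n) (Par w') (Var 0))))
     (Imp (in_el_fm (Par n) (Par w') (Par a)) (Imp (Neg (in_el_fm (Par n) (Par w) (Par a)))
       (Lt (Par l) (Par l')))))))"
  have "sat std \<iota> e ?q" for \<iota> e
  proof (cases "Suc (Suc 0) \<le> bit_length (\<iota> n) \<and> dseq std (\<iota> n) (\<iota> w) (\<iota> l) \<and>
      dseq std (\<iota> n) (\<iota> w') (\<iota> l')")
    case True
    then have n: "\<iota> n > 0" by (cases "\<iota> n") auto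
    obtain xs where xs: "length xs = \<iota> l" "distinct xs" "\<And>x. in_el std (\<iota> n) (\<iota> w) x \<longleftrightarrow> x \<in> set xs"
      using dseq_std_list True n by metis
    obtain ys where ys: "length ys = \<iota> l'" "distinct ys" "\<And>x. in_el std (\<iota> n) (\<iota> w') x \<longleftrightarrow> x \<in> set ys"
      using dseq_std_list True n by metis
    have "\<iota> l \<le> \<iota> l' \<and> \<iota> l \<noteq> \<iota> l'" if "\<forall>x. x \<in> set xs \<longrightarrow> x \<in> set ys" "\<iota> a \<in> set ys" "\<iota> a \<notin> set xs"
    proof -
      have "card (set xs) < card (set ys)" using that by (intro psubset_card_mono) auto
      then show ?thesis using xs(1,2) ys(1,2) by (simp add: distinct_card)
    qed
    then show ?thesis by (simp add: xs ys)
  qed auto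
  from transfer_id[OF this] show ?thesis
    using assms a two_le_len by (simp add: mem_el_iff[symmetric] lt_of_def set_eq_iff) (auto simp: mem_el_iff)
qed

text \<open>If n >= k and n differs from the numeral k, then n >= k + 1.\<close>

lemma num_le_n: "((\<lambda>y. y \<oplus>\<^bsub>M\<^esub> \<one>\<^bsub>M\<^esub>) ^^ k) \<zero>\<^bsub>M\<^esub> \<sqsubseteq>\<^bsub>M\<^esub> n"
proof (induction k)
  case (Suc k)
  have "sat std \<iota> e (Imp (Le (num_tm k) (Par n)) (Or (Eq (Par n) (num_tm k)) (Le (Add (num_tm k) One) (Par n))))"
    for \<iota> :: "'m \<Rightarrow> nat" and e by auto
  from transfer_id[OF this] show ?case
    using Suc n_nonstandard by (auto simp: tval_num_tm standard_def)
qed simp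

text \<open>Being nonstandard, n lies above the threshold from which |m|^c < m. This guarantees that
  the \<open>LEAST\<close> in \<open>strategy_MIN\<close> is attained.\<close>

lemma missing_element:
  assumes "w \<in> Conds M n"
  shows "\<exists>a\<in>below M n. a \<notin> el M n w"
proof -
  obtain c l where l: "w \<in> univ M" "l \<in> univ M" "dseq M n w l" "l \<sqsubseteq>\<^bsub>M\<^esub> len_pow M n c"
    using assms unfolding Conds_dseq by blast
  obtain N where N: "\<And>m. m \<ge> N \<Longrightarrow> bit_length m ^ c < m" using bit_length_power_less by blast
  let ?q = "Imp two_le_len_fm (Imp (dseq_fm (Par n) (Par w) (Par l)) (Imp (Le (Par l) (len_pow_tm (Par n) c))
    (Imp (Le (num_tm N) (Par n)) (Ex (And (Lt (Var 0) (Par n)) (Neg (in_el_fm (Par n) (Par w) (Var 0))))))))"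
  have "sat std \<iota> e ?q" for \<iota> :: "'m \<Rightarrow> nat" and e
  proof (cases "Suc (Suc 0) \<le> bit_length (\<iota> n) \<and> dseq std (\<iota> n) (\<iota> w) (\<iota> l) \<and>
      \<iota> l \<le> bit_length (\<iota> n) ^ c \<and> N \<le> \<iota> n")
    case True
    then have n: "\<iota> n > 0" by (cases "\<iota> n") auto
    obtain xs where xs: "length xs = \<iota> l" "distinct xs" "\<And>x. in_el std (\<iota> n) (\<iota> w) x \<longleftrightarrow> x \<in> set xs"
      using dseq_std_list True n by metis
    have "length xs < \<iota> n" using N[of "\<iota> n"] True xs(1) by linarith
    then have "\<not> {..<\<iota> n} \<subseteq> set xs"
      using card_mono[of "set xs" "{..<\<iota> n}"] card_length[of xs] by fastforce
    then obtain a where "a < \<iota> n" "a \<notin> set xs" by auto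
    then have "a \<le> \<iota> n \<and> a \<noteq> \<iota> n \<and> a \<notin> set xs" by simp
    then show ?thesis by (auto simp: xs)
  qed auto
  from transfer_id[OF this] show ?thesis
    using l two_le_len num_le_n[of N] by (auto simp: below_def lt_of_def mem_el_iff tval_num_tm)
qed

text \<open>The arithmetic expression of \<open>strategy_MIN\<close> decodes to
  \<open>a # xs\<close> when w decodes to \<open>xs\<close>.\<close>

lemma prec_prepend:
  assumes "w \<in> Conds M n" "a \<in> below M n" "b \<in> el M n w"
  shows "seq_prec M n (a \<oplus>\<^bsub>M\<^esub> n \<sharp>\<^bsub>M\<^esub> \<one>\<^bsub>M\<^esub> \<otimes>\<^bsub>M\<^esub> w) a b"
proof -
  obtain l where l: "w \<in> univ M" "l \<in> univ M" "dseq M n w l"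
    using assms unfolding Conds_dseq by blast
  have univ: "a \<in> univ M" "a \<sqsubset>\<^bsub>M\<^esub> n" "b \<in> univ M" "in_el M n w b" using assms by (auto simp: below_def mem_el_iff)
  let ?q = "Imp two_le_len_fm (Imp (dseq_fm (Par n) (Par w) (Par l)) (Imp (Lt (Par a) (Par n))
    (Imp (in_el_fm (Par n) (Par w) (Par b))
      (seq_prec_fm (Par n) (Add (Par a) (Mul (Smash (Par n) One) (Par w))) (Par a) (Par b)))))"
  have "sat std \<iota> e ?q" for \<iota> e
  proof (cases "Suc (Suc 0) \<le> bit_length (\<iota> n) \<and> dseq std (\<iota> n) (\<iota> w) (\<iota> l) \<and>
      \<iota> a < \<iota> n \<and> in_el std (\<iota> n) (\<iota> w) (\<iota> b)")
    case True
    then have n: "\<iota> n > 0" by (cases "\<iota> n") auto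
    have len: "bit_length (\<iota> w) = \<iota> l * bit_length (\<iota> n) + 1" using True by (simp add: dseq_std_iff)
    then have "\<iota> w > 0" by (cases "\<iota> w") auto
    have a: "\<iota> a < 2 ^ bit_length (\<iota> n)" using True less_two_power_bit_length[of "\<iota> n"] by linarith
    have len': "bit_length (\<iota> a + 2 ^ bit_length (\<iota> n) * \<iota> w) = Suc (\<iota> l) * bit_length (\<iota> n) + 1"
      using bit_length_block[OF a \<open>\<iota> w > 0\<close>] len by simp
    show ?thesis
      using seq_prec_std(1)[OF n len', of "\<iota> a" "\<iota> b"] seq_prec_std(2)[OF n len, of "\<iota> b"] True
      by (simp add: dec_Cons[OF a])
  qed auto
  from transfer_id[OF this] show ?thesis
    using l univ two_le_len by (simp add: lt_of_def)
qed

text \<open>The sequence (0, 1) is allowed because |n| >= 2 yields both 1 < n and 2 <= |n|.\<close>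

lemma two_element_cond: "\<exists>t\<in>Conds M n. \<exists>x\<in>univ M. \<exists>y\<in>univ M. seq_prec M n t x y"
proof -
  let ?q = "Imp two_le_len_fm (Ex (Ex (And (dseq_fm (Par n) (Var 1) (Var 0))
    (And (Le (Var 0) (len_pow_tm (Par n) 1)) (Ex (Ex (seq_prec_fm (Par n) (Var 3) (Var 1) (Var 0))))))))"
  have "sat std \<iota> e ?q" for \<iota> :: "'m \<Rightarrow> nat" and e
  proof (cases "Suc (Suc 0) \<le> bit_length (\<iota> n)")
    case True
    then have n: "\<iota> n \<ge> 2" using less_bit_length_iff[of 1 "\<iota> n"] by simp
    then obtain w where w: "dseq std (\<iota> n) w (length [0, 1::nat])"
      "\<And>x y. seq_prec std (\<iota> n) w x y \<longleftrightarrow> lprec [0, 1::nat] x y"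
      using dseq_std_of_list[of "[0, 1::nat]" "\<iota> n"] by auto
    then have "\<exists>w l. dseq std (\<iota> n) w l \<and> l \<le> bit_length (\<iota> n) \<and> (\<exists>x y. seq_prec std (\<iota> n) w x y)"
      using True by (intro exI[of _ w] exI[of _ "length [0, 1::nat]"]) auto
    then show ?thesis by simp
  qed auto
  note q = this
  have "sat M id (\<lambda>_. \<zero>\<^bsub>M\<^esub>) ?q"
    by (rule transfer_id[OF q]) simp_all
  then obtain t l where "t \<in> univ M" "l \<in> univ M" "dseq M n t l" "l \<sqsubseteq>\<^bsub>M\<^esub> len_pow M n 1"
    "\<exists>x\<in>univ M. \<exists>y\<in>univ M. seq_prec M n t x y"
    using two_le_len by auto
  moreover from this have "t \<in> Conds M n" unfolding Conds_dseq by blast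
  ultimately show ?thesis by blast
qed

text \<open>A sequence of length at most |n|^c has a code of at most |n|^(c+1) + 1 <= |n|^(c+2)
  bits.\<close>

lemma Conds_in_cut:
  assumes "w \<in> Conds M n"
  shows "w \<in> univ (cut M n)"
proof -
  obtain c l where l: "w \<in> univ M" "l \<in> univ M" "dseq M n w l" "l \<sqsubseteq>\<^bsub>M\<^esub> len_pow M n c"
    using assms unfolding Conds_dseq by blast
  let ?q = "Imp two_le_len_fm (Imp (dseq_fm (Par n) (Par w) (Par l)) (Imp (Le (Par l) (len_pow_tm (Par n) c))
      (Le (Len (Par w)) (len_pow_tm (Par n) (c + 2)))))"
  have "sat std \<iota> e ?q" for \<iota> :: "'m \<Rightarrow> nat" and e
  proof -
    define N where "N = bit_length (\<iota> n)"
    { assume N: "Suc (Suc 0) \<le> N" and "\<iota> l \<le> N ^ c"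
      then have "\<iota> l * N + 1 \<le> N ^ c * N + N ^ c * N" by (intro add_mono mult_le_mono1) auto
      also have "\<dots> \<le> N * (N * N ^ c)" using mult_le_mono1[OF N, of "N * N ^ c"] by (simp add: mult.commute)
      finally have "Suc (\<iota> l * N) \<le> N * (N * N ^ c)" by simp }
    then show ?thesis by (auto simp: N_def dseq_std_iff)
  qed
  from transfer_id[OF this] show ?thesis
    using l two_le_len unfolding cut_iff by auto
qed

text \<open>Absoluteness: all existential witnesses in \<open>seq_prec\<close> and
  \<open>seq_entry\<close> are at most w, and w lies in the cut.\<close>

lemma seq_prec_cut_iff:
  assumes w: "w \<in> Conds M n" and xy: "x \<in> univ M" "y \<in> univ M"
  shows "seq_prec (cut_tri M n R) n w x y \<longleftrightarrow> seq_prec M n w x y"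
proof
  have lt: "lt_of (cut_tri M n R) = lt_of M" by (intro ext) (simp add: lt_of_def)
  show "seq_prec (cut_tri M n R) n w x y \<Longrightarrow> seq_prec M n w x y"
    unfolding seq_prec_def seq_entry_def seq_len_def lt cut_tri_sel using cut_univ by meson
  assume "seq_prec M n w x y"
  then obtain l i j where lij: "l \<in> univ M" "i \<in> univ M" "j \<in> univ M" "seq_len M n w l"
    "i \<sqsubset>\<^bsub>M\<^esub> j" "j \<sqsubset>\<^bsub>M\<^esub> l" "seq_entry M n w i x" "seq_entry M n w j y"
    unfolding seq_prec_def by blast
  have wM: "w \<in> univ M" and wC: "w \<in> univ (cut M n)" using w Conds_in_cut by (simp_all add: Conds_dseq)
  have entry: "seq_entry (cut_tri M n R) n w i a \<and> i \<in> univ (cut M n) \<and> l \<in> univ (cut M n)"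
    if i: "i \<in> univ M" "i \<sqsubset>\<^bsub>M\<^esub> l" and a: "a \<in> univ M" and en: "seq_entry M n w i a" for i a
  proof -
    obtain z u v where zuv: "z \<in> univ M" "u \<in> univ M" "v \<in> univ M" "len_of M z = i" "u \<sqsubset>\<^bsub>M\<^esub> n \<sharp>\<^bsub>M\<^esub> z"
      "a \<sqsubset>\<^bsub>M\<^esub> n \<sharp>\<^bsub>M\<^esub> \<one>\<^bsub>M\<^esub>" "w = u \<oplus>\<^bsub>M\<^esub> n \<sharp>\<^bsub>M\<^esub> z \<otimes>\<^bsub>M\<^esub> (a \<oplus>\<^bsub>M\<^esub> n \<sharp>\<^bsub>M\<^esub> \<one>\<^bsub>M\<^esub> \<otimes>\<^bsub>M\<^esub> v)"
      using en unfolding seq_entry_def by blast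
    let ?q = "Imp two_le_len_fm (Imp (Eq (Len (Par w)) (Add (Mul (Par l) (Len (Par n))) One))
      (Imp (Lt (Par i) (Par l)) (Imp (Eq (Len (Par z)) (Par i))
      (Imp (Eq (Par w) (Add (Par u) (Mul (Smash (Par n) (Par z)) (Add (Par a) (Mul (Smash (Par n) One) (Par v))))))
      (And (Le (Par z) (Par w)) (And (Le (Par u) (Par w)) (And (Le (Par v) (Par w))
        (And (Le (Par i) (Par w)) (Le (Par l) (Par w))))))))))"
    have "sat std \<iota> e ?q" for \<iota> e
    proof (cases "Suc (Suc 0) \<le> bit_length (\<iota> n) \<and> bit_length (\<iota> w) = Suc (\<iota> l * bit_length (\<iota> n)) \<and>
        \<iota> i < \<iota> l \<and> bit_length (\<iota> z) = \<iota> i \<and>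
        \<iota> w = \<iota> u + 2 ^ (bit_length (\<iota> n) * \<iota> i) * (\<iota> a + 2 ^ bit_length (\<iota> n) * \<iota> v)")
      case True
      then have weq: "\<iota> w = \<iota> u + 2 ^ (bit_length (\<iota> n) * \<iota> i) *
          (\<iota> a + 2 ^ bit_length (\<iota> n) * \<iota> v)" by blast
      from True have "\<iota> l * 1 \<le> \<iota> l * bit_length (\<iota> n)" by (intro mult_le_mono2) simp
      moreover have wl: "bit_length (\<iota> w) = Suc (\<iota> l * bit_length (\<iota> n))" using True by blast
      ultimately have l: "\<iota> l < bit_length (\<iota> w)" by linarith
      then have "\<iota> l \<le> \<iota> w" "\<iota> i \<le> \<iota> w" using bit_length_le_self[of "\<iota> w"] True by linarith+
      moreover have "bit_length (\<iota> z) < bit_length (\<iota> w)" using True l by linarith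
      then have "\<iota> z \<le> \<iota> w" using bit_length_mono[of "\<iota> w" "\<iota> z"] by linarith
      moreover have "\<iota> v \<le> \<iota> w"
      proof -
        let ?b = "bit_length (\<iota> n)"
        have "1 * (1 * \<iota> v) \<le> 2 ^ (?b * \<iota> i) * (2 ^ ?b * \<iota> v)" by (intro mult_le_mono) simp_all
        also have "\<dots> \<le> \<iota> w" unfolding weq by (simp add: distrib_left)
        finally show ?thesis by simp
      qed
      moreover have "\<iota> u \<le> \<iota> w" unfolding weq by simp
      ultimately have "sat std \<iota> e (And (Le (Par z) (Par w)) (And (Le (Par u) (Par w)) (And (Le (Par v) (Par w))
        (And (Le (Par i) (Par w)) (Le (Par l) (Par w))))))" by simp
      then show ?thesis unfolding sat.simps by blast
    qed auto
    from transfer_id[OF this] have "z \<sqsubseteq>\<^bsub>M\<^esub> w" "u \<sqsubseteq>\<^bsub>M\<^esub> w" "v \<sqsubseteq>\<^bsub>M\<^esub> w" "i \<sqsubseteq>\<^bsub>M\<^esub> w" "l \<sqsubseteq>\<^bsub>M\<^esub> w"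
      using zuv i a lij wM two_le_len by (simp_all add: seq_len_def lt_of_def)
    then have "z \<in> univ (cut M n)" "u \<in> univ (cut M n)" "v \<in> univ (cut M n)" "i \<in> univ (cut M n)" "l \<in> univ (cut M n)"
      using wC zuv i lij by (auto intro: cut_downward)
    then show ?thesis using zuv unfolding seq_entry_def lt cut_tri_sel by blast
  qed
  have "i \<sqsubset>\<^bsub>M\<^esub> l" using lt_le_trans[of i j l] lij by (auto simp: lt_of_def)
  then show "seq_prec (cut_tri M n R) n w x y"
    using lij entry[of i x] entry[of j y] xy unfolding seq_prec_def lt seq_len_def cut_tri_sel by blast
qed

end

section \<open>Trees and plays\<close>

lemma seq_prec_cong:
  assumes "univ A = univ B" "one_of A = one_of B" "plus_of A = plus_of B" "times_of A = times_of B"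
    "len_of A = len_of B" "smash_of A = smash_of B" "le_of A = le_of B"
  shows "seq_prec A n w x y \<longleftrightarrow> seq_prec B n w x y"
  by (simp add: assms seq_prec_def seq_entry_def seq_len_def lt_of_def)

lemma BASIC_fam_free: "q \<in> BASIC \<Longrightarrow> fam_free q"
  unfolding BASIC_def Let_def by (elim insertE emptyE; simp)

lemma S12_fam_free: "q \<in> S12 \<Longrightarrow> fam_free q"
  unfolding S12_def using BASIC_fam_free by (auto simp: PIND_def inst_def sigma_b1_fam_free)

lemma sat_MIN_fm: "sat A \<iota> e (MIN_fm t) \<longleftrightarrow> (let U = below A (tval A \<iota> e t) in
    (\<exists>x\<in>U. tri_of A x x) \<or> (\<exists>x\<in>U. \<exists>y\<in>U. tri_of A x y \<and> tri_of A y x) \<or>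
    (\<exists>x\<in>U. \<exists>y\<in>U. x \<noteq> y \<and> \<not> tri_of A x y \<and> \<not> tri_of A y x) \<or>
    (\<exists>x\<in>U. \<exists>y\<in>U. \<exists>z\<in>U. tri_of A x y \<and> tri_of A y z \<and> \<not> tri_of A x z) \<or>
    (\<exists>x\<in>U. \<forall>y\<in>U. x = y \<or> tri_of A x y))"
  by (simp add: MIN_fm_def Let_def tval_subst_tm numeral_2_eq_2)

context nonstandard_model
begin

text \<open>Induction inside the model on the length of a node, downwards from the common bound on the
  lengths of all nodes.\<close>

lemma tree_extends:
  assumes tree: "is_tree M n r T" and "t0 \<in> T"
  shows "extends M n t0 r"
proof (rule ccontr)
  assume not_ext: "\<not> extends M n t0 r"
  obtain c N F where N: "N \<subseteq> conds_upto M n c" "definable M {[s] | s. s \<in> N}" "r \<in> N" "F r = T"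
    and F: "definable M {[s, t] | s t. s \<in> N \<and> t \<in> F s}"
    and step: "\<forall>s\<in>N. F s = {s} \<or>
           (\<exists>a\<in>below M n. a \<notin> el M n s \<and> one_point_exts M n s a \<subseteq> N \<and>
              F s = (\<Union>s'\<in>one_point_exts M n s a. F s'))"
    using tree unfolding is_tree_def by blast
  obtain k1 pN where pN: "arith_fm pN" "params pN \<subseteq> univ M" "fv pN \<subseteq> {..<k1}"
    "{[s] | s. s \<in> N} = {xs. length xs = k1 \<and> set xs \<subseteq> univ M \<and> sat M id ((!) xs) pN}"
    using N(2) unfolding definable_def by blast
  have "[r] \<in> {[s] | s. s \<in> N}" using N(3) by blast
  then have "k1 = 1" unfolding pN(4) by simp
  \<comment> \<open>Past the end of the list \<open>(!) [s]\<close> has unspecified values. Only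
    variable 0 is free, so an assignment with known values can replace it.\<close>
  have satN: "s \<in> N \<longleftrightarrow> s \<in> univ M \<and> sat M id (\<lambda>_. s) pN" for s
  proof -
    have "s \<in> N \<longleftrightarrow> [s] \<in> {[s] | s. s \<in> N}" by blast
    also have "\<dots> \<longleftrightarrow> s \<in> univ M \<and> sat M id ((!) [s]) pN" unfolding pN(4) \<open>k1 = 1\<close> by simp
    also have "sat M id ((!) [s]) pN \<longleftrightarrow> sat M id (\<lambda>_. s) pN"
      by (rule sat_cong) (use pN(3) \<open>k1 = 1\<close> in auto)
    finally show ?thesis .
  qed
  obtain k2 pF where pF: "arith_fm pF" "params pF \<subseteq> univ M" "fv pF \<subseteq> {..<k2}"
    "{[s, t] | s t. s \<in> N \<and> t \<in> F s} = {xs. length xs = k2 \<and> set xs \<subseteq> univ M \<and> sat M id ((!) xs) pF}"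
    using F unfolding definable_def by blast
  have "[r, t0] \<in> {[s, t] | s t. s \<in> N \<and> t \<in> F s}" using N(3,4) \<open>t0 \<in> T\<close> by blast
  then have "k2 = 2" unfolding pF(4) by simp
  have satF: "s \<in> N \<and> t \<in> F s \<longleftrightarrow> s \<in> univ M \<and> t \<in> univ M \<and> sat M id (case_nat s (\<lambda>_. t)) pF" for s t
  proof -
    have "s \<in> N \<and> t \<in> F s \<longleftrightarrow> [s, t] \<in> {[s, t] | s t. s \<in> N \<and> t \<in> F s}" by blast
    also have "\<dots> \<longleftrightarrow> s \<in> univ M \<and> t \<in> univ M \<and> sat M id ((!) [s, t]) pF"
      unfolding pF(4) \<open>k2 = 2\<close> by auto
    also have "sat M id ((!) [s, t]) pF \<longleftrightarrow> sat M id (case_nat s (\<lambda>_. t)) pF"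
    proof (rule sat_cong)
      fix i
      assume "i \<in> fv pF"
      then have "i = 0 \<or> i = 1" using pF(3) \<open>k2 = 2\<close> by auto
      then show "[s, t] ! i = case_nat s (\<lambda>_. t) i" by auto
    qed simp
    finally show ?thesis .
  qed
  define \<sigma> :: "nat \<Rightarrow> 'm tm" where "\<sigma> = case_nat (Var 2) (\<lambda>_. Var 1)"
  have \<sigma>: "(\<lambda>i. tval M id (case_nat l (case_nat t (case_nat s e))) (\<sigma> i)) = case_nat s (\<lambda>_. t)"
    for l t s e
    by (rule ext) (simp add: \<sigma>_def split: nat.split)
  \<comment> \<open>\<open>B\<close> says of m that some node s of length |n|^c - m has a member t
    of its tree not extending s; the difference is written as l + m = |n|^c. A least m belongs to a
    longest bad node.\<close>
  define B where "B = Ex (Ex (Ex (And (subst \<sigma> pF) (And (dseq_fm (Par n) (Var 2) (Var 0))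
    (And (Eq (Add (Var 0) (Var 3)) (len_pow_tm (Par n) c)) (Neg (ext_fm (Par n) (Var 1) (Var 2))))))))"
  have satB: "sat M id (case_nat m e) B \<longleftrightarrow> (\<exists>s\<in>univ M. \<exists>t\<in>univ M. \<exists>l\<in>univ M. (s \<in> N \<and> t \<in> F s) \<and>
      dseq M n s l \<and> l \<oplus>\<^bsub>M\<^esub> m = len_pow M n c \<and> \<not> extends M n t s)" for m e
    unfolding satF by (auto simp: B_def sat_subst \<sigma>)
  have B: "arith_fm B" "params B \<subseteq> univ M"
    using pF(1,2) params_subst[of \<sigma> pF] by (auto simp: B_def \<sigma>_def split: nat.splits)
  have len: "\<exists>l\<in>univ M. dseq M n s l \<and> (\<exists>m\<in>univ M. l \<oplus>\<^bsub>M\<^esub> m = len_pow M n c)" if sN: "s \<in> N" for s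
  proof -
    obtain l where l: "l \<in> univ M" "dseq M n s l" "l \<sqsubseteq>\<^bsub>M\<^esub> len_pow M n c"
      using subsetD[OF N(1) sN] unfolding conds_upto_dseq by blast
    have "sat std \<iota> e (Imp (Le (Par l) (len_pow_tm (Par n) c))
        (Ex (Eq (Add (Par l) (Var 0)) (len_pow_tm (Par n) c))))" for \<iota> :: "'m \<Rightarrow> nat" and e
      by (auto intro: le_add_diff_inverse)
    from transfer_id[OF this] show ?thesis using l by auto
  qed
  have N_univ: "s \<in> univ M" if "s \<in> N" for s using satN that by blast
  obtain m0 where "m0 \<in> univ M" "sat M id (case_nat m0 (\<lambda>_. \<zero>\<^bsub>M\<^esub>)) B"
    unfolding satB using len[OF N(3)] not_ext N(3,4) \<open>t0 \<in> T\<close> satF[of r t0] by blast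
  from least_number[OF B _ this] obtain m where m: "m \<in> univ M"
    "sat M id (case_nat m (\<lambda>_. \<zero>\<^bsub>M\<^esub>)) B"
    and least: "\<And>m'. m' \<in> univ M \<Longrightarrow> m' \<sqsubset>\<^bsub>M\<^esub> m \<Longrightarrow> \<not> sat M id (case_nat m' (\<lambda>_. \<zero>\<^bsub>M\<^esub>)) B"
    by auto
  from m(2) obtain s t l where stl: "s \<in> univ M" "t \<in> univ M" "l \<in> univ M" "s \<in> N" "t \<in> F s"
    "dseq M n s l" "l \<oplus>\<^bsub>M\<^esub> m = len_pow M n c" "\<not> extends M n t s"
    unfolding satB by blast
  have "F s \<noteq> {s}" using stl(5,8) extends_refl[of M n s] by auto
  then obtain a where a: "a \<notin> el M n s" "one_point_exts M n s a \<subseteq> N"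
    "F s = (\<Union>s'\<in>one_point_exts M n s a. F s')" using step stl(4) by blast
  then obtain s' where s': "s' \<in> one_point_exts M n s a" "t \<in> F s'" using stl(5) by blast
  then have "s' \<in> N" and ext: "extends M n s' s" "el M n s' = el M n s \<union> {a}"
    using a(2) by (auto simp: one_point_exts_def)
  \<comment> \<open>As s' extends s, it is a bad node as well; being longer, it has a smaller
    m.\<close>
  have "\<not> extends M n t s'" using ext(1) extends_trans[of M n t s' s] stl(8) by blast
  obtain l' m' where l': "l' \<in> univ M" "dseq M n s' l'" "m' \<in> univ M" "l' \<oplus>\<^bsub>M\<^esub> m' = len_pow M n c"
    using len[OF \<open>s' \<in> N\<close>] by blast
  have "sat M id (case_nat m' (\<lambda>_. \<zero>\<^bsub>M\<^esub>)) B"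
    unfolding satB using l' N_univ[OF \<open>s' \<in> N\<close>] \<open>s' \<in> N\<close> s'(2) stl(2) \<open>\<not> extends M n t s'\<close> by blast
  moreover have "l \<sqsubset>\<^bsub>M\<^esub> l'"
    by (rule length_grows[OF stl(6) l'(2) ext(2) a(1)]) (use stl l' N_univ[OF \<open>s' \<in> N\<close>] in simp_all)
  have "sat std \<iota> e (Imp (Lt (Par l) (Par l')) (Imp (Eq (Add (Par l) (Par m)) (Add (Par l') (Par m')))
     (Lt (Par m') (Par m))))" for \<iota> :: "'m \<Rightarrow> nat" and e
    by auto
  from transfer_id[OF this] have "m' \<sqsubset>\<^bsub>M\<^esub> m"
    using \<open>l \<sqsubset>\<^bsub>M\<^esub> l'\<close> stl l' m(1) by (simp add: lt_of_def)
  ultimately show False using least l'(3) by blast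
qed

text \<open>Every entry of w differs from x or from y and is ordered with it by w. Hence it takes
  part in the induced order and must occur in every extension; a single entry would induce no order
  and could disappear.\<close>

lemma el_mono:
  assumes "w \<in> Conds M n" "w' \<in> Conds M n" "extends M n w' w"
    and xy: "x \<in> univ M" "y \<in> univ M" "seq_prec M n w x y"
  shows "el M n w \<subseteq> el M n w'"
proof
  fix b
  assume b: "b \<in> el M n w"
  have "x \<noteq> y" using seq_prec_irrefl[of w x] assms by blast
  then obtain z where z: "z \<in> {x, y}" "z \<noteq> b" by auto
  then have zel: "z \<in> el M n w" using seq_prec_el[of w x y] assms by blast
  have univ: "z \<in> univ M" "b \<in> univ M" using z xy b by (auto simp: el_def)
  have "seq_prec M n w b z \<or> seq_prec M n w z b" using seq_prec_total assms(1) b zel z(2) by blast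
  then have "seq_prec M n w' b z \<or> seq_prec M n w' z b"
    using assms(3) univ unfolding extends_def by blast
  then show "b \<in> el M n w'" using seq_prec_el assms(2) univ by blast
qed

end

section \<open>Plays in which MIN follows its strategy\<close>

locale MIN_play = nonstandard_model +
  fixes q :: "nat \<Rightarrow> 'a" and ps :: "nat \<Rightarrow> 'a" and k0 :: nat and x0 y0 :: 'a
  assumes play: "is_play M n ps" and MIN: "follows 0 (strategy_MIN M n q) ps"
    and q: "range q = below M n"
    and start: "x0 \<in> univ M" "y0 \<in> univ M" "seq_prec M n (ps (Suc k0)) x0 y0"
begin

abbreviation R :: "'a \<Rightarrow> 'a \<Rightarrow> bool" where
  "R \<equiv> play_order M n ps"

lemma ps_Conds: "ps (Suc i) \<in> Conds M n"
  using play by (simp add: is_play_def)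

lemma ps_extends: "i \<le> j \<Longrightarrow> extends M n (ps j) (ps i)"
proof (induction j)
  case (Suc j)
  have "extends M n (ps (Suc j)) (ps j)" using play by (simp add: is_play_def)
  then show ?case
    using Suc extends_trans[of M n "ps (Suc j)" "ps j" "ps i"] extends_refl[of M n "ps i"]
    by (cases "i = Suc j") auto
qed (simp add: extends_refl)

text \<open>Ordered pairs persist, so finitely many of them can be examined at one common
  position.\<close>

lemma play_orderE:
  assumes "R x y" "x \<in> univ M" "y \<in> univ M"
  obtains i where "\<And>j. j \<ge> i \<Longrightarrow> seq_prec M n (ps (Suc j)) x y"
proof -
  obtain i where "seq_prec M n (ps i) x y" using assms(1) by (auto simp: play_order_def)
  then have "seq_prec M n (ps (Suc j)) x y" if "j \<ge> i" for j
    using ps_extends[of i "Suc j"] that assms(2,3) unfolding extends_def by simp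
  then show ?thesis using that by blast
qed

lemma R_irrefl: "x \<in> univ M \<Longrightarrow> \<not> R x x"
  using play_orderE[of x x] seq_prec_irrefl[OF ps_Conds] by (metis order_refl)

lemma R_trans:
  assumes "R x y" "R y z" and univ: "x \<in> univ M" "y \<in> univ M" "z \<in> univ M"
  shows "R x z"
proof -
  obtain i where i: "\<And>j. j \<ge> i \<Longrightarrow> seq_prec M n (ps (Suc j)) x y"
    using play_orderE[OF assms(1) univ(1,2)] by blast
  obtain i' where i': "\<And>j. j \<ge> i' \<Longrightarrow> seq_prec M n (ps (Suc j)) y z"
    using play_orderE[OF assms(2) univ(2,3)] by blast
  show ?thesis
    using seq_prec_trans[OF ps_Conds univ i i', of "max i i'"] unfolding play_order_def by auto
qed

text \<open>This is the purpose of \<open>x0\<close> and \<open>y0\<close>: from position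
  \<open>Suc k0\<close> on, a pair is ordered and entries are never lost.\<close>

lemma el_ps_mono:
  assumes "Suc k0 \<le> i" "i \<le> j"
  shows "el M n (ps i) \<subseteq> el M n (ps j)"
proof -
  obtain i' j' where ij: "i = Suc i'" "j = Suc j'" using assms by (metis Suc_le_D le_trans)
  have "seq_prec M n (ps i) x0 y0"
    using ps_extends[OF assms(1)] start unfolding extends_def by blast
  then show ?thesis
    using el_mono[OF _ _ ps_extends[OF assms(2)] start(1,2)] ps_Conds ij by blast
qed

lemma MIN_move:
  assumes "i mod 3 = 0" "Suc k0 \<le> i"
  defines "a \<equiv> q (LEAST k. q k \<notin> el M n (ps i))"
  shows "a \<in> below M n" "a \<notin> el M n (ps i)" "\<forall>b\<in>el M n (ps i). R a b" "a \<in> el M n (ps (Suc i))"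
proof -
  obtain i' where i': "i = Suc i'" using assms(2) by (metis Suc_le_D)
  have "\<exists>k. q k \<notin> el M n (ps i)"
    using missing_element[OF ps_Conds[of i']] q unfolding i' by (metis rangeE)
  then show "a \<notin> el M n (ps i)" unfolding a_def by (rule LeastI_ex)
  show a: "a \<in> below M n" using q by (auto simp: a_def)
  have "ps (Suc i) = a \<oplus>\<^bsub>M\<^esub> n \<sharp>\<^bsub>M\<^esub> \<one>\<^bsub>M\<^esub> \<otimes>\<^bsub>M\<^esub> ps i"
    using MIN assms(1) by (simp add: follows_def strategy_MIN_def a_def)
  then have prec: "seq_prec M n (ps (Suc i)) a b" if "b \<in> el M n (ps i)" for b
    using prec_prepend[OF ps_Conds a, of b i'] that unfolding i' by simp
  then show "\<forall>b\<in>el M n (ps i). R a b" unfolding play_order_def by blast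
  \<comment> \<open>The position has the entry \<open>x0\<close>, before which a is placed; so a
    takes part in the order and is an entry of the next position.\<close>
  have "seq_prec M n (ps i) x0 y0"
    using ps_extends[OF assms(2)] start unfolding extends_def by blast
  then have "x0 \<in> el M n (ps i)" using seq_prec_el[OF ps_Conds start(1,2)] i' by blast
  then show "a \<in> el M n (ps (Suc i))"
    using prec seq_prec_el[OF ps_Conds _ start(1)] below_univ[OF a] by blast
qed

lemma next_MIN_stage: "\<exists>j\<ge>i. j mod 3 = (0::nat)"
  by (intro exI[of _ "3 * i"]) simp

text \<open>If all earlier elements of the queue are listed at a stage of MIN and \<open>q m\<close>
  is not, then \<open>LEAST\<close> returns m and MIN lists \<open>q m\<close>.\<close>

lemma exhausted: "\<exists>i\<ge>Suc k0. \<forall>m'<m. q m' \<in> el M n (ps i)"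
proof (induction m)
  case (Suc m)
  then obtain i where i: "i \<ge> Suc k0" "\<forall>m'<m. q m' \<in> el M n (ps i)" by blast
  obtain j where j: "j \<ge> i" "j mod 3 = 0" using next_MIN_stage[of i] by auto
  have jk: "Suc k0 \<le> j" using i(1) j(1) by simp
  have all: "\<forall>m'<m. q m' \<in> el M n (ps j)" using i(2) el_ps_mono[OF i(1) j(1)] by blast
  have "q m \<in> el M n (ps (Suc j))"
  proof (cases "q m \<in> el M n (ps j)")
    case True
    then show ?thesis using el_ps_mono[OF jk, of "Suc j"] by auto
  next
    case False
    then have "(LEAST k. q k \<notin> el M n (ps j)) = m"
      using all by (intro Least_equality) (auto simp: not_less[symmetric])
    then show ?thesis using MIN_move(4)[OF j(2) jk] by simp
  qed
  then have "\<forall>m'<Suc m. q m' \<in> el M n (ps (Suc j))"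
    using all el_ps_mono[OF jk, of "Suc j"] by (auto simp: less_Suc_eq)
  then show ?case using jk by (intro exI[of _ "Suc j"]) simp
qed auto

lemma eventually_el:
  assumes "x \<in> below M n"
  shows "\<exists>i\<ge>Suc k0. \<forall>j\<ge>i. x \<in> el M n (ps j)"
proof -
  obtain m where m: "x = q m" using assms q by (metis rangeE)
  obtain i where i: "i \<ge> Suc k0" "\<forall>m'<Suc m. q m' \<in> el M n (ps i)"
    using exhausted[of "Suc m"] by auto
  have "\<forall>j\<ge>i. x \<in> el M n (ps j)" using i(2) el_ps_mono[OF i(1)] m by auto
  then show ?thesis using i(1) by auto
qed

lemma R_total:
  assumes x: "x \<in> below M n" and y: "y \<in> below M n" and "x \<noteq> y"
  shows "R x y \<or> R y x"
proof -
  obtain i where i: "\<forall>j\<ge>i. x \<in> el M n (ps j)" using eventually_el[OF x] by auto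
  obtain i' where i': "\<forall>j\<ge>i'. y \<in> el M n (ps j)" using eventually_el[OF y] by auto
  have "x \<in> el M n (ps (Suc (max i i')))" "y \<in> el M n (ps (Suc (max i i')))"
    using i i' by simp_all
  then show ?thesis
    using seq_prec_total[OF ps_Conds _ _ \<open>x \<noteq> y\<close>] unfolding play_order_def by blast
qed

text \<open>Once x is listed, the next move of MIN puts a new element before it.\<close>

lemma R_no_least:
  assumes x: "x \<in> below M n"
  shows "\<exists>y\<in>below M n. R y x"
proof -
  obtain i where i: "i \<ge> Suc k0" "\<forall>j\<ge>i. x \<in> el M n (ps j)" using eventually_el[OF x] by auto
  obtain j where j: "j \<ge> i" "j mod 3 = 0" using next_MIN_stage[of i] by auto
  then have "Suc k0 \<le> j" "x \<in> el M n (ps j)" using i by simp_all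
  then show ?thesis using MIN_move(1,3)[OF j(2)] by blast
qed

lemma not_MIN: 
  assumes "univ A = univ (cut M n)" "le_of A = le_of M" "tri_of A = R" "tval A \<iota> e t = n"
  shows "\<not> sat A \<iota> e (MIN_fm t)"
proof -
  \<comment> \<open>All numbers below n lie in the cut, so the bounded quantifiers of
    \<open>MIN_fm\<close> range over the same set as in \<open>M\<close>.\<close>
  have eq: "below A n = below M n"
    using below_in_cut[OF _ n_in_cut] by (auto simp: below_def lt_of_def assms cut_univ)
  have "\<forall>x\<in>below M n. \<not> R x x" using R_irrefl below_univ by blast
  moreover have "\<forall>x\<in>below M n. \<forall>y\<in>below M n. \<not> (R x y \<and> R y x)"
    using R_irrefl R_trans below_univ by blast
  moreover have "\<forall>x\<in>below M n. \<forall>y\<in>below M n. \<not> (x \<noteq> y \<and> \<not> R x y \<and> \<not> R y x)"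
    using R_total by blast
  moreover have "\<forall>x\<in>below M n. \<forall>y\<in>below M n. \<forall>z\<in>below M n. \<not> (R x y \<and> R y z \<and> \<not> R x z)"
    using R_trans below_univ by blast
  moreover have "\<forall>x\<in>below M n. \<not> (\<forall>y\<in>below M n. x = y \<or> R x y)"
  proof
    fix x
    assume x: "x \<in> below M n"
    then obtain y where y: "y \<in> below M n" "R y x" using R_no_least by blast
    have "x \<noteq> y" "\<not> R x y"
      using y R_irrefl[of x] R_trans[of x y x] below_univ[OF x] below_univ[OF y(1)] by blast+
    then show "\<not> (\<forall>y\<in>below M n. x = y \<or> R x y)" using y(1) by blast
  qed
  ultimately show ?thesis unfolding sat_MIN_fm Let_def assms eq
    by (intro notI) (elim disjE; blast)
qed

end

section \<open>Provability and the expansions of \<open>\<I>\<close>\<close>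

context nonstandard_model
begin

text \<open>Interprets \<open>Tri\<close> and \<open>Fam\<close> together, since the derivations use
  axioms about the order and truths about the families.\<close>

definition expansion :: "('m \<Rightarrow> 'm \<Rightarrow> bool) \<Rightarrow> (bool \<Rightarrow> 'm \<Rightarrow> 'm \<Rightarrow> 'm \<Rightarrow> bool) \<Rightarrow> 'm arith" where
  "expansion R \<F> = (cut M n)\<lparr>tri_of := R, fam_of := \<F>\<rparr>"

lemma expansion_sel [simp]:
  "univ (expansion R \<F>) = univ (cut M n)" "zero_of (expansion R \<F>) = zero_of M"
  "one_of (expansion R \<F>) = one_of M" "plus_of (expansion R \<F>) = plus_of M"
  "times_of (expansion R \<F>) = times_of M" "len_of (expansion R \<F>) = len_of M"
  "half_of (expansion R \<F>) = half_of M" "smash_of (expansion R \<F>) = smash_of M"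
  "le_of (expansion R \<F>) = le_of M" "tri_of (expansion R \<F>) = R" "fam_of (expansion R \<F>) = \<F>"
  by (simp_all add: expansion_def)

lemma sat_expansion_fam_free:
  "fam_free p \<Longrightarrow> sat (expansion R \<F>) \<iota> e p \<longleftrightarrow> sat (cut_tri M n R) \<iota> e p"
  using sat_tri_fam_cong[of p R "cut_tri M n R" \<F> \<iota> e] by (simp add: expansion_def cut_tri_def)

lemma sat_expansion_tri_free:
  "tri_free p \<Longrightarrow> sat (expansion R \<F>) \<iota> e p \<longleftrightarrow> sat ((cut M n)\<lparr>fam_of := \<F>\<rparr>) \<iota> e p"
  using sat_tri_fam_cong[of p R "(cut M n)\<lparr>fam_of := \<F>\<rparr>" \<F> \<iota> e] by (simp add: expansion_def)

text \<open>Parameters outside \<open>\<I>\<close> may occur in a derivation, so they get a dummy value.\<close>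

definition par_val :: "'m \<Rightarrow> 'm" where
  "par_val c = (if c \<in> univ (cut M n) then c else \<zero>\<^bsub>M\<^esub>)"

lemma zero_in_cut: "\<zero>\<^bsub>M\<^esub> \<in> univ (cut M n)"
  using closed_cut by (simp add: closed_struct_def)

lemma par_val_eq [simp]: "c \<in> univ (cut M n) \<Longrightarrow> par_val c = c"
  by (simp add: par_val_def)

text \<open>Axioms of \<open>S12\<close> do not see \<open>Fam\<close> and hold by the induction
  available for \<open>R\<close>; formulas of the diagram do not see \<open>Tri\<close> and hold by
  definition.\<close>

lemma proves_expansion:
  assumes ind: "sigma_b1_induction (cut_tri M n R)" and q: "proves (S12 \<union> diagram M n \<F>) {} q"
  shows "sat (expansion R \<F>) par_val (\<lambda>_. \<zero>\<^bsub>M\<^esub>) q"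
proof (rule soundness[OF q])
  show "closed_struct (expansion R \<F>)"
    using closed_cut unfolding closed_struct_def expansion_sel cut_sel .
  show "range par_val \<subseteq> univ (expansion R \<F>)" "range (\<lambda>_. \<zero>\<^bsub>M\<^esub>) \<subseteq> univ (expansion R \<F>)"
    using zero_in_cut by (auto simp: par_val_def)
  fix q :: "'m fm"
  assume "q \<in> S12 \<union> diagram M n \<F>"
  then show "valid (expansion R \<F>) par_val q"
  proof
    assume "q \<in> S12"
    from S12_valid_cut[OF ind this, of par_val] show ?thesis
      unfolding valid_def sat_expansion_fam_free[OF S12_fam_free[OF \<open>q \<in> S12\<close>]] by simp
  next
    assume d: "q \<in> diagram M n \<F>"
    have "sat (expansion R \<F>) par_val e q" if "range e \<subseteq> univ (cut M n)" for e
    proof -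
      have "sat (expansion R \<F>) par_val e q \<longleftrightarrow> sat ((cut M n)\<lparr>fam_of := \<F>\<rparr>) par_val e q"
        using d by (simp add: diagram_def sat_expansion_tri_free)
      also have "\<dots> \<longleftrightarrow> sat ((cut M n)\<lparr>fam_of := \<F>\<rparr>) id e q"
        by (rule sat_cong) (use d in \<open>auto simp: diagram_def\<close>)
      also have "\<dots>" using d that by (simp add: diagram_def valid_def)
      finally show ?thesis .
    qed
    then show ?thesis by (simp add: valid_def)
  qed
qed simp

end

section \<open>From provable equivalences to truth in a play\<close>

context MIN_play
begin

abbreviation R_extends :: "'a \<Rightarrow> bool" where
  "R_extends w \<equiv> \<forall>x\<in>univ M. \<forall>y\<in>univ M. seq_prec M n w x y \<longrightarrow> R x y"

lemma R_extends_if_extended: "extends M n (ps i) w \<Longrightarrow> R_extends w"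
  unfolding extends_def play_order_def by blast

text \<open>The formula quantifies over the cut and \<open>R_extends\<close> over \<open>M\<close>;
  they agree because pairs ordered by w lie below n and \<open>seq_prec\<close> is absolute.\<close>

lemma sat_extends_expansion:
  assumes "w \<in> Conds M n" "tval (expansion R \<F>) \<iota> e t = n" "tval (expansion R \<F>) \<iota> e u = w"
  shows "sat (expansion R \<F>) \<iota> e (extends_fm t u) \<longleftrightarrow> R_extends w"
proof -
  have prec: "seq_prec (expansion R \<F>) n w x y \<longleftrightarrow> seq_prec M n w x y"
    if "x \<in> univ M" "y \<in> univ M" for x y
    using seq_prec_cut_iff[OF assms(1) that, of R]
      seq_prec_cong[of "expansion R \<F>" "cut_tri M n R"] by simp
  have in_cut: "x \<in> univ (cut M n) \<and> y \<in> univ (cut M n)"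
    if "x \<in> univ M" "y \<in> univ M" "seq_prec M n w x y" for x y
    using seq_prec_el[OF assms(1) that] el_below[OF assms(1)] below_in_cut[OF _ n_in_cut] by blast
  show ?thesis
    unfolding sat_extends_fm assms(2,3) expansion_sel using prec in_cut cut_univ by metis
qed

text \<open>Both antecedents of the provable implication hold in the expansion: the first by the
  play of MIN, the second because a position extends s. The quantifier over members of the family
  loses nothing, as \<open>Conds\<close> lies inside the cut.\<close>

lemma formula_iff_family:
  fixes \<phi> :: "'a fm" and T :: "bool \<Rightarrow> 'a \<Rightarrow> 'a \<Rightarrow> 'a set"
  assumes ind: "sigma_b1_induction (cut_tri M n R)"
    and \<phi>: "fam_free \<phi>" "params \<phi> \<subseteq> univ (cut M n)"
    and ph: "p \<in> univ (cut M n)" "h \<in> univ (cut M n)"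
    and s: "s \<in> Conds M n" "extends M n (ps i) s"
    and ab: "a \<in> below M p" "b \<in> below M h" and T: "T True a b \<subseteq> Conds M n"
    and pr: "proves (S12 \<union> diagram M n (family_rel M p h T)) {}
             (Imp (And (Neg (MIN_fm (Par n))) (extends_fm (Par n) (Par s)))
                  (Iff (inst2 \<phi> a b) (extends_some_fm True n a b)))"
  shows "sat (cut_tri M n R) id (case_nat a (\<lambda>_. b)) \<phi> \<longleftrightarrow> (\<exists>t\<in>T True a b. R_extends t)"
proof -
  let ?B = "expansion R (family_rel M p h T)" and ?e = "\<lambda>_::nat. \<zero>\<^bsub>M\<^esub>"
  have sC: "s \<in> univ (cut M n)" using s Conds_in_cut by blast
  have abC: "a \<in> univ (cut M n)" "b \<in> univ (cut M n)" using ab ph below_in_cut by blast+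
  have "\<not> sat ?B par_val ?e (MIN_fm (Par n))" by (rule not_MIN) simp_all
  moreover have "sat ?B par_val ?e (extends_fm (Par n) (Par s))"
    by (rule iffD2[OF sat_extends_expansion[OF s(1)] R_extends_if_extended[OF s(2)]])
      (simp_all add: sC)
  ultimately have "sat ?B par_val ?e (inst2 \<phi> a b) \<longleftrightarrow> sat ?B par_val ?e (extends_some_fm True n a b)"
    using proves_expansion[OF ind pr] unfolding sat.simps by blast
  moreover have "sat ?B par_val ?e (inst2 \<phi> a b) \<longleftrightarrow> sat (cut_tri M n R) id (case_nat a (\<lambda>_. b)) \<phi>"
  proof -
    have "(\<lambda>i. tval ?B par_val ?e (case i of 0 \<Rightarrow> Par a | Suc x \<Rightarrow> Par b)) = case_nat a (\<lambda>_. b)"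
      using abC by (auto split: nat.split)
    then have "sat ?B par_val ?e (inst2 \<phi> a b) \<longleftrightarrow> sat ?B par_val (case_nat a (\<lambda>_. b)) \<phi>"
      by (simp add: inst2_def sat_subst)
    also have "\<dots> \<longleftrightarrow> sat ?B id (case_nat a (\<lambda>_. b)) \<phi>"
      by (rule sat_cong) (use \<phi>(2) in auto)
    finally show ?thesis using sat_expansion_fam_free[OF \<phi>(1)] by simp
  qed
  moreover have "sat ?B par_val ?e (extends_some_fm True n a b) \<longleftrightarrow>
      (\<exists>t\<in>univ (cut M n). t \<in> T True a b \<and> sat ?B par_val (case_nat t ?e) (extends_fm (Par n) (Var 0)))"
    using ab abC by (simp add: extends_some_fm_def family_rel_def)
  moreover have "sat ?B par_val (case_nat t ?e) (extends_fm (Par n) (Var 0)) \<longleftrightarrow> R_extends t"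
    if "t \<in> T True a b" for t
    by (rule sat_extends_expansion) (use that T in auto)
  ultimately show ?thesis using T Conds_in_cut by blast
qed

end

section \<open>The move of PHP and the failure of injectivity\<close>

theorem theorem3p9:
  fixes M :: "'m arith" and n p h s :: 'm and \<phi> :: "'m fm"
    and T :: "bool \<Rightarrow> 'm \<Rightarrow> 'm \<Rightarrow> 'm set" and c :: nat
  assumes "true_arith_model M" and "countable (univ M)"
    and "n \<in> univ M" and "\<not> standard M n"
    and "delta_b1 \<phi>" and "params \<phi> \<subseteq> univ (cut M n)" and "fv \<phi> \<subseteq> {0, 1}"
    and "p \<in> univ (cut M n)" and "h \<in> univ (cut M n)" and "s \<in> Conds M n"
    and "definable_family M p h T True" and "definable_family M p h T False"
    and "\<And>a b. a \<in> below M p \<Longrightarrow> b \<in> below M h \<Longrightarrow>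
           T True a b \<inter> T False a b = {} \<and>
           is_tree M n s (T True a b \<union> T False a b) \<and>
           depth_le M n s (T True a b \<union> T False a b) (len_pow M n c)"
    and "\<And>a b. a \<in> below M p \<Longrightarrow> b \<in> below M h \<Longrightarrow>
           proves (S12 \<union> diagram M n (family_rel M p h T)) {}
             (Imp (And (Neg (MIN_fm (Par n))) (extends_fm (Par n) (Par s)))
                  (Iff (inst2 \<phi> a b) (extends_some_fm True n a b)))"
    and "\<And>a b. a \<in> below M p \<Longrightarrow> b \<in> below M h \<Longrightarrow>
           proves (S12 \<union> diagram M n (family_rel M p h T)) {}
             (Imp (And (Neg (MIN_fm (Par n))) (extends_fm (Par n) (Par s)))
                  (Iff (Neg (inst2 \<phi> a b)) (extends_some_fm False n a b)))"
    and "(\<exists>a\<in>below M p. \<exists>b\<in>below M p. \<exists>d\<in>below M h. a \<noteq> b \<and>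
            (\<exists>s'\<in>T True a d. \<exists>s''\<in>T True b d. compatible M n s' s'')) \<or>
         (\<exists>a\<in>below M p. \<exists>b\<in>below M h. \<exists>d\<in>below M h. b \<noteq> d \<and>
            (\<exists>s'\<in>T True a b. \<exists>s''\<in>T True a d. compatible M n s' s'')) \<or>
         (\<exists>s'\<in>Conds M n. extends M n s' s \<and>
            (\<exists>a\<in>below M p. \<forall>b\<in>below M h. \<forall>s''\<in>T True a b. \<not> compatible M n s' s''))"
  shows "\<exists>t\<in>Conds M n. extends M n t s \<and>
           (\<forall>q S ps. range q = below M n \<and> winning_IND M n S \<and> is_play M n ps \<and>
              follows 0 (strategy_MIN M n q) ps \<and> follows 1 S ps \<and>
              (\<exists>k. k mod 3 = 2 \<and> ps (Suc k) = t) \<longrightarrow>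
              \<not> defines_injection (cut_tri M n (play_order M n ps)) \<phi> p h)"
proof -
  interpret nonstandard_model M n
    using assms(1,3,4) by unfold_locales
  have \<phi>: "fam_free \<phi>" using assms(5) sigma_b1_fam_free by (auto simp: delta_b1_def)
  have T_Conds: "T True a b \<subseteq> Conds M n" and T_ext: "\<forall>t\<in>T True a b. extends M n t s"
    if "a \<in> below M p" "b \<in> below M h" for a b
    using assms(13)[OF that] tree_extends[of s "T True a b \<union> T False a b"]
    by (auto simp: is_tree_def)
  have grow: "\<exists>t\<in>Conds M n. extends M n t w \<and> (\<exists>x\<in>univ M. \<exists>y\<in>univ M. seq_prec M n t x y)"
    if w: "w \<in> Conds M n" for w
  proof (cases "\<exists>x\<in>univ M. \<exists>y\<in>univ M. seq_prec M n w x y")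
    case True
    then show ?thesis using w extends_refl[of M n w] by blast
  next
    case False
    \<comment> \<open>Here w induces the empty order, so every sequence extends it.\<close>
    then show ?thesis using two_element_cond by (auto simp: extends_def)
  qed
  let ?ext = "\<lambda>R w. \<forall>x\<in>univ M. \<forall>y\<in>univ M. seq_prec M n w x y \<longrightarrow> R x y"
  \<comment> \<open>\<open>graph\<close> expresses injectivity through the trees alone. This allows
    w to be chosen before any play is given, against every asymmetric relation extending it.\<close>
  define graph where "graph R f \<longleftrightarrow> f ` below M p \<subseteq> below M h \<and> inj_on f (below M p) \<and>
    (\<forall>x\<in>below M p. \<forall>y\<in>below M h. (\<exists>t\<in>T True x y. ?ext R t) \<longleftrightarrow> y = f x)"
    for R :: "'m \<Rightarrow> 'm \<Rightarrow> bool" and f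
  have ext_mono: "?ext R w" if "?ext R t" "extends M n t w" for R t w
    using that unfolding extends_def by blast
  have "\<exists>w\<in>Conds M n. extends M n w s \<and> (\<forall>R f. (\<forall>x\<in>univ M. \<forall>y\<in>univ M. \<not> (R x y \<and> R y x)) \<longrightarrow>
      ?ext R w \<longrightarrow> \<not> graph R f)"
    using assms(16)
  proof (elim disjE bexE conjE)
    fix a b d s' s''
    assume ab: "a \<in> below M p" "b \<in> below M p" "d \<in> below M h" "a \<noteq> b"
      and s': "s' \<in> T True a d" "s'' \<in> T True b d" "compatible M n s' s''"
    then obtain w where w: "w \<in> Conds M n" "extends M n w s'" "extends M n w s''"
      unfolding compatible_def by blast
    have "extends M n w s" using T_ext[OF ab(1,3)] s'(1) w(2) extends_trans[of M n w s' s] by blast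
    moreover have "\<not> graph R f" if "?ext R w" for R f
    proof
      assume "graph R f"
      moreover have "\<exists>t\<in>T True a d. ?ext R t" "\<exists>t\<in>T True b d. ?ext R t"
        using ext_mono[OF that w(2)] ext_mono[OF that w(3)] s' by blast+
      ultimately have "d = f a" "d = f b" "inj_on f (below M p)" using ab unfolding graph_def by blast+
      then show False using ab by (simp add: inj_on_def)
    qed
    ultimately show ?thesis using w(1) by blast
  next
    fix a b d s' s''
    assume ab: "a \<in> below M p" "b \<in> below M h" "d \<in> below M h" "b \<noteq> d"
      and s': "s' \<in> T True a b" "s'' \<in> T True a d" "compatible M n s' s''"
    then obtain w where w: "w \<in> Conds M n" "extends M n w s'" "extends M n w s''"
      unfolding compatible_def by blast
    have "extends M n w s" using T_ext[OF ab(1,2)] s'(1) w(2) extends_trans[of M n w s' s] by blast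
    moreover have "\<not> graph R f" if "?ext R w" for R f
    proof
      assume "graph R f"
      moreover have "\<exists>t\<in>T True a b. ?ext R t" "\<exists>t\<in>T True a d. ?ext R t"
        using ext_mono[OF that w(2)] ext_mono[OF that w(3)] s' by blast+
      ultimately have "b = f a" "d = f a" using ab unfolding graph_def by blast+
      then show False using ab by simp
    qed
    ultimately show ?thesis using w(1) by blast
  next
    fix s' a
    assume s': "s' \<in> Conds M n" "extends M n s' s" and a: "a \<in> below M p"
      and incomp: "\<forall>b\<in>below M h. \<forall>s''\<in>T True a b. \<not> compatible M n s' s''"
    have "\<not> graph R f" if asym: "\<forall>x\<in>univ M. \<forall>y\<in>univ M. \<not> (R x y \<and> R y x)" and "?ext R s'" for R f
    proof
      assume "graph R f"
      then have f: "f a \<in> below M h" "\<exists>t\<in>T True a (f a). ?ext R t"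
        using a unfolding graph_def by blast+
      then obtain t where t: "t \<in> T True a (f a)" "?ext R t" by blast
      \<comment> \<open>The asymmetric relation \<open>R\<close> contains the orders of both s' and
        t, so these cannot conflict.\<close>
      have "compatible M n s' t"
        using T_Conds[OF a f(1)] s'(1) t that by (intro compatible_if_no_conflict) blast+
      then show False using incomp f(1) t(1) by blast
    qed
    then show ?thesis using s' by blast
  qed
  then obtain w where w: "w \<in> Conds M n" "extends M n w s"
    "\<And>R f. \<forall>x\<in>univ M. \<forall>y\<in>univ M. \<not> (R x y \<and> R y x) \<Longrightarrow> ?ext R w \<Longrightarrow> \<not> graph R f"
    by blast
  text \<open>Sequences of length at most \<open>1\<close> impose nothing on the later moves, so PHP plays an extension
    of \<open>w\<close> with at least two entries.\<close>
  obtain t x0 y0 where t: "t \<in> Conds M n" "extends M n t w"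
    and xy: "x0 \<in> univ M" "y0 \<in> univ M" "seq_prec M n t x0 y0"
    using grow[OF w(1)] by blast
  show ?thesis
  proof (intro bexI[OF _ t(1)] conjI allI impI)
    show "extends M n t s" using extends_trans[OF t(2) w(2)] .
    fix q S ps
    assume "range q = below M n \<and> winning_IND M n S \<and> is_play M n ps \<and>
              follows 0 (strategy_MIN M n q) ps \<and> follows 1 S ps \<and>
              (\<exists>k. k mod 3 = 2 \<and> ps (Suc k) = t)"
    then obtain k where game: "range q = below M n" "winning_IND M n S" "is_play M n ps"
      "follows 0 (strategy_MIN M n q) ps" "follows 1 S ps" "ps (Suc k) = t"
      by blast
    then interpret MIN_play M n q ps k x0 y0
      using xy by unfold_locales auto
    have ind: "sigma_b1_induction (cut_tri M n R)"
      using game by (simp add: winning_IND_def)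
    have below: "below (cut_tri M n R) m = below M m" if "m \<in> univ (cut M n)" for m
      using below_in_cut[OF _ that] by (auto simp: below_def lt_of_def cut_univ)
    have "extends M n (ps (Suc k)) s" using extends_trans[OF t(2) w(2)] game(6) by simp
    then have iff: "sat (cut_tri M n R) id (case_nat a (\<lambda>_. b)) \<phi> \<longleftrightarrow> (\<exists>t\<in>T True a b. R_extends t)"
      if "a \<in> below M p" "b \<in> below M h" for a b
      using formula_iff_family[OF ind \<phi> assms(6,8,9,10) _ that T_Conds[OF that] assms(14)[OF that]]
      by blast
    have "\<forall>x\<in>univ M. \<forall>y\<in>univ M. \<not> (R x y \<and> R y x)"
      using R_irrefl R_trans by blast
    moreover have "R_extends w" using R_extends_if_extended[of "Suc k" w] t(2) game(6) by simp
    ultimately have "\<not> graph R f" for f by (rule w(3))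
    then show "\<not> defines_injection (cut_tri M n (play_order M n ps)) \<phi> p h"
      unfolding defines_injection_def below[OF assms(8)] below[OF assms(9)] graph_def
      using iff by (simp cong: conj_cong)
  qed
qed

end
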